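(* Let $\mathbf{T}$ be a vector tree of infinite height and let $\mathcal{P}$ be a Souslin measurable subset of $\mathcal{U}(\mathbf{T})$. Let $\mathbf{D}$ be a dense vector subset of $\mathbf{T}$ and let $\mathbf{U}$ be a $\mathbf{D}$-subspace of $\mathcal{U}(\mathbf{T})$. Then there exists a subspace $\mathbf{U}'$ of $\mathcal{U}(\mathbf{T})$ with $\mathbf{U}'\leqslant\mathbf{U}$ such that either (i) $[\mathbf{U}']\subseteq\mathcal{P}$ and $\mathbf{D}(\mathbf{U}')$ is a dense vector subset of $\mathbf{T}$, or (ii) $[\mathbf{U}']\subseteq\mathcal{P}^c$ and $\mathbf{D}(\mathbf{U}')$ is a $\mathbf{t}$-dense vector subset of $\mathbf{T}$ for some $\mathbf{t}\in\otimes\mathbf{T}$.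
   Context: Trees. A tree is a partially ordered set $(T,\leqslant_T)$ with a minimum (root), such that for every $t\in T$ the set of strict predecessors $\{s\in T: s<_T t\}$ is finite and well ordered, every non-maximal $t$ has finitely many immediate successors, and all maximal chains have the same cardinality, called the height $h(T)$ of $T$. Infinite height means $h(T)=\omega$ (so there are no maximal nodes). $\ell_T(t)$ is the number of strict predecessors of $t$, $T(n)=\{t\in T:\ell_T(t)=n\}$, and $\mathrm{Succ}_T(t)=\{t'\in T: t\leqslant_T t'\}$, itself a tree with the induced order. For $D\subseteq T$, $L_T(D)=\{n<h(T): T(n)\cap D\neq\emptyset\}$. A level subset of $T$ is a nonempty subset of some $T(n)$. A level subset $D_1$ dominates a level subset $D_2$ if for every $t\in D_2$ there is $s\in D_1$ with $t\leqslant_T s$. If $T$ has infinite height, $D\subseteq T$ is dense in $T$ if $L_T(D)=\{\ell_0<\ell_1<\dots\}$ is infinite and $D\cap T(\ell_k)$ dominates $T(k)$ for every $k\in\omega$. For $t\in T$, $D$ is $t$-dense if $D\cap\mathrm{Succ}_T(t)$ is dense in the tree $\mathrm{Succ}_T(t)$. Vector trees. A vector tree $\mathbf{T}=(T_1,\dots,T_d)$ ($d\geq 1$) is a finite sequence of trees of the same height $h(\mathbf{T})$. Its level product is $\otimes\mathbf{T}=\bigcup_{n<h(\mathbf{T})}T_1(n)\times\dots\times T_d(n)$, ordered coordinatewise. A vector subset of $\mathbf{T}$ is $\mathbf{D}=(D_1,\dots,D_d)$ with $D_i\subseteq T_i$ and $L_{T_i}(D_i)=L_{T_j}(D_j)$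 for all $i,j$; its level product is $\otimes\mathbf{D}=\bigcup_{n<h(\mathbf{T})}(D_1\cap T_1(n))\times\dots\times(D_d\cap T_d(n))$. For $\mathbf{T}$ of infinite height, $\mathbf{D}$ is dense if each $D_i$ is dense in $T_i$; for $\mathbf{t}=(t_1,\dots,t_d)\in\otimes\mathbf{T}$, $\mathbf{D}$ is $\mathbf{t}$-dense if each $D_i$ is $t_i$-dense in $T_i$. The space $\mathcal{U}(\mathbf{T})$. $\mathcal{U}(\mathbf{T})=\{U\subseteq\otimes\mathbf{T}: U\text{ has a minimum}\}$ (minimum with respect to the coordinatewise order), with the topology induced from the product topology on $\{0,1\}^{\otimes\mathbf{T}}$ ($\{0,1\}$ discrete). For a vector subset $\mathbf{D}$ of $\mathbf{T}$, a $\mathbf{D}$-subspace of $\mathcal{U}(\mathbf{T})$ is a family $\mathbf{U}=(U_{\mathbf{t}})_{\mathbf{t}\in\otimes\mathbf{D}}$ of pairwise disjoint elements of $\mathcal{U}(\mathbf{T})$ with $\min U_{\mathbf{t}}=\mathbf{t}$ for all $\mathbf{t}\in\otimes\mathbf{D}$. A subspace of $\mathcal{U}(\mathbf{T})$ is a $\mathbf{D}$-subspace for some vector subset $\mathbf{D}$, denoted $\mathbf{D}(\mathbf{U})$. The span of $\mathbf{U}$ is $[\mathbf{U}]=\{\bigcup_{\mathbf{t}\in\Gamma}U_{\mathbf{t}}:\Gamma\subseteq\otimes\mathbf{D}(\mathbf{U})\}\cap\mathcal{U}(\mathbf{T})$. Write $\mathbf{U}'\leqslant\mathbf{U}$ if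 $[\mathbf{U}']\subseteq[\mathbf{U}]$. Souslin measurability. The Souslin measurable subsets of a topological space are the members of the smallest algebra of subsets that contains all open sets and is closed under the Souslin operation $(X_s)_{s\in\omega^{<\infty}}\mapsto\bigcup_{\sigma\in\omega^\omega}\bigcap_{n\in\omega}X_{\sigma\upharpoonright n}$, where $\omega^{<\infty}$ is the set of finite sequences in $\omega$. *)

theory Defs
  imports
    "HOL-Analysis.Analysis"
    "HOL-Library.Infinite_Set"
    "HOL-Library.Extended_Nat"
    "HOL-Library.Equipollence"
begin

section \<open>Trees\<close>

text \<open>
  A tree is given by its order, a reflexive relation \<open>T\<close> with carrier \<^term>\<open>Field T\<close>;
  \<open>(s, t) \<in> T\<close> means that \<open>s\<close> is below or equal to \<open>t\<close>. The strict predecessors of \<open>t\<close> are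
  \<^term>\<open>underS T t\<close>.
\<close>

definition max_chains :: "'a rel \<Rightarrow> 'a set set" where
  "max_chains T = {C \<in> Chains T. \<forall>C' \<in> Chains T. C \<subseteq> C' \<longrightarrow> C' = C}"

definition imm_succs :: "'a rel \<Rightarrow> 'a \<Rightarrow> 'a set" where
  "imm_succs T t = {s \<in> aboveS T t. \<not> (\<exists>u. u \<in> aboveS T t \<and> s \<in> aboveS T u)}"

definition is_tree :: "'a rel \<Rightarrow> bool" where
  "is_tree T \<longleftrightarrow>
     Partial_order T \<and>
     (\<exists>r \<in> Field T. \<forall>t \<in> Field T. (r, t) \<in> T) \<and>
     (\<forall>t \<in> Field T. finite (underS T t) \<and> well_order_on (underS T t) (Restr T (underS T t))) \<and>
     (\<forall>t \<in> Field T. aboveS T t \<noteq> {} \<longrightarrow> finite (imm_succs T t)) \<and>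
     (\<forall>C \<in> max_chains T. \<forall>C' \<in> max_chains T. C \<approx> C')"

text \<open>
  Chains in a tree are countable because predecessor sets are finite, so the common
  cardinality of the maximal chains is a natural number or omega, the latter written \<open>\<infinity>\<close>.
\<close>

definition tree_height :: "'a rel \<Rightarrow> enat" where
  "tree_height T = (THE h. \<forall>C \<in> max_chains T. h = (if finite C then enat (card C) else \<infinity>))"

definition level :: "'a rel \<Rightarrow> nat \<Rightarrow> 'a set" where
  "level T n = {t \<in> Field T. card (underS T t) = n}"

definition succ_tree :: "'a rel \<Rightarrow> 'a \<Rightarrow> 'a rel" where
  "succ_tree T t = Restr T (above T t)"

definition level_set :: "'a rel \<Rightarrow> 'a set \<Rightarrow> nat set" where
  "level_set T D = {n. enat n < tree_height T \<and> level T n \<inter> D \<noteq> {}}"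

definition dominates :: "'a rel \<Rightarrow> 'a set \<Rightarrow> 'a set \<Rightarrow> bool" where
  "dominates T D1 D2 \<longleftrightarrow> (\<forall>t \<in> D2. \<exists>s \<in> D1. (t, s) \<in> T)"

text \<open>\<open>enumerate L k\<close> is the \<open>k\<close>-th element, in increasing order, of the infinite set \<open>L\<close>.\<close>

definition dense_in :: "'a rel \<Rightarrow> 'a set \<Rightarrow> bool" where
  "dense_in T D \<longleftrightarrow>
     D \<subseteq> Field T \<and> infinite (level_set T D) \<and>
     (\<forall>k. dominates T (D \<inter> level T (enumerate (level_set T D) k)) (level T k))"

text \<open>The levels of \<open>D\<close> are computed here inside the successor tree, not inside \<open>T\<close>.\<close>

definition dense_above :: "'a rel \<Rightarrow> 'a \<Rightarrow> 'a set \<Rightarrow> bool" where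
  "dense_above T t D \<longleftrightarrow> dense_in (succ_tree T t) (D \<inter> Field (succ_tree T t))"


section \<open>Vector trees\<close>

definition vector_tree :: "'a rel list \<Rightarrow> bool" where
  "vector_tree Ts \<longleftrightarrow>
     Ts \<noteq> [] \<and> (\<forall>T \<in> set Ts. is_tree T) \<and>
     (\<forall>S \<in> set Ts. \<forall>T \<in> set Ts. tree_height S = tree_height T)"

definition vheight :: "'a rel list \<Rightarrow> enat" where
  "vheight Ts = tree_height (hd Ts)"

definition tree_product :: "'a rel list \<Rightarrow> 'a list set" where
  "tree_product Ts = (\<Union>n \<in> {n. enat n < vheight Ts}. listset (map (\<lambda>T. level T n) Ts))"

definition coord_le :: "'a rel list \<Rightarrow> 'a list \<Rightarrow> 'a list \<Rightarrow> bool" where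
  "coord_le Ts s t \<longleftrightarrow>
     length s = length Ts \<and> length t = length Ts \<and> (\<forall>i < length Ts. (s ! i, t ! i) \<in> Ts ! i)"

definition vector_subset :: "'a rel list \<Rightarrow> 'a set list \<Rightarrow> bool" where
  "vector_subset Ts Ds \<longleftrightarrow>
     length Ds = length Ts \<and>
     (\<forall>i < length Ts. Ds ! i \<subseteq> Field (Ts ! i)) \<and>
     (\<forall>i < length Ts. \<forall>j < length Ts. level_set (Ts ! i) (Ds ! i) = level_set (Ts ! j) (Ds ! j))"

definition level_product :: "'a rel list \<Rightarrow> 'a set list \<Rightarrow> 'a list set" where
  "level_product Ts Ds =
     (\<Union>n \<in> {n. enat n < vheight Ts}. listset (map2 (\<lambda>T D. D \<inter> level T n) Ts Ds))"

definition dense_vector_subset :: "'a rel list \<Rightarrow> 'a set list \<Rightarrow> bool" where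
  "dense_vector_subset Ts Ds \<longleftrightarrow>
     vector_subset Ts Ds \<and> (\<forall>i < length Ts. dense_in (Ts ! i) (Ds ! i))"

definition dense_vector_subset_above :: "'a rel list \<Rightarrow> 'a list \<Rightarrow> 'a set list \<Rightarrow> bool" where
  "dense_vector_subset_above Ts t Ds \<longleftrightarrow>
     vector_subset Ts Ds \<and> (\<forall>i < length Ts. dense_above (Ts ! i) (t ! i) (Ds ! i))"


section \<open>The space of sets with a minimum\<close>

definition is_minimum :: "'a rel list \<Rightarrow> 'a list set \<Rightarrow> 'a list \<Rightarrow> bool" where
  "is_minimum Ts U m \<longleftrightarrow> m \<in> U \<and> (\<forall>u \<in> U. coord_le Ts m u)"

definition min_sets :: "'a rel list \<Rightarrow> 'a list set set" where
  "min_sets Ts = {U. U \<subseteq> tree_product Ts \<and> (\<exists>m. is_minimum Ts U m)}"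

text \<open>
  The topology induced from the product of discrete two-point spaces, sets being identified
  with their characteristic functions (library products consist of extensional functions).
\<close>

definition min_sets_topology :: "'a rel list \<Rightarrow> 'a list set topology" where
  "min_sets_topology Ts =
     pullback_topology (min_sets Ts) (\<lambda>U. restrict (\<lambda>t. t \<in> U) (tree_product Ts))
       (product_topology (\<lambda>_. discrete_topology (UNIV :: bool set)) (tree_product Ts))"

text \<open>
  A subspace is given by a vector subset \<open>Ds\<close> and a family \<open>U\<close>; only the values of \<open>U\<close> on
  \<^term>\<open>level_product Ts Ds\<close> are relevant.
\<close>

definition is_subspace :: "'a rel list \<Rightarrow> 'a set list \<Rightarrow> ('a list \<Rightarrow> 'a list set) \<Rightarrow> bool" where
  "is_subspace Ts Ds U \<longleftrightarrow>
     vector_subset Ts Ds \<and>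
     (\<forall>t \<in> level_product Ts Ds. U t \<in> min_sets Ts \<and> is_minimum Ts (U t) t) \<and>
     disjoint_family_on U (level_product Ts Ds)"

definition subspace_span ::
    "'a rel list \<Rightarrow> 'a set list \<Rightarrow> ('a list \<Rightarrow> 'a list set) \<Rightarrow> 'a list set set" where
  "subspace_span Ts Ds U =
     {(\<Union>t \<in> \<Gamma>. U t) | \<Gamma>. \<Gamma> \<subseteq> level_product Ts Ds} \<inter> min_sets Ts"


section \<open>Souslin measurability\<close>

definition souslin_op :: "(nat list \<Rightarrow> 'b set) \<Rightarrow> 'b set" where
  "souslin_op X = (\<Union>\<sigma> :: nat \<Rightarrow> nat. \<Inter>n :: nat. X (map \<sigma> [0..<n]))"

definition souslin_measurable_sets :: "'b topology \<Rightarrow> 'b set set" where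
  "souslin_measurable_sets X =
     \<Inter>{M. algebra (topspace X) M \<and> {S. openin X S} \<subseteq> M \<and>
         (\<forall>F. range F \<subseteq> M \<longrightarrow> souslin_op F \<in> M)}"

end

theory Submission
  imports Defs "HOL-Library.Sublist"
begin

text \<open>
  The elements of the span of a subspace are given by their index sets: the subsets of a level product that
  have a minimum. Under the topology of pointwise convergence, the index sets with a given minimum form a
  Cantor space. Souslin measurable sets have the Baire property (\<open>souslin_measurable_baire\<close>). Hence there is a
  sequence of nowhere dense sets such that densely many basic open sets decide membership in \<open>P\<close> for all their points
  outside these sets.
  
  A fusion (\<open>fusion\<close>) turns this into a subspace in which membership in \<open>P\<close> depends only on the minimum of a union.
  Levels are retained one at a time; an index strictly between two retained levels is either discarded or given to a
  smaller retained index, its owner, whose set is enlarged accordingly. For each of the finitely many sets of retained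
  indices that are possible so far, elements given to its least index steer the union into a prescribed dense open
  set. The decision about \<open>P\<close> for unions with minimum \<open>t\<close> is made directly after the level of \<open>t\<close>: there,
  \<open>t\<close> is the only index involved, because all others lie strictly higher. So the decision is the same for all these
  unions.
  
  What remains is a two-colouring of the level product of a dense vector subset, and the two alternatives of the
  theorem are those of the asymmetric Halpern-Lauchli theorem (\<open>Halpern_Lauchli\<close>): one colour contains the level
  product of a dense vector subset, or the other one contains that of a vector subset which is dense above some tuple.
  Every finitely branching tree of infinite height is a level-preserving monotone image of a tree of sequences, so it suffices to treat
  trees of sequences, by induction on their number. The step from \<open>d\<close> to \<open>d + 1\<close> trees (\<open>HLweak_Suc\<close>) uses the
  theorem for \<open>d\<close> trees twice: to let the colour along countably many branches of the last tree depend on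
  initial parts of the other coordinates only, and to show that one colour is attained persistently.
\<close>

section \<open>Trees of sequences\<close>

definition alphabet :: "(nat \<Rightarrow> nat set) \<Rightarrow> bool" where
  "alphabet B \<longleftrightarrow> (\<forall>j. finite (B j) \<and> B j \<noteq> {})"

text \<open>
  \<open>B j\<close> is the set of letters admitted at position \<open>j\<close>. Since it depends on the position alone, the trees
  above any two nodes of one level coincide, and one subtree can be copied above all of them.
\<close>

definition seqs :: "(nat \<Rightarrow> nat set) \<Rightarrow> nat \<Rightarrow> nat list set" where
  "seqs B n = {s. length s = n \<and> (\<forall>j<n. s ! j \<in> B j)}"

text \<open>
  Coordinates from \<open>d\<close> on are empty. A tuple for \<open>Suc d\<close> trees is then \<open>x(d := u)\<close> with \<open>x\<close> a tuple for
  \<open>d\<close> trees, and tuples of all dimensions have one type, which the induction on \<open>d\<close> relies on.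
\<close>

definition tups :: "(nat \<Rightarrow> nat set) \<Rightarrow> nat \<Rightarrow> nat \<Rightarrow> (nat \<Rightarrow> nat list) set" where
  "tups B d n = {x. (\<forall>i<d. x i \<in> seqs B n) \<and> (\<forall>i\<ge>d. x i = [])}"

definition tup_le :: "(nat \<Rightarrow> nat list) \<Rightarrow> (nat \<Rightarrow> nat list) \<Rightarrow> bool" where
  "tup_le x y \<longleftrightarrow> (\<forall>i. prefix (x i) (y i))"

definition map_tup :: "(nat \<Rightarrow> nat list \<Rightarrow> nat list) \<Rightarrow> (nat \<Rightarrow> nat list) \<Rightarrow> nat \<Rightarrow> nat list" where
  "map_tup \<phi> x = (\<lambda>i. \<phi> i (x i))"

text \<open>
  The last clause keeps the images of tuples inside \<^const>\<open>tups\<close>: coordinates from \<open>d\<close> on stay empty.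
\<close>

definition lift :: "(nat \<Rightarrow> nat set) \<Rightarrow> nat \<Rightarrow> nat \<Rightarrow> nat \<Rightarrow> (nat \<Rightarrow> nat list \<Rightarrow> nat list) \<Rightarrow> bool" where
  "lift B d k m \<phi> \<longleftrightarrow> k \<le> m \<and>
     (\<forall>i<d. \<forall>s\<in>seqs B k. \<phi> i s \<in> seqs B m \<and> prefix s (\<phi> i s)) \<and> (\<forall>i\<ge>d. \<phi> i [] = [])"

text \<open>
  The finite form of a monochromatic set that is dense above \<open>t\<close>: it dominates level \<open>k\<close>. Colourings get
  the level as an argument of its own because the empty tuple (\<open>d = 0\<close>) does not determine it.
\<close>

definition mono_lift :: "(nat \<Rightarrow> nat set) \<Rightarrow> nat \<Rightarrow> (nat \<Rightarrow> (nat \<Rightarrow> nat list) \<Rightarrow> bool) \<Rightarrow>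
    (nat \<Rightarrow> nat list) \<Rightarrow> nat \<Rightarrow> bool \<Rightarrow> bool" where
  "mono_lift B d c t k \<epsilon> \<longleftrightarrow>
     (\<exists>m \<phi>. lift B d k m \<phi> \<and> (\<forall>x\<in>tups B d k. tup_le t x \<longrightarrow> c m (map_tup \<phi> x) = \<epsilon>))"

definition pad :: "(nat \<Rightarrow> nat set) \<Rightarrow> nat \<Rightarrow> nat list \<Rightarrow> nat list" where
  "pad B k s = s @ map (\<lambda>j. SOME v. v \<in> B j) [length s..<k]"

definition padt :: "(nat \<Rightarrow> nat set) \<Rightarrow> nat \<Rightarrow> nat \<Rightarrow> nat \<Rightarrow> nat list \<Rightarrow> nat list" where
  "padt B d k i s = (if i < d then pad B k s else s)"

lemma length_seqs: "s \<in> seqs B n \<Longrightarrow> length s = n"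
  by (simp add: seqs_def)

lemma seqs_0 [simp]: "seqs B 0 = {[]}"
  by (auto simp: seqs_def)

lemma seqs_snoc [simp]: "s @ [v] \<in> seqs B (Suc n) \<longleftrightarrow> s \<in> seqs B n \<and> v \<in> B n"
  by (auto simp: seqs_def nth_append less_Suc_eq split: if_splits)

lemma seqs_SucE:
  assumes "s \<in> seqs B (Suc n)"
  obtains r v where "s = r @ [v]" "r \<in> seqs B n" "v \<in> B n"
proof -
  have "s \<noteq> []" using assms by (auto simp: seqs_def)
  then obtain r v where "s = r @ [v]" by (metis append_butlast_last_id)
  then show ?thesis using assms that by auto
qed

lemma seqs_prefix_snoc:
  assumes "p \<in> seqs B n" "s \<in> seqs B (Suc n)" "prefix p s"
  shows "\<exists>v\<in>B n. s = p @ [v]"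
proof -
  obtain r v where s: "s = r @ [v]" "r \<in> seqs B n" "v \<in> B n"
    using assms(2) by (rule seqs_SucE)
  obtain z where "r @ [v] = p @ z" using s assms(3) by (auto simp: prefix_def)
  then have "p = r" using length_seqs[OF assms(1)] length_seqs[OF s(2)] by (simp add: append_eq_append_conv)
  then show ?thesis using s by blast
qed

lemma seqs_cong: "(\<And>j. j < n \<Longrightarrow> B j = B' j) \<Longrightarrow> seqs B n = seqs B' n"
  by (auto simp: seqs_def)

lemma take_seqs: "s \<in> seqs B n \<Longrightarrow> m \<le> n \<Longrightarrow> take m s \<in> seqs B m"
  by (auto simp: seqs_def)

lemma append_seqs: "s \<in> seqs B n \<Longrightarrow> r \<in> seqs (\<lambda>j. B (n + j)) m \<Longrightarrow> s @ r \<in> seqs B (n + m)"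
  by (force simp: seqs_def nth_append dest: spec[of _ "_ - length s"])

lemma drop_seqs: "s \<in> seqs B (n + m) \<Longrightarrow> drop n s \<in> seqs (\<lambda>j. B (n + j)) m"
  by (auto simp: seqs_def)

lemma finite_seqs:
  assumes "alphabet B" shows "finite (seqs B n)"
proof (rule finite_subset)
  show "seqs B n \<subseteq> {s. set s \<subseteq> (\<Union>j<n. B j) \<and> length s = n}"
    by (fastforce simp: seqs_def set_conv_nth)
  show "finite {s. set s \<subseteq> (\<Union>j<n. B j) \<and> length s = n}"
    using assms by (intro finite_lists_length_eq) (auto simp: alphabet_def)
qed

lemma finite_tups:
  assumes "alphabet B" shows "finite (tups B d n)"
proof -
  have "finite {x. \<forall>i. (i \<in> {..<d} \<longrightarrow> x i \<in> seqs B n) \<and> (i \<notin> {..<d} \<longrightarrow> x i = [])}"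
    by (rule finite_set_of_finite_funs[OF finite_lessThan finite_seqs[OF assms]])
  moreover have "tups B d n \<subseteq> {x. \<forall>i. (i \<in> {..<d} \<longrightarrow> x i \<in> seqs B n) \<and> (i \<notin> {..<d} \<longrightarrow> x i = [])}"
    by (simp add: tups_def subset_iff)
  ultimately show ?thesis by (rule finite_subset[rotated])
qed

lemma pad_seqs:
  assumes "alphabet B" "s \<in> seqs B n" "n \<le> k" shows "pad B k s \<in> seqs B k"
proof -
  have "(SOME v. v \<in> B j) \<in> B j" for j
    using assms(1) by (simp add: alphabet_def some_in_eq)
  then show ?thesis using assms by (auto simp: pad_def seqs_def nth_append)
qed

lemma prefix_pad [simp]: "prefix s (pad B k s)"
  by (simp add: pad_def)

lemma tup_le_refl [simp]: "tup_le x x" by (simp add: tup_le_def)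
lemma tup_le_trans: "tup_le x y \<Longrightarrow> tup_le y z \<Longrightarrow> tup_le x z"
  unfolding tup_le_def using prefix_order.trans by blast

lemma seqs_nonempty: "alphabet B \<Longrightarrow> seqs B n \<noteq> {}"
  using pad_seqs[of B "[]" 0 n] by auto

lemma lift_tups:
  assumes "lift B d k m \<phi>" "x \<in> tups B d k"
  shows "map_tup \<phi> x \<in> tups B d m" "tup_le x (map_tup \<phi> x)"
proof -
  show "map_tup \<phi> x \<in> tups B d m" using assms by (auto simp: lift_def tups_def map_tup_def)
  show "tup_le x (map_tup \<phi> x)" unfolding tup_le_def map_tup_def
  proof
    fix i show "prefix (x i) (\<phi> i (x i))"
      using assms by (cases "i < d") (auto simp: lift_def tups_def)
  qed
qed

lemma lift_comp:
  assumes "lift B d k m \<phi>" "lift B d m n \<psi>"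
  shows "lift B d k n (\<lambda>i s. \<psi> i (\<phi> i s))"
  unfolding lift_def
proof (intro conjI allI impI ballI)
  show "k \<le> n" using assms by (simp add: lift_def)
  fix i s assume "i < d" "s \<in> seqs B k"
  then have "\<phi> i s \<in> seqs B m" "prefix s (\<phi> i s)" "\<psi> i (\<phi> i s) \<in> seqs B n"
    "prefix (\<phi> i s) (\<psi> i (\<phi> i s))" using assms by (auto simp: lift_def)
  then show "\<psi> i (\<phi> i s) \<in> seqs B n" "prefix s (\<psi> i (\<phi> i s))"
    using prefix_order.trans by blast+
qed (use assms in \<open>auto simp: lift_def\<close>)

lemma lift_padt: "alphabet B \<Longrightarrow> k \<le> m \<Longrightarrow> lift B d k m (padt B d m)"
  by (auto simp: lift_def padt_def pad_seqs)

lemma map_tup_comp: "map_tup (\<lambda>i s. \<psi> i (\<phi> i s)) x = map_tup \<psi> (map_tup \<phi> x)"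
  by (simp add: map_tup_def)

lemma lift_take:
  assumes L: "lift B d k m \<phi>" and x: "x \<in> tups B d k" and j: "j \<le> k"
  shows "take j (map_tup \<phi> x i) = take j (x i)"
proof (cases "i < d")
  case True
  then have "length (x i) = k" using x length_seqs by (auto simp: tups_def)
  moreover obtain r where "map_tup \<phi> x i = x i @ r"
    using lift_tups(2)[OF L x] by (auto simp: tup_le_def prefix_def)
  ultimately show ?thesis using j by simp
next
  case False
  then show ?thesis using x lift_tups(1)[OF L x] by (simp add: tups_def)
qed

text \<open>
  Nodes of a lower level may first be prolonged arbitrarily.
\<close>

lemma mono_lift_antimono:
  assumes "alphabet B" "mono_lift B d c t k \<epsilon>" "k' \<le> k" shows "mono_lift B d c t k' \<epsilon>"
proof -
  obtain m \<phi> where m: "lift B d k m \<phi>" "\<And>x. x \<in> tups B d k \<Longrightarrow> tup_le t x \<Longrightarrow> c m (map_tup \<phi> x) = \<epsilon>"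
    using assms(2) unfolding mono_lift_def by blast
  have p: "lift B d k' k (padt B d k)" using lift_padt assms by blast
  have "c m (map_tup (\<lambda>i s. \<phi> i (padt B d k i s)) x) = \<epsilon>" if "x \<in> tups B d k'" "tup_le t x" for x
    using m(2)[OF lift_tups(1)[OF p that(1)] tup_le_trans[OF that(2) lift_tups(2)[OF p that(1)]]]
    by (simp add: map_tup_comp)
  then show ?thesis unfolding mono_lift_def using lift_comp[OF p m(1)] by blast
qed

section \<open>Chosen levels as trees of blocks\<close>

text \<open>
  The nodes on levels \<open>kk 0 < kk 1 < \<dots>\<close> form a tree of sequences again once the letters between two
  consecutive chosen levels are coded as a single letter. An immediate successor in the new tree is an
  extension to the next chosen level in the old one.
\<close>

definition blocks :: "(nat \<Rightarrow> nat set) \<Rightarrow> (nat \<Rightarrow> nat) \<Rightarrow> nat \<Rightarrow> nat set" where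
  "blocks B kk m = list_encode ` seqs (\<lambda>j. B (kk m + j)) (kk (Suc m) - kk m)"

definition unblock :: "nat list \<Rightarrow> nat list" where
  "unblock a = concat (map list_decode a)"

lemma unblock_simps [simp]: "unblock [] = []" "unblock (a @ b) = unblock a @ unblock b"
  "unblock [v] = list_decode v"
  by (simp_all add: unblock_def)

lemma alphabet_shift: "alphabet B \<Longrightarrow> alphabet (\<lambda>j. B (f j))"
  by (simp add: alphabet_def)

lemma alphabet_blocks: "alphabet B \<Longrightarrow> alphabet (blocks B kk)"
  using finite_seqs[OF alphabet_shift] seqs_nonempty[OF alphabet_shift]
  unfolding alphabet_def[of "blocks B kk"] blocks_def by blast

lemma unblock_seqs:
  assumes "strict_mono kk" "kk 0 = 0" "a \<in> seqs (blocks B kk) n"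
  shows "unblock a \<in> seqs B (kk n)"
  using assms(3)
proof (induction n arbitrary: a)
  case 0 then show ?case using assms by simp
next
  case (Suc n)
  obtain r v where a: "a = r @ [v]" "r \<in> seqs (blocks B kk) n" "v \<in> blocks B kk n"
    using Suc.prems by (rule seqs_SucE)
  have le: "kk n \<le> kk (Suc n)" using assms(1) by (simp add: strict_mono_less_eq)
  have "list_decode v \<in> seqs (\<lambda>j. B (kk n + j)) (kk (Suc n) - kk n)"
    using a(3) by (auto simp: blocks_def)
  from append_seqs[OF Suc.IH[OF a(2)] this] show ?case using a le by simp
qed

lemma unblock_surj:
  assumes "strict_mono kk" "kk 0 = 0" "s \<in> seqs B (kk n)"
  shows "\<exists>a\<in>seqs (blocks B kk) n. unblock a = s"
  using assms(3)
proof (induction n arbitrary: s)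
  case 0 then show ?case using assms by simp
next
  case (Suc n)
  have le: "kk n \<le> kk (Suc n)" using assms(1) by (simp add: strict_mono_less_eq)
  obtain a where a: "a \<in> seqs (blocks B kk) n" "unblock a = take (kk n) s"
    using Suc.IH[OF take_seqs[OF Suc.prems le]] by blast
  let ?v = "list_encode (drop (kk n) s)"
  have "drop (kk n) s \<in> seqs (\<lambda>j. B (kk n + j)) (kk (Suc n) - kk n)"
    using drop_seqs[of s B "kk n" "kk (Suc n) - kk n"] Suc.prems le by simp
  then have "?v \<in> blocks B kk n" by (simp add: blocks_def)
  then show ?case using a by (intro bexI[of _ "a @ [?v]"]) auto
qed

lemma unblock_inj:
  assumes "strict_mono kk" "kk 0 = 0"
  shows "a \<in> seqs (blocks B kk) n \<Longrightarrow> b \<in> seqs (blocks B kk) n \<Longrightarrow> unblock a = unblock b \<Longrightarrow> a = b"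
proof (induction n arbitrary: a b)
  case 0 then show ?case by simp
next
  case (Suc n)
  obtain r v where a: "a = r @ [v]" "r \<in> seqs (blocks B kk) n"
    using Suc.prems(1) by (rule seqs_SucE)
  obtain r' v' where b: "b = r' @ [v']" "r' \<in> seqs (blocks B kk) n"
    using Suc.prems(2) by (rule seqs_SucE)
  have "length (unblock r) = length (unblock r')"
    using unblock_seqs[OF assms a(2)] unblock_seqs[OF assms b(2)] by (simp add: seqs_def)
  then have "unblock r = unblock r'" "list_decode v = list_decode v'"
    using Suc.prems(3) a b by auto
  then show ?case using Suc.IH[OF a(2) b(2)] a b by (metis list_decode_inverse)
qed

lemma unblock_prefix:
  assumes "strict_mono kk" "kk 0 = 0" "a \<in> seqs (blocks B kk) n" "b \<in> seqs (blocks B kk) m" "n \<le> m"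
    and "prefix (unblock a) (unblock b)"
  shows "prefix a b"
proof -
  have t: "take n b \<in> seqs (blocks B kk) n" using take_seqs assms by blast
  have "prefix (unblock (take n b)) (unblock b)"
    by (metis append_take_drop_id prefixI unblock_simps(2))
  moreover have "length (unblock (take n b)) = length (unblock a)"
    using unblock_seqs[OF assms(1,2) t] unblock_seqs[OF assms(1-3)] by (simp add: seqs_def)
  ultimately have "unblock (take n b) = unblock a"
    using assms(6) by (metis prefix_length_prefix order_refl prefix_order.antisym)
  then have "take n b = a" using unblock_inj[OF assms(1,2) t assms(3)] by simp
  then show ?thesis by (metis take_is_prefix)
qed

text \<open>
  Monochromatic lifts survive the decoding because \<^const>\<open>unblock\<close> is an order isomorphism onto the
  nodes on the chosen levels.
\<close>

lemma mono_lift_unblock: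
  assumes B: "alphabet B" and kk: "strict_mono kk" "kk 0 = 0"
    and t: "t \<in> tups (blocks B kk) d n" and na: "n \<le> a"
    and g: "mono_lift (blocks B kk) d (\<lambda>m x. c (kk m) (\<lambda>i. unblock (x i))) t a \<epsilon>"
  shows "(\<lambda>i. unblock (t i)) \<in> tups B d (kk n)" "mono_lift B d c (\<lambda>i. unblock (t i)) (kk a) \<epsilon>"
proof -
  let ?B = "blocks B kk"
  show "(\<lambda>i. unblock (t i)) \<in> tups B d (kk n)"
    using t unblock_seqs[OF kk] by (auto simp: tups_def)
  obtain m \<phi> where m: "lift ?B d a m \<phi>"
    "\<And>x. x \<in> tups ?B d a \<Longrightarrow> tup_le t x \<Longrightarrow> c (kk m) (\<lambda>i. unblock (map_tup \<phi> x i)) = \<epsilon>"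
    using g unfolding mono_lift_def by blast
  define e where "e s = (SOME b. b \<in> seqs ?B a \<and> unblock b = s)" for s
  have e: "e s \<in> seqs ?B a" "unblock (e s) = s" if "s \<in> seqs B (kk a)" for s
    using someI_ex[of "\<lambda>b. b \<in> seqs ?B a \<and> unblock b = s"] unblock_surj[OF kk that]
    unfolding e_def by blast+
  define \<psi> where "\<psi> i s = (if i < d then unblock (\<phi> i (e s)) else [])" for i s
  have am: "a \<le> m" using m(1) by (simp add: lift_def)
  have "prefix s (\<psi> i s)" "\<psi> i s \<in> seqs B (kk m)" if "i < d" "s \<in> seqs B (kk a)" for i s
  proof -
    have f: "\<phi> i (e s) \<in> seqs ?B m" "prefix (e s) (\<phi> i (e s))"
      using m(1) e[OF that(2)] that(1) by (auto simp: lift_def)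
    obtain r where "\<phi> i (e s) = e s @ r" using f(2) by (auto simp: prefix_def)
    then have "unblock (\<phi> i (e s)) = s @ unblock r" using e[OF that(2)] by simp
    then show "prefix s (\<psi> i s)" using that by (simp add: \<psi>_def)
    show "\<psi> i s \<in> seqs B (kk m)" using unblock_seqs[OF kk f(1)] that by (simp add: \<psi>_def)
  qed
  then have L: "lift B d (kk a) (kk m) \<psi>"
    using am kk(1) by (auto simp: lift_def strict_mono_less_eq \<psi>_def)
  have "c (kk m) (map_tup \<psi> x) = \<epsilon>" if x: "x \<in> tups B d (kk a)" "tup_le (\<lambda>i. unblock (t i)) x" for x
  proof -
    define y where "y i = (if i < d then e (x i) else [])" for i
    have y: "y \<in> tups ?B d a" using x e by (auto simp: y_def tups_def)
    have "prefix (t i) (y i)" for i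
    proof (cases "i < d")
      case True
      have "prefix (unblock (t i)) (unblock (y i))"
        using x e True by (auto simp: y_def tups_def tup_le_def)
      then show ?thesis using unblock_prefix[OF kk _ _ na, of "t i" B "y i"] t y True
        by (auto simp: tups_def)
    qed (use t in \<open>auto simp: tups_def y_def\<close>)
    then have "c (kk m) (\<lambda>i. unblock (map_tup \<phi> y i)) = \<epsilon>" using m(2)[OF y] by (simp add: tup_le_def)
    moreover have "(\<lambda>i. unblock (map_tup \<phi> y i)) = map_tup \<psi> x"
      using m(1) by (auto simp: map_tup_def \<psi>_def y_def lift_def)
    ultimately show ?thesis by simp
  qed
  then show "mono_lift B d c (\<lambda>i. unblock (t i)) (kk a) \<epsilon>" unfolding mono_lift_def using L by blast
qed

text \<open>
  A level has finitely many tuples, so if each of them fails at some height, one height works for the whole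
  level. Iteration yields chosen levels such that the failure shows at the next chosen level.
\<close>

lemma sparse_levels:
  assumes B: "alphabet B"
    and bad: "\<And>n t \<epsilon>. t \<in> tups B d n \<Longrightarrow> \<epsilon> \<in> E \<Longrightarrow> \<exists>k. \<not> mono_lift B d c t k \<epsilon>"
  shows "\<exists>kk. strict_mono kk \<and> kk 0 = 0 \<and>
    (\<forall>m. \<forall>t\<in>tups B d (kk m). \<forall>\<epsilon>\<in>E. \<not> mono_lift B d c t (kk (Suc m)) \<epsilon>)"
proof -
  have "\<exists>k>n. \<forall>t\<in>tups B d n. \<forall>\<epsilon>\<in>E. \<not> mono_lift B d c t k \<epsilon>" for n
  proof -
    obtain K where K: "\<And>t \<epsilon>. t \<in> tups B d n \<Longrightarrow> \<epsilon> \<in> E \<Longrightarrow> \<not> mono_lift B d c t (K t \<epsilon>) \<epsilon>"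
      using bad by metis
    have fin: "finite (insert (Suc n) ((\<lambda>(t, \<epsilon>). K t \<epsilon>) ` (tups B d n \<times> E)))"
      using finite_tups[OF B] finite_subset[of E UNIV] by auto
    let ?M = "Max (insert (Suc n) ((\<lambda>(t, \<epsilon>). K t \<epsilon>) ` (tups B d n \<times> E)))"
    have "?M \<ge> Suc n" using fin by simp
    moreover have "?M \<ge> K t \<epsilon>" if "t \<in> tups B d n" "\<epsilon> \<in> E" for t \<epsilon>
      using fin that by (intro Max_ge) auto
    ultimately have "?M > n \<and> (\<forall>t\<in>tups B d n. \<forall>\<epsilon>\<in>E. \<not> mono_lift B d c t ?M \<epsilon>)"
      using K mono_lift_antimono[OF B] by (simp add: Suc_le_lessD) blast
    then show ?thesis by blast
  qed
  then obtain h where h: "\<And>n. h n > n"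
    "\<And>n t \<epsilon>. t \<in> tups B d n \<Longrightarrow> \<epsilon> \<in> E \<Longrightarrow> \<not> mono_lift B d c t (h n) \<epsilon>" by metis
  define kk where "kk = rec_nat 0 (\<lambda>_. h)"
  have kk: "kk 0 = 0" "kk (Suc m) = h (kk m)" for m by (simp_all add: kk_def)
  have "strict_mono kk" using h(1) kk by (simp add: strict_mono_Suc_iff)
  then show ?thesis using kk h(2) by auto
qed

section \<open>Three forms of the Halpern-Lauchli theorem\<close>

text \<open>
  Three forms of the Halpern-Lauchli theorem for \<open>d\<close> trees. The weak form lifts only the immediate
  successors of one tuple, but it speaks about all alphabets, hence also about the trees of
  \<^const>\<open>blocks\<close>; this makes it as strong as the dense form.
\<close>

definition HLweak :: "nat \<Rightarrow> bool" where
  "HLweak d \<longleftrightarrow> (\<forall>B c. alphabet B \<longrightarrow> (\<exists>n. \<exists>t\<in>tups B d n. \<exists>\<epsilon>. mono_lift B d c t (Suc n) \<epsilon>))"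

definition HLdense :: "nat \<Rightarrow> bool" where
  "HLdense d \<longleftrightarrow> (\<forall>B c. alphabet B \<longrightarrow> (\<exists>n. \<exists>t\<in>tups B d n. \<exists>\<epsilon>. \<forall>k. mono_lift B d c t k \<epsilon>))"

text \<open>
  If the dense form failed, the weak form for the tree of blocks between sparse levels would produce a lift
  that those levels exclude.
\<close>

lemma HLdense_if_weak:
  assumes "HLweak d" shows "HLdense d"
  unfolding HLdense_def
proof (intro allI impI, rule ccontr)
  fix B c assume B: "alphabet B" and neg: "\<not> (\<exists>n. \<exists>t\<in>tups B d n. \<exists>\<epsilon>. \<forall>k. mono_lift B d c t k \<epsilon>)"
  obtain kk where kk: "strict_mono kk" "kk 0 = 0"
    and dead: "\<And>m t \<epsilon>. t \<in> tups B d (kk m) \<Longrightarrow> \<not> mono_lift B d c t (kk (Suc m)) \<epsilon>"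
    using sparse_levels[OF B, of d UNIV c] neg by auto
  obtain n t \<epsilon> where t: "t \<in> tups (blocks B kk) d n"
    and g: "mono_lift (blocks B kk) d (\<lambda>m x. c (kk m) (\<lambda>i. unblock (x i))) t (Suc n) \<epsilon>"
    using assms alphabet_blocks[OF B, of kk] unfolding HLweak_def by meson
  show False using mono_lift_unblock[OF B kk t _ g] dead by simp
qed

text \<open>
  An embedding of the tree with alphabets \<open>B (l j)\<close> onto a strong subtree with levels \<open>l 0 < l 1 < \<dots>\<close>:
  every immediate successor of the image of a node lies below the image of the corresponding successor.
\<close>

definition strong :: "(nat \<Rightarrow> nat set) \<Rightarrow> nat \<Rightarrow> (nat \<Rightarrow> nat) \<Rightarrow> (nat \<Rightarrow> nat list \<Rightarrow> nat list) \<Rightarrow> bool" where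
  "strong B d l G \<longleftrightarrow> strict_mono l \<and> (\<forall>i\<ge>d. G i [] = []) \<and>
     (\<forall>i<d. \<forall>n. \<forall>s\<in>seqs (\<lambda>j. B (l j)) n. G i s \<in> seqs B (l n) \<and>
        (\<forall>v\<in>B (l n). prefix (G i s @ [v]) (G i (s @ [v]))))"

definition HLstrong :: "nat \<Rightarrow> bool" where
  "HLstrong d \<longleftrightarrow> (\<forall>B (c :: nat \<Rightarrow> (nat \<Rightarrow> nat list) \<Rightarrow> bool). alphabet B \<longrightarrow> (\<exists>G l \<epsilon>. strong B d l G \<and>
     (\<forall>n. \<forall>x\<in>tups (\<lambda>j. B (l j)) d n. c (l n) (map_tup G x) = \<epsilon>)))"

lemma strong_tups:
  assumes "strong B d l G" "x \<in> tups (\<lambda>j. B (l j)) d n" shows "map_tup G x \<in> tups B d (l n)"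
  using assms by (auto simp: strong_def tups_def map_tup_def)

lemma strong_prefix:
  assumes "strong B d l G" "i < d" "s @ r \<in> seqs (\<lambda>j. B (l j)) n"
  shows "prefix (G i s) (G i (s @ r))"
  using assms(3)
proof (induction r arbitrary: n rule: rev_induct)
  case Nil then show ?case by simp
next
  case (snoc v r)
  obtain n' where n: "n = Suc n'" using snoc.prems by (cases n) (auto simp: seqs_def)
  have sr: "s @ r \<in> seqs (\<lambda>j. B (l j)) n'" "v \<in> B (l n')"
    using snoc.prems n seqs_snoc[of "s @ r" v] by auto
  have "prefix (G i (s @ r) @ [v]) (G i ((s @ r) @ [v]))"
    using assms(1,2) sr unfolding strong_def by blast
  then have "prefix (G i (s @ r)) (G i (s @ r @ [v]))" by (metis append_assoc append_prefixD)
  then show ?case using snoc.IH[OF sr(1)] prefix_order.trans by blast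
qed

lemma strong_id: "strong B d (\<lambda>n. n) (\<lambda>i s. s)"
  by (auto simp: strong_def strict_mono_def)

lemma strong_comp:
  assumes G: "strong B d l G" and G': "strong (\<lambda>j. B (l j)) d l' G'"
  shows "strong B d (\<lambda>n. l (l' n)) (\<lambda>i s. G i (G' i s))"
  unfolding strong_def
proof (intro conjI allI impI ballI)
  show "strict_mono (\<lambda>n. l (l' n))" using G G' by (auto simp: strong_def strict_mono_def)
  fix i assume "d \<le> i" then show "G i (G' i []) = []" using G G' by (auto simp: strong_def)
next
  fix i n s assume i: "i < d" and s: "s \<in> seqs (\<lambda>j. B (l (l' j))) n"
  have s': "G' i s \<in> seqs (\<lambda>j. B (l j)) (l' n)" using G' i s by (auto simp: strong_def)
  then show "G i (G' i s) \<in> seqs B (l (l' n))" using G i by (auto simp: strong_def)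
  fix v assume v: "v \<in> B (l (l' n))"
  have p: "prefix (G' i s @ [v]) (G' i (s @ [v]))" using G' i s v by (auto simp: strong_def)
  then obtain r where r: "G' i (s @ [v]) = (G' i s @ [v]) @ r" by (auto simp: prefix_def)
  have "G' i (s @ [v]) \<in> seqs (\<lambda>j. B (l j)) (l' (Suc n))"
    using G' i s v seqs_snoc[of s v "\<lambda>j. B (l (l' j))" n] unfolding strong_def by blast
  then have "prefix (G i (G' i s @ [v])) (G i (G' i (s @ [v])))"
    using strong_prefix[OF G i] r by metis
  moreover have "prefix (G i (G' i s) @ [v]) (G i (G' i s @ [v]))"
    using G i s' v by (auto simp: strong_def)
  ultimately show "prefix (G i (G' i s) @ [v]) (G i (G' i (s @ [v])))"
    using prefix_order.trans by blast
qed

text \<open>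
  The subtree grows level by level: the immediate successors of its last level all lie above \<open>t\<close>, and the
  dense form lifts them simultaneously to a common level, in the prescribed colour.
\<close>

lemma HLstrong_if_dense:
  assumes "HLdense d" shows "HLstrong d"
  unfolding HLstrong_def
proof (intro allI impI)
  fix B and c :: "nat \<Rightarrow> (nat \<Rightarrow> nat list) \<Rightarrow> bool" assume B: "alphabet B"
  obtain n0 t \<epsilon> where t: "t \<in> tups B d n0" and g: "\<And>k. mono_lift B d c t k \<epsilon>"
    using assms B unfolding HLdense_def by blast
  obtain m \<phi> where m: "\<And>k. lift B d k (m k) (\<phi> k)"
    "\<And>k x. x \<in> tups B d k \<Longrightarrow> tup_le t x \<Longrightarrow> c (m k) (map_tup (\<phi> k) x) = \<epsilon>"
    using g unfolding mono_lift_def by metis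
  define l where "l = rec_nat (m n0) (\<lambda>_ k. m (Suc k))"
  have l: "l 0 = m n0" "l (Suc n) = m (Suc (l n))" for n by (simp_all add: l_def)
  define H where "H i = rec_list (\<phi> n0 i (t i)) (\<lambda>v r h. \<phi> (Suc (l (length r))) i (h @ [v]))" for i
  define G where "G i s = H i (rev s)" for i s
  have G: "G i [] = \<phi> n0 i (t i)" "G i (s @ [v]) = \<phi> (Suc (l (length s))) i (G i s @ [v])" for i s v
    by (simp_all add: G_def H_def)
  have mk: "k \<le> m k" for k using m(1) by (auto simp: lift_def)
  have sm: "strict_mono l"
    unfolding strict_mono_Suc_iff using l mk by (metis Suc_le_lessD)
  have lif: "\<phi> k i s \<in> seqs B (m k)" "prefix s (\<phi> k i s)" if "i < d" "s \<in> seqs B k" for k i s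
    using m(1)[of k] that by (auto simp: lift_def)
  have GG: "G i s \<in> seqs B (l n) \<and> prefix (t i) (G i s)" if "i < d" "s \<in> seqs (\<lambda>j. B (l j)) n" for i s n
    using that(2)
  proof (induction n arbitrary: s)
    case 0
    then show ?case using lif[OF that(1), of "t i" n0] t G that(1) l by (auto simp: tups_def)
  next
    case (Suc n)
    obtain r v where s: "s = r @ [v]" "r \<in> seqs (\<lambda>j. B (l j)) n" "v \<in> B (l n)"
      using Suc.prems by (rule seqs_SucE)
    have r: "G i r @ [v] \<in> seqs B (Suc (l n))" "prefix (t i) (G i r)" using Suc.IH[OF s(2)] s by auto
    have "length r = n" using s by (simp add: seqs_def)
    then show ?case using lif[OF that(1) r(1)] r(2) G s l
      by (metis append_prefixD prefix_order.trans)
  qed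
  have "strong B d l G" unfolding strong_def
  proof (intro conjI allI impI ballI)
    show "strict_mono l" by fact
    fix i assume "d \<le> i" then show "G i [] = []" using m(1)[of n0] t G by (auto simp: lift_def tups_def)
  next
    fix i n s assume i: "i < d" and s: "s \<in> seqs (\<lambda>j. B (l j)) n"
    show "G i s \<in> seqs B (l n)" using GG[OF i s] by blast
    fix v assume v: "v \<in> B (l n)"
    then show "prefix (G i s @ [v]) (G i (s @ [v]))"
      using lif(2)[OF i, of "G i s @ [v]" "Suc (l n)"] GG[OF i s] G length_seqs[OF s] by simp
  qed
  moreover have "c (l n) (map_tup G x) = \<epsilon>" if x: "x \<in> tups (\<lambda>j. B (l j)) d n" for n x
  proof (cases n)
    case 0
    then have "x = (\<lambda>_. [])" using x by (auto simp: tups_def fun_eq_iff) (metis not_le)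
    then show ?thesis using m(2)[OF t] l 0 G by (simp add: map_tup_def)
  next
    case (Suc n')
    define y where "y i = (if i < d then G i (butlast (x i)) @ [last (x i)] else [])" for i
    have xi: "x i = butlast (x i) @ [last (x i)] \<and> butlast (x i) \<in> seqs (\<lambda>j. B (l j)) n' \<and> last (x i) \<in> B (l n')"
      if "i < d" for i
      using x that Suc by (auto simp: tups_def elim!: seqs_SucE)
    have y: "y \<in> tups B d (Suc (l n'))" using xi GG by (auto simp: tups_def y_def)
    have "prefix (t i) (y i)" for i
      using xi[of i] GG[of i "butlast (x i)" n'] t by (cases "i < d") (auto simp: y_def tups_def)
    then have "c (m (Suc (l n'))) (map_tup (\<phi> (Suc (l n'))) y) = \<epsilon>" using m(2)[OF y] by (simp add: tup_le_def)
    moreover have "map_tup (\<phi> (Suc (l n'))) y i = map_tup G x i" for i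
    proof (cases "i < d")
      case True
      have "length (butlast (x i)) = n'" using xi[OF True] by (auto simp: seqs_def)
      then show ?thesis using G(2)[of i "butlast (x i)" "last (x i)"] xi[OF True] True
        by (simp add: map_tup_def y_def)
    next
      case False
      then show ?thesis using x m(1)[of n0] m(1)[of "Suc (l n')"] t
        by (auto simp: map_tup_def y_def tups_def G lift_def)
    qed
    ultimately show ?thesis using Suc l by (metis ext)
  qed
  ultimately show "\<exists>G l \<epsilon>. strong B d l G \<and> (\<forall>n. \<forall>x\<in>tups (\<lambda>j. B (l j)) d n. c (l n) (map_tup G x) = \<epsilon>)"
    by (intro exI[of _ G] exI[of _ l] exI[of _ \<epsilon>]) simp
qed

definition const_colour :: "(nat \<Rightarrow> nat set) \<Rightarrow> nat \<Rightarrow> (nat \<Rightarrow> nat) \<Rightarrow> (nat \<Rightarrow> nat list \<Rightarrow> nat list) \<Rightarrow>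
    (nat \<Rightarrow> (nat \<Rightarrow> nat list) \<Rightarrow> bool) \<Rightarrow> bool" where
  "const_colour B d l G c \<longleftrightarrow> (\<exists>\<epsilon>. \<forall>n. \<forall>x\<in>tups (\<lambda>j. B (l j)) d n. c (l n) (map_tup G x) = \<epsilon>)"

lemma const_colourD:
  "const_colour B d l G c \<Longrightarrow> x \<in> tups (\<lambda>j. B (l j)) d n \<Longrightarrow> y \<in> tups (\<lambda>j. B (l j)) d m \<Longrightarrow>
    c (l n) (map_tup G x) = c (l m) (map_tup G y)"
  unfolding const_colour_def by metis

text \<open>
  The colourings are treated one after another, each inside the subtree found for its predecessors.
\<close>

lemma HLstrong_family:
  assumes S: "HLstrong d" and B: "alphabet B" and "finite C"
  shows "\<exists>G l. strong B d l G \<and> (\<forall>c\<in>C. const_colour B d l G c)"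
  using assms(3)
proof (induction C rule: finite_induct)
  case empty then show ?case using strong_id by blast
next
  case (insert c C)
  obtain G l where G: "strong B d l G" "\<And>c. c \<in> C \<Longrightarrow> const_colour B d l G c"
    using insert.IH by blast
  obtain G' l' where G': "strong (\<lambda>j. B (l j)) d l' G'"
    "const_colour (\<lambda>j. B (l j)) d l' G' (\<lambda>n x. c (l n) (map_tup G x))"
    using S[unfolded HLstrong_def, rule_format, OF alphabet_shift[OF B], of l "\<lambda>n x. c (l n) (map_tup G x)"]
    unfolding const_colour_def by blast
  have "const_colour B d (\<lambda>n. l (l' n)) (\<lambda>i s. G i (G' i s)) c'" if "c' \<in> insert c C" for c'
  proof (cases "c' = c")
    case True then show ?thesis using G'(2) by (simp add: const_colour_def map_tup_comp)
  next
    case False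
    then have "const_colour B d l G c'" using that G(2) by blast
    then obtain \<epsilon>' where e: "\<forall>n. \<forall>x\<in>tups (\<lambda>j. B (l j)) d n. c' (l n) (map_tup G x) = \<epsilon>'"
      unfolding const_colour_def ..
    then show ?thesis unfolding const_colour_def
      using strong_tups[OF G'(1)] by (intro exI[of _ \<epsilon>']) (simp add: map_tup_comp)
  qed
  then show ?case using strong_comp[OF G(1) G'(1)] by blast
qed

text \<open>
  A colouring restricted to the trees above \<open>p\<close>, for the finitely many \<open>p\<close> of level \<open>j\<close>, is a finite
  family of colourings of the same trees. One subtree \<open>G\<close>, copied above all \<open>p\<close>, makes each of them constant.
\<close>

lemma HLstrong_above_level:
  fixes c :: "nat \<Rightarrow> (nat \<Rightarrow> nat list) \<Rightarrow> bool"
  assumes S: "HLstrong d" and B: "alphabet B"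
  obtains G l where "strong (\<lambda>m. B (j + m)) d l G"
    and "\<And>p x y n m. p \<in> tups B d j \<Longrightarrow> x \<in> tups (\<lambda>q. B (j + l q)) d n \<Longrightarrow>
      y \<in> tups (\<lambda>q. B (j + l q)) d m \<Longrightarrow>
      c (j + l n) (\<lambda>i. p i @ G i (x i)) = c (j + l m) (\<lambda>i. p i @ G i (y i))"
proof -
  define C where "C = (\<lambda>p n y. c (j + n) (\<lambda>i. p i @ y i)) ` tups B d j"
  have C: "finite C" using finite_tups[OF B] by (simp add: C_def)
  obtain G l where G: "strong (\<lambda>m. B (j + m)) d l G"
    and hom: "\<And>c. c \<in> C \<Longrightarrow> const_colour (\<lambda>m. B (j + m)) d l G c"
    using HLstrong_family[OF S alphabet_shift[OF B] C] by blast
  have "c (j + l n) (\<lambda>i. p i @ G i (x i)) = c (j + l m) (\<lambda>i. p i @ G i (y i))"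
    if "p \<in> tups B d j" "x \<in> tups (\<lambda>q. B (j + l q)) d n" "y \<in> tups (\<lambda>q. B (j + l q)) d m" for p x y n m
    using const_colourD[OF hom[of "\<lambda>n y. c (j + n) (\<lambda>i. p i @ y i)"] that(2,3)] that(1)
    by (auto simp: C_def map_tup_def)
  then show thesis by (rule that[OF G])
qed

section \<open>The asymmetric form\<close>

text \<open>
  Above each tuple of level \<open>k\<close> the colour is made constant. If all constants are \<^const>\<open>True\<close>, the roots
  of the copied subtrees dominate level \<open>k\<close>; if one of them is \<^const>\<open>False\<close>, the first branching of that copy
  gives the second alternative.
\<close>

lemma Halpern_Lauchli_step_asym:
  assumes S: "HLstrong d" and B: "alphabet B"
  shows "mono_lift B d c (\<lambda>_. []) k True \<or> (\<exists>n. \<exists>t\<in>tups B d n. mono_lift B d c t (Suc n) False)"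
proof -
  obtain G l where G: "strong (\<lambda>j. B (k + j)) d l G"
    and hom: "\<And>p x y n m. p \<in> tups B d k \<Longrightarrow> x \<in> tups (\<lambda>q. B (k + l q)) d n \<Longrightarrow>
      y \<in> tups (\<lambda>q. B (k + l q)) d m \<Longrightarrow>
      c (k + l n) (\<lambda>i. p i @ G i (x i)) = c (k + l m) (\<lambda>i. p i @ G i (y i))"
    by (rule HLstrong_above_level[OF S B, of k c]) (rule that; assumption)
  have G0: "G i [] \<in> seqs (\<lambda>j. B (k + j)) (l 0)" if "i < d" for i
    using G that unfolding strong_def by (metis insertI1 seqs_0)
  have Gd: "G i [] = []" if "i \<ge> d" for i using G that by (simp add: strong_def)
  have l01: "l 0 < l (Suc 0)" using G by (simp add: strong_def strict_mono_less)
  show ?thesis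
  proof (cases "\<forall>p\<in>tups B d k. c (k + l 0) (\<lambda>i. p i @ G i [])")
    case True
    have "lift B d k (k + l 0) (\<lambda>i s. s @ G i [])"
      using G0 Gd by (auto simp: lift_def append_seqs)
    then show ?thesis using True unfolding mono_lift_def map_tup_def by blast
  next
    case False
    then obtain p where p: "p \<in> tups B d k" "\<not> c (k + l 0) (\<lambda>i. p i @ G i [])" by blast
    have "c (k + l 1) (\<lambda>i. p i @ G i (x i)) = False" if "x \<in> tups (\<lambda>j. B (k + l j)) d 1" for x
    proof -
      have "(\<lambda>_. []) \<in> tups (\<lambda>j. B (k + l j)) d 0" by (simp add: tups_def)
      from hom[OF p(1) this that] show ?thesis using p(2) by simp
    qed
    note hom1 = this
    define t where "t i = p i @ G i []" for i
    have t: "t \<in> tups B d (k + l 0)"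
      using p(1) G0 Gd by (auto simp: tups_def t_def append_seqs)
    define \<phi> where "\<phi> i s = (if i < d then if prefix (t i) s then p i @ G i [last s]
        else pad B (k + l 1) s else [])" for i s
    have step: "\<exists>v. s = t i @ [v] \<and> v \<in> B (k + l 0) \<and> last s = v"
      if A: "i < d" "s \<in> seqs B (Suc (k + l 0))" "prefix (t i) s" for i s
      using seqs_prefix_snoc[of "t i" B "k + l 0" s] t A by (auto simp: tups_def)
    have "lift B d (Suc (k + l 0)) (k + l 1) \<phi>" unfolding lift_def
    proof (intro conjI allI impI ballI)
      show "Suc (k + l 0) \<le> k + l 1" using l01 by simp
      fix i s assume i: "i < d" and s: "s \<in> seqs B (Suc (k + l 0))"
      have "\<phi> i s \<in> seqs B (k + l 1) \<and> prefix s (\<phi> i s)"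
      proof (cases "prefix (t i) s")
        case True
        then obtain v where v: "s = t i @ [v]" "v \<in> B (k + l 0)" "last s = v" using step i s by blast
        have "[v] \<in> seqs (\<lambda>j. B (k + l j)) 1" using v by (simp add: seqs_def)
        then have "G i [v] \<in> seqs (\<lambda>j. B (k + j)) (l 1)" "prefix (G i [] @ [v]) (G i ([] @ [v]))"
          using G i v(2) unfolding strong_def by (blast, metis insertI1 seqs_0)
        moreover have "p i \<in> seqs B k" using p i by (simp add: tups_def)
        ultimately show ?thesis using True i v by (auto simp: \<phi>_def append_seqs t_def)
      next
        case False
        then show ?thesis using i pad_seqs[OF B s] l01 by (simp add: \<phi>_def)
      qed
      then show "\<phi> i s \<in> seqs B (k + l 1)" "prefix s (\<phi> i s)" by auto
    qed (simp add: \<phi>_def)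
    moreover have "c (k + l 1) (map_tup \<phi> x) = False" if x: "x \<in> tups B d (Suc (k + l 0))" "tup_le t x" for x
    proof -
      define y where "y i = (if i < d then [last (x i)] else [])" for i
      have "y \<in> tups (\<lambda>j. B (k + l j)) d 1"
        using x step by (fastforce simp: y_def tups_def tup_le_def seqs_def)
      moreover have "map_tup \<phi> x = (\<lambda>i. p i @ G i (y i))"
        using x p(1) Gd by (auto simp: map_tup_def \<phi>_def y_def tup_le_def tups_def)
      ultimately show ?thesis using hom1 by simp
    qed
    ultimately show ?thesis using t unfolding mono_lift_def by blast
  qed
qed

text \<open>
  In the second alternative only immediate successors were lifted; passing to blocks of sparse levels
  improves this to lifts of every height, as for \<open>HLdense_if_weak\<close>.
\<close>

lemma Halpern_Lauchli_dense_asym: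
  assumes S: "HLstrong d" and B: "alphabet B"
  shows "(\<forall>k. mono_lift B d c (\<lambda>_. []) k True) \<or> (\<exists>n. \<exists>t\<in>tups B d n. \<forall>k. mono_lift B d c t k False)"
proof (rule ccontr)
  assume neg: "\<not> ?thesis"
  then obtain k where k: "\<not> mono_lift B d c (\<lambda>_. []) k True" by blast
  obtain kk where kk: "strict_mono kk" "kk 0 = 0"
    and dead: "\<And>m t. t \<in> tups B d (kk m) \<Longrightarrow> \<not> mono_lift B d c t (kk (Suc m)) False"
    using sparse_levels[OF B, of d "{False}" c] neg by auto
  let ?c = "\<lambda>m x. c (kk m) (\<lambda>i. unblock (x i))"
  consider "mono_lift (blocks B kk) d ?c (\<lambda>_. []) k True"
    | n t where "t \<in> tups (blocks B kk) d n" "mono_lift (blocks B kk) d ?c t (Suc n) False"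
    using Halpern_Lauchli_step_asym[OF S alphabet_blocks[OF B, of kk], of ?c k] by blast
  then show False
  proof cases
    case 1
    have "(\<lambda>_. []) \<in> tups (blocks B kk) d 0" by (simp add: tups_def)
    from mono_lift_unblock(2)[OF B kk this _ 1] have "mono_lift B d c (\<lambda>_. []) (kk k) True" by simp
    then show False using mono_lift_antimono[OF B] k strict_mono_imp_increasing[OF kk(1)] by blast
  next
    case 2
    then show False using mono_lift_unblock[OF B kk 2(1) _ 2(2)] dead by simp
  qed
qed

section \<open>Fusion of strong subtrees\<close>

text \<open>
  What step \<open>j\<close> of a fusion has to respect: the first condition lets the embeddings converge, and the last one
  protects the results of earlier steps.
\<close>

definition fixes_below :: "(nat \<Rightarrow> nat set) \<Rightarrow> nat \<Rightarrow> nat \<Rightarrow> (nat \<Rightarrow> nat) \<Rightarrow> (nat \<Rightarrow> nat list \<Rightarrow> nat list) \<Rightarrow> bool" where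
  "fixes_below B d j f F \<longleftrightarrow> (\<forall>n<j. f n = n) \<and> (\<forall>i<d. \<forall>s. length s < j \<longrightarrow> F i s = s) \<and>
     (\<forall>i<d. \<forall>n\<ge>j. \<forall>s\<in>seqs (\<lambda>m. B (f m)) n. take j (F i s) = take j s)"

definition homog :: "(nat \<Rightarrow> nat set) \<Rightarrow> nat \<Rightarrow> nat \<Rightarrow> (nat \<Rightarrow> (nat \<Rightarrow> nat list) \<Rightarrow> bool) \<Rightarrow>
    (nat \<Rightarrow> nat) \<Rightarrow> (nat \<Rightarrow> nat list \<Rightarrow> nat list) \<Rightarrow> bool" where
  "homog B d j c l G \<longleftrightarrow> (\<forall>n\<ge>j. \<forall>n'\<ge>j. \<forall>x\<in>tups (\<lambda>m. B (l m)) d n. \<forall>y\<in>tups (\<lambda>m. B (l m)) d n'.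
     (\<forall>i<d. take j (x i) = take j (y i)) \<longrightarrow> c (l n) (map_tup G x) = c (l n') (map_tup G y))"

lemma fixes_belowD:
  assumes "fixes_below B d j f F"
  shows "n < j \<Longrightarrow> f n = n" "i < d \<Longrightarrow> length s < j \<Longrightarrow> F i s = s"
    "i < d \<Longrightarrow> n \<ge> j \<Longrightarrow> s \<in> seqs (\<lambda>m. B (f m)) n \<Longrightarrow> take j (F i s) = take j s"
  using assms unfolding fixes_below_def by blast+

text \<open>
  \<open>F\<close> keeps the first \<open>j\<close> letters and applies one and the same \<open>G\<close> to the remaining ones.
\<close>

lemma HL_homog:
  assumes S: "HLstrong d" and B: "alphabet B"
  shows "\<exists>F f. strong B d f F \<and> fixes_below B d j f F \<and> homog B d j c f F"
proof -
  obtain G l where G: "strong (\<lambda>m. B (j + m)) d l G"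
    and hom: "\<And>p x y n m. p \<in> tups B d j \<Longrightarrow> x \<in> tups (\<lambda>q. B (j + l q)) d n \<Longrightarrow>
      y \<in> tups (\<lambda>q. B (j + l q)) d m \<Longrightarrow>
      c (j + l n) (\<lambda>i. p i @ G i (x i)) = c (j + l m) (\<lambda>i. p i @ G i (y i))"
    by (rule HLstrong_above_level[OF S B, of j c]) (rule that; assumption)
  have Gd: "G i [] = []" if "i \<ge> d" for i using G that by (simp add: strong_def)
  have sm: "strict_mono l" using G by (simp add: strong_def)
  define f where "f n = (if n < j then n else j + l (n - j))" for n
  define F where "F i s = (if i < d then if length s < j then s else take j s @ G i (drop j s) else [])" for i s
  have split: "take j s \<in> seqs B j" "drop j s \<in> seqs (\<lambda>m. B (j + l m)) (n - j)"
    if "s \<in> seqs (\<lambda>m. B (f m)) n" "j \<le> n" for s n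
  proof -
    have "take j s \<in> seqs (\<lambda>m. B (f m)) j" using take_seqs that by blast
    then show "take j s \<in> seqs B j" using seqs_cong[of j B "\<lambda>m. B (f m)"] by (simp add: f_def)
    have "drop j s \<in> seqs (\<lambda>m. B (f (j + m))) (n - j)"
      using drop_seqs[of s "\<lambda>m. B (f m)" j "n - j"] that by simp
    then show "drop j s \<in> seqs (\<lambda>m. B (j + l m)) (n - j)" by (simp add: f_def)
  qed
  have smf: "strict_mono f" unfolding strict_mono_Suc_iff
  proof
    fix n
    have "l (n - j) < l (Suc n - j)" if "j \<le> n" using sm that by (simp add: strict_mono_less)
    then show "f n < f (Suc n)" by (auto simp: f_def not_less)
  qed
  have "strong B d f F" unfolding strong_def
  proof (intro conjI allI impI ballI)
    show "strict_mono f" by fact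
    fix i n s assume i: "i < d" and s: "s \<in> seqs (\<lambda>m. B (f m)) n"
    note len = length_seqs[OF s]
    show "F i s \<in> seqs B (f n)"
    proof (cases "n < j")
      case True
      then have "seqs (\<lambda>m. B (f m)) n = seqs B n" by (intro seqs_cong) (simp add: f_def)
      then show ?thesis using s i True len by (simp add: F_def f_def)
    next
      case False
      then have "G i (drop j s) \<in> seqs (\<lambda>m. B (j + m)) (l (n - j))"
        using G i split[OF s] unfolding strong_def by simp
      then show ?thesis using append_seqs[OF split(1)[OF s]] False i len by (simp add: F_def f_def)
    qed
    fix v assume v: "v \<in> B (f n)"
    consider "Suc n < j" | "Suc n = j" | "j \<le> n" by linarith
    then show "prefix (F i s @ [v]) (F i (s @ [v]))"
    proof cases
      case 3
      then have "prefix (G i (drop j s) @ [v]) (G i (drop j s @ [v]))"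
        using G i split(2)[OF s] v unfolding strong_def by (simp add: f_def)
      then show ?thesis using 3 i len by (simp add: F_def)
    qed (use i len in \<open>auto simp: F_def\<close>)
  qed (simp add: F_def)
  moreover have "fixes_below B d j f F"
    using length_seqs by (fastforce simp: fixes_below_def f_def F_def)
  moreover have "homog B d j c f F"
    unfolding homog_def
  proof (intro allI impI ballI)
    fix n n' x y assume n: "n \<ge> j" "n' \<ge> j" and x: "x \<in> tups (\<lambda>m. B (f m)) d n"
      and y: "y \<in> tups (\<lambda>m. B (f m)) d n'" and eq: "\<forall>i<d. take j (x i) = take j (y i)"
    define p where "p i = take j (x i)" for i
    have p: "p \<in> tups B d j" using x split n by (auto simp: p_def tups_def)
    have pe: "take j (y i) = p i" for i
      using eq x y by (cases "i < d") (auto simp: p_def tups_def)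
    have dx: "(\<lambda>i. drop j (x i)) \<in> tups (\<lambda>m. B (j + l m)) d (n - j)"
      and dy: "(\<lambda>i. drop j (y i)) \<in> tups (\<lambda>m. B (j + l m)) d (n' - j)"
      using x y split n by (auto simp: tups_def)
    have Fz: "map_tup F z = (\<lambda>i. take j (z i) @ G i (drop j (z i)))"
      if "z \<in> tups (\<lambda>m. B (f m)) d k" "j \<le> k" for z k
    proof
      fix i show "map_tup F z i = take j (z i) @ G i (drop j (z i))"
        using that Gd[of i] length_seqs[of "z i" "\<lambda>m. B (f m)" k]
        by (cases "i < d") (auto simp: map_tup_def F_def tups_def)
    qed
    have "map_tup F x = (\<lambda>i. p i @ G i (drop j (x i)))" "map_tup F y = (\<lambda>i. p i @ G i (drop j (y i)))"
      using Fz[OF x n(1)] Fz[OF y n(2)] pe by (simp_all add: p_def)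
    then show "c (f n) (map_tup F x) = c (f n') (map_tup F y)"
      using hom[OF p dx dy] n by (simp add: f_def)
  qed
  ultimately show ?thesis by blast
qed

text \<open>
  The relation between an embedding and a later one in a fusion sequence.
\<close>

definition refines :: "(nat \<Rightarrow> nat set) \<Rightarrow> nat \<Rightarrow> nat \<Rightarrow> (nat \<Rightarrow> nat) \<Rightarrow> (nat \<Rightarrow> nat list \<Rightarrow> nat list) \<Rightarrow>
    (nat \<Rightarrow> nat) \<Rightarrow> (nat \<Rightarrow> nat list \<Rightarrow> nat list) \<Rightarrow> bool" where
  "refines B d j l G l' G' \<longleftrightarrow> (\<exists>f F. strong (\<lambda>m. B (l m)) d f F \<and> fixes_below (\<lambda>m. B (l m)) d j f F \<and>
     l' = (\<lambda>n. l (f n)) \<and> G' = (\<lambda>i s. G i (F i s)))"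

lemma strong_increasing: "strong B d l G \<Longrightarrow> n \<le> l n"
  by (simp add: strong_def strict_mono_imp_increasing)

lemma refines_refl: "refines B d j l G l G"
  unfolding refines_def fixes_below_def
  by (intro exI[of _ "\<lambda>n. n"] exI[of _ "\<lambda>i s. s"]) (simp add: strong_id)

lemma refines_trans:
  assumes "refines B d j l G l' G'" "refines B d j' l' G' l'' G''" "j \<le> j'"
  shows "refines B d j l G l'' G''"
proof -
  obtain f F where F: "strong (\<lambda>m. B (l m)) d f F" "fixes_below (\<lambda>m. B (l m)) d j f F"
    "l' = (\<lambda>n. l (f n))" "G' = (\<lambda>i s. G i (F i s))" using assms(1) unfolding refines_def by blast
  obtain f' F' where F': "strong (\<lambda>m. B (l' m)) d f' F'" "fixes_below (\<lambda>m. B (l' m)) d j' f' F'"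
    "l'' = (\<lambda>n. l' (f' n))" "G'' = (\<lambda>i s. G' i (F' i s))" using assms(2) unfolding refines_def by blast
  have "fixes_below (\<lambda>m. B (l m)) d j (\<lambda>n. f (f' n)) (\<lambda>i s. F i (F' i s))"
    unfolding fixes_below_def
  proof (intro conjI allI impI ballI)
    fix n assume "n < j" then show "f (f' n) = n" using F(2) F'(2) assms(3) by (simp add: fixes_below_def)
  next
    fix i s assume "i < d" "length (s :: nat list) < j"
    then show "F i (F' i s) = s" using F(2) F'(2) assms(3) by (simp add: fixes_below_def)
  next
    fix i n s assume i: "i < d" "n \<ge> j" and s: "s \<in> seqs (\<lambda>m. B (l (f (f' m)))) n"
    have "F' i s \<in> seqs (\<lambda>m. B (l (f m))) (f' n)" using F'(1) i s F(3) by (auto simp: strong_def)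
    moreover have "f' n \<ge> j" using strong_increasing[OF F'(1), of n] i by simp
    ultimately have "take j (F i (F' i s)) = take j (F' i s)" using F(2) i by (auto simp: fixes_below_def)
    also have "\<dots> = take j s"
    proof (cases "n < j'")
      case True then show ?thesis using F'(2) i length_seqs[OF s] by (simp add: fixes_below_def)
    next
      case False
      then have "take j' (F' i s) = take j' s" using fixes_belowD(3)[OF F'(2), of i n s] i s F(3) by simp
      then show ?thesis using assms(3) by (metis min.absorb1 take_take)
    qed
    finally show "take j (F i (F' i s)) = take j s" .
  qed
  moreover have "strong (\<lambda>m. B (l m)) d (\<lambda>n. f (f' n)) (\<lambda>i s. F i (F' i s))"
    using strong_comp[OF F(1)] F'(1) F(3) by simp
  ultimately show ?thesis unfolding refines_def using F(3,4) F'(3,4) by blast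
qed

lemma homog_refines:
  assumes "homog B d j c l G" "refines B d (Suc j) l G l' G'"
  shows "homog B d j c l' G'"
proof -
  obtain f F where F: "strong (\<lambda>m. B (l m)) d f F" "fixes_below (\<lambda>m. B (l m)) d (Suc j) f F"
    "l' = (\<lambda>n. l (f n))" "G' = (\<lambda>i s. G i (F i s))" using assms(2) unfolding refines_def by blast
  have keep: "take j (F i (x i)) = take j (x i)"
    if "x \<in> tups (\<lambda>m. B (l (f m))) d n" "n \<ge> j" "i < d" for x n i
  proof (cases "n = j")
    case True
    have "length (x i) = j" using that True length_seqs by (auto simp: tups_def)
    then show ?thesis using F(2) that by (simp add: fixes_below_def)
  next
    case False
    then have "take (Suc j) (F i (x i)) = take (Suc j) (x i)"
      using fixes_belowD(3)[OF F(2), of i n "x i"] that by (simp add: tups_def)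
    then show ?thesis by (metis le_add2 min.absorb1 plus_1_eq_Suc take_take)
  qed
  show ?thesis unfolding homog_def
  proof (intro allI impI ballI)
    fix n n' x y assume n: "n \<ge> j" "n' \<ge> j" and x: "x \<in> tups (\<lambda>m. B (l' m)) d n"
      and y: "y \<in> tups (\<lambda>m. B (l' m)) d n'" and eq: "\<forall>i<d. take j (x i) = take j (y i)"
    have "map_tup F x \<in> tups (\<lambda>m. B (l m)) d (f n)" "map_tup F y \<in> tups (\<lambda>m. B (l m)) d (f n')"
      using strong_tups[OF F(1)] x y F(3) by auto
    moreover have "f n \<ge> j" "f n' \<ge> j" using strong_increasing[OF F(1)] n order_trans by blast+
    moreover have "\<forall>i<d. take j (map_tup F x i) = take j (map_tup F y i)"
      using keep[of x n] keep[of y n'] x y n eq F(3) by (simp add: map_tup_def)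
    ultimately have "c (l (f n)) (map_tup G (map_tup F x)) = c (l (f n')) (map_tup G (map_tup F y))"
      using assms(1) unfolding homog_def by blast
    then show "c (l' n) (map_tup G' x) = c (l' n') (map_tup G' y)" using F(3,4) by (simp add: map_tup_def)
  qed
qed

text \<open>
  Step \<open>j\<close> takes care of the colouring \<open>c j\<close> without moving levels below \<open>j\<close>, so the embeddings converge.
  Later steps preserve the first \<open>j\<close> letters and therefore do not spoil what step \<open>j\<close> achieved.
\<close>

lemma HL_fusion:
  assumes S: "HLstrong d" and B: "alphabet B"
  shows "\<exists>E l. strong B d l E \<and> (\<forall>j. homog B d j (c j) l E)"
proof -
  define Q where "Q j S S' \<longleftrightarrow> refines B d j (fst S) (snd S) (fst S') (snd S') \<and>
    homog B d j (c j) (fst S') (snd S')" for j and S S' :: "(nat \<Rightarrow> nat) \<times> (nat \<Rightarrow> nat list \<Rightarrow> nat list)"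
  have "\<exists>S. \<forall>j. strong B d (fst (S j)) (snd (S j)) \<and> Q j (S j) (S (Suc j))"
  proof (rule dependent_nat_choice)
    show "\<exists>S. strong B d (fst S) (snd S)" using strong_id[of B d] by (intro exI[of _ "(\<lambda>n. n, \<lambda>i s. s)"]) simp
  next
    fix S :: "(nat \<Rightarrow> nat) \<times> (nat \<Rightarrow> nat list \<Rightarrow> nat list)" and j
    assume st: "strong B d (fst S) (snd S)"
    obtain F f where F: "strong (\<lambda>m. B (fst S m)) d f F" "fixes_below (\<lambda>m. B (fst S m)) d j f F"
      "homog (\<lambda>m. B (fst S m)) d j (\<lambda>n x. c j (fst S n) (map_tup (snd S) x)) f F"
      using HL_homog[OF S alphabet_shift[OF B]] by blast
    let ?S = "(\<lambda>n. fst S (f n), \<lambda>i s. snd S i (F i s))"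
    have "refines B d j (fst S) (snd S) (fst ?S) (snd ?S)"
      unfolding refines_def using F(1,2) by (intro exI[of _ f] exI[of _ F]) simp
    moreover have "homog B d j (c j) (fst ?S) (snd ?S)"
      using F(3) unfolding homog_def map_tup_def fst_conv snd_conv .
    ultimately have "Q j S ?S" by (simp add: Q_def)
    moreover have "strong B d (fst ?S) (snd ?S)" using strong_comp[OF st F(1)] by simp
    ultimately show "\<exists>S'. strong B d (fst S') (snd S') \<and> Q j S S'" by blast
  qed
  then obtain S where S: "\<And>j. strong B d (fst (S j)) (snd (S j))" "\<And>j. Q j (S j) (S (Suc j))" by blast
  define ls Gs where "ls j = fst (S j)" and "Gs j = snd (S j)" for j
  have st: "strong B d (ls j) (Gs j)" for j using S by (simp add: ls_def Gs_def)
  have step: "refines B d j (ls j) (Gs j) (ls (Suc j)) (Gs (Suc j))"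
    "homog B d j (c j) (ls (Suc j)) (Gs (Suc j))" for j using S(2) by (auto simp: ls_def Gs_def Q_def)
  note rr = step(1)
  have ref: "refines B d j (ls j) (Gs j) (ls m) (Gs m)" if "j \<le> m" for j m
    using that
  proof (induction m rule: dec_induct)
    case base then show ?case by (rule refines_refl)
  next
    case (step n)
    then show ?case
      using refines_trans[OF step.IH rr] by simp
  qed
  define E where "E i s = (if i < d then Gs (Suc (length s)) i s else [])" for i s
  define l where "l n = ls (Suc n) n" for n
  have lim: "ls m n = l n" "i < d \<Longrightarrow> length s = n \<Longrightarrow> Gs m i s = E i s" if "Suc n \<le> m" for m n i s
    using ref[OF that] by (auto simp: refines_def fixes_below_def l_def E_def)
  have sl: "seqs (\<lambda>j. B (l j)) n = seqs (\<lambda>j. B (ls m j)) n" if "n \<le> m" for n m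
    using lim(1) that by (intro seqs_cong) (metis Suc_leI order_trans less_imp_le_nat Suc_le_eq order_less_le_trans)
  have "strong B d l E" unfolding strong_def
  proof (intro conjI allI impI ballI)
    show "strict_mono l" unfolding strict_mono_Suc_iff
    proof
      fix n
      have "ls (Suc (Suc n)) n < ls (Suc (Suc n)) (Suc n)" using st by (simp add: strong_def strict_mono_less)
      then show "l n < l (Suc n)" using lim(1)[of n "Suc (Suc n)"] lim(1)[of "Suc n" "Suc (Suc n)"] by simp
    qed
    fix i n s assume i: "i < d" and s: "s \<in> seqs (\<lambda>j. B (l j)) n"
    let ?m = "Suc (Suc n)"
    have s': "s \<in> seqs (\<lambda>j. B (ls ?m j)) n" using sl[of n ?m] s by simp
    have e: "Gs ?m i s = E i s" "ls ?m n = l n" using lim(2)[of n ?m i s] lim(1)[of n ?m] i length_seqs[OF s] by auto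
    show "E i s \<in> seqs B (l n)" using st[of ?m] s' i e unfolding strong_def by metis
    fix v assume v: "v \<in> B (l n)"
    have "Gs ?m i (s @ [v]) = E i (s @ [v])" using lim(2)[of "Suc n" ?m i "s @ [v]"] i length_seqs[OF s] by simp
    then show "prefix (E i s @ [v]) (E i (s @ [v]))" using st[of ?m] s' i v e unfolding strong_def by metis
  qed (simp add: E_def)
  moreover have "homog B d j (c j) l E" for j
    unfolding homog_def
  proof (intro allI impI ballI)
    fix n n' x y assume n: "n \<ge> j" "n' \<ge> j" and x: "x \<in> tups (\<lambda>m. B (l m)) d n"
      and y: "y \<in> tups (\<lambda>m. B (l m)) d n'" and eq: "\<forall>i<d. take j (x i) = take j (y i)"
    define m where "m = Suc (max n n')"
    have m: "Suc n \<le> m" "Suc n' \<le> m" "Suc j \<le> m" using n by (auto simp: m_def)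
    have h: "homog B d j (c j) (ls m) (Gs m)" using homog_refines[OF step(2) ref] m by simp
    have x': "x \<in> tups (\<lambda>j. B (ls m j)) d n" "y \<in> tups (\<lambda>j. B (ls m j)) d n'"
      using x y sl[of n m] sl[of n' m] m by (auto simp: tups_def)
    have "map_tup (Gs m) z = map_tup E z" if "z \<in> tups (\<lambda>m. B (l m)) d k" "Suc k \<le> m" for z k
    proof
      fix i show "map_tup (Gs m) z i = map_tup E z i"
        using lim(2)[OF that(2)] that(1) length_seqs st[of m] by (cases "i < d") (auto simp: tups_def map_tup_def E_def strong_def)
    qed
    then show "c j (l n) (map_tup E x) = c j (l n') (map_tup E y)"
      using h x' n eq x y m lim(1) unfolding homog_def by metis
  qed
  ultimately show ?thesis by blast
qed

lemma homogD:
  assumes "homog B d j c l G" "n \<ge> j" "n' \<ge> j" "x \<in> tups (\<lambda>m. B (l m)) d n" "y \<in> tups (\<lambda>m. B (l m)) d n'"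
    and "\<And>i. i < d \<Longrightarrow> take j (x i) = take j (y i)"
  shows "c (l n) (map_tup G x) = c (l n') (map_tup G y)"
  using assms(1)[unfolded homog_def, rule_format, OF assms(2-5)] assms(6) by simp

section \<open>Adding a tree\<close>

text \<open>
  The induction step. Call the tree with index \<open>d\<close> the last one, and let \<open>w 0, w 1, \<dots>\<close> enumerate its nodes
  with infinite repetition. For a fixed branch through \<open>w j\<close> the colour is a colouring of the first \<open>d\<close> trees,
  so by \<open>HL_fusion\<close> it may be assumed to depend only on the first \<open>j\<close> letters: it is a colouring
  \<open>f j\<close> of level \<open>j\<close>. In this way the last tree has turned into a labelling of the levels by nodes \<open>w j\<close>.
  
  Colour \<open>\<epsilon>\<close> is alive at \<open>t, k, u\<close> if some level beyond \<open>k\<close> with a label above \<open>u\<close> contains an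
  extension of every node of level \<open>k\<close> above \<open>t\<close> such that all tuples have colour \<open>\<epsilon>\<close>. Suppose that
  for all \<open>t\<close> and \<open>u\<close> both colours die at some \<open>k\<close> and some node above \<open>u\<close>. Then there are nodes
  \<open>U 0, U 1, \<dots>\<close>, each above its predecessor, such that both colours are dead at \<open>t, k, U (Suc n)\<close> for all \<open>t\<close> of
  level \<open>n\<close> and a suitable \<open>k\<close>. Colouring a tuple of level \<open>n\<close> by the \<open>f\<close>-colour of any extension on a level
  labelled \<open>U n\<close>, the dense form for \<open>d\<close> trees brings one colour back to life, a contradiction.
  
  Hence some colour is alive at \<open>t, k, u'\<close> for fixed \<open>t, u\<close>, all \<open>k\<close> and all \<open>u'\<close> above \<open>u\<close>. Applied to the immediate
  successors of a prolongation of \<open>u\<close> one after another, this yields nodes of the first \<open>d\<close> trees that work with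
  branches through all these successors at the same time.
\<close>

lemma HLweak_Suc:
  assumes W: "HLweak d" shows "HLweak (Suc d)"
  unfolding HLweak_def
proof (intro allI impI)
  fix B and c :: "nat \<Rightarrow> (nat \<Rightarrow> nat list) \<Rightarrow> bool" assume B: "alphabet B"
  have D: "HLdense d" using W by (rule HLdense_if_weak)
  have S: "HLstrong d" using D by (rule HLstrong_if_dense)
  define Sq where "Sq = (\<Union>m. seqs B m)"
  have Sq: "countable Sq" "Sq \<noteq> {}" using seqs_nonempty[OF B] by (auto simp: Sq_def)
  \<comment> \<open>The second component of the pair coded by j is free, so each node occurs beyond every N.\<close>
  define w where "w j = from_nat_into Sq (fst (prod_decode j))" for j
  have w: "w j \<in> seqs B (length (w j))" for j
  proof -
    have "w j \<in> Sq" using from_nat_into[OF Sq(2)] by (simp add: w_def)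
    then show ?thesis using length_seqs by (auto simp: Sq_def)
  qed
  have winf: "\<exists>j\<ge>N. w j = u" if "u \<in> seqs B m" for u m N
  proof -
    have "u \<in> Sq" using that by (auto simp: Sq_def)
    then have "w (prod_encode (to_nat_on Sq u, N)) = u" using Sq by (simp add: w_def from_nat_into_to_nat_on)
    then show ?thesis using le_prod_encode_2 by blast
  qed
  \<comment> \<open>The branch through w j that continues with default letters, cut off at level n.\<close>
  define xb where "xb j n = take n (pad B (max n (length (w j))) (w j))" for j n
  have xb: "xb j n \<in> seqs B n" for j n
    unfolding xb_def using pad_seqs[OF B w] take_seqs by (metis max.cobounded1 max.cobounded2)
  have xbw: "prefix (w j) (xb j n)" if "length (w j) \<le> n" for j n
    using that length_seqs[OF pad_seqs[OF B w that]] by (simp add: xb_def max_absorb1)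
  define cc where "cc j n y = c n (y(d := xb j n))" for j n y
  obtain E l where st: "strong B d l E" and hom: "\<And>j. homog B d j (cc j) l E"
    using HL_fusion[OF S B, of cc] by blast
  define B' where "B' = (\<lambda>j. B (l j))"
  have B': "alphabet B'" using alphabet_shift[OF B] by (simp add: B'_def)
  have st': "E i s \<in> seqs B (l n)" "v \<in> B' n \<Longrightarrow> prefix (E i s @ [v]) (E i (s @ [v]))"
    if "i < d" "s \<in> seqs B' n" for i s n v
    using st that by (auto simp: strong_def B'_def)
  \<comment> \<open>By homD, f j computes the colour of (y, branch j) for all y of level at least j.\<close>
  define f where "f j y = cc j (l j) (map_tup E y)" for j y
  have homD: "cc j (l n) (map_tup E x) = f j (\<lambda>i. take j (x i))" if "j \<le> n" "x \<in> tups B' d n" for j n x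
  proof -
    have "(\<lambda>i. take j (x i)) \<in> tups B' d j" using that take_seqs by (auto simp: tups_def)
    then show ?thesis
      unfolding f_def using homogD[OF hom[of j], of n j x "\<lambda>i. take j (x i)"] that by (simp add: B'_def)
  qed
  define alive where "alive \<epsilon> t k u \<longleftrightarrow> (\<exists>j \<phi>. k \<le> j \<and> prefix u (w j) \<and> lift B' d k j \<phi> \<and>
     (\<forall>x\<in>tups B' d k. tup_le t x \<longrightarrow> f j (map_tup \<phi> x) = \<epsilon>))" for \<epsilon> t k u
  have alive_mono: "alive \<epsilon> t k' u'" if al: "alive \<epsilon> t k u" and "k' \<le> k" "prefix u' u" for \<epsilon> t k u k' u'
  proof -
    obtain j \<phi> where j: "k \<le> j" "prefix u (w j)" "lift B' d k j \<phi>"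
      "\<And>x. x \<in> tups B' d k \<Longrightarrow> tup_le t x \<Longrightarrow> f j (map_tup \<phi> x) = \<epsilon>" using al unfolding alive_def by blast
    have p: "lift B' d k' k (padt B' d k)" using lift_padt[OF B'] that by blast
    have "f j (map_tup (\<lambda>i s. \<phi> i (padt B' d k i s)) x) = \<epsilon>" if "x \<in> tups B' d k'" "tup_le t x" for x
      using j(4)[OF lift_tups(1)[OF p that(1)] tup_le_trans[OF that(2) lift_tups(2)[OF p that(1)]]]
      by (simp add: map_tup_def)
    then show ?thesis unfolding alive_def using lift_comp[OF p j(3)] j(1,2) that
      by (meson order_trans prefix_order.trans)
  qed
  define valid where "valid u \<longleftrightarrow> u \<in> seqs B (length u)" for u
  have claim1: "\<exists>n t u. t \<in> tups B' d n \<and> valid u \<and> (\<forall>k u'. valid u' \<and> prefix u u' \<longrightarrow> (\<exists>\<epsilon>. alive \<epsilon> t k u'))"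
  proof (rule ccontr)
    assume neg: "\<not> ?thesis"
    have neg': "\<exists>k u'. valid u' \<and> prefix u u' \<and> (\<forall>\<epsilon>. \<not> alive \<epsilon> t k u')"
      if "t \<in> tups B' d n" "valid u" for t n u
    proof -
      have "\<forall>n t. t \<in> tups B' d n \<longrightarrow> (\<forall>u. valid u \<longrightarrow>
          (\<exists>k u'. valid u' \<and> prefix u u' \<and> (\<forall>\<epsilon>. \<not> alive \<epsilon> t k u')))"
        using neg by simp
      from this[rule_format, OF that] show ?thesis .
    qed
    have fin: "\<exists>k u'. valid u' \<and> prefix u u' \<and> (\<forall>t\<in>X. \<forall>\<epsilon>. \<not> alive \<epsilon> t k u')"
      if "finite X" "X \<subseteq> tups B' d n" "valid u" for X n u
      using that(1,2)
    proof (induction X rule: finite_induct)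
      case empty then show ?case using that(3) by blast
    next
      case (insert t X)
      then have "\<exists>k u'. valid u' \<and> prefix u u' \<and> (\<forall>t\<in>X. \<forall>\<epsilon>. \<not> alive \<epsilon> t k u')" by simp
      then obtain k u' where k: "valid u'" "prefix u u'" "\<And>t \<epsilon>. t \<in> X \<Longrightarrow> \<not> alive \<epsilon> t k u'" by blast
      obtain k2 u2 where k2: "valid u2" "prefix u' u2" "\<And>\<epsilon>. \<not> alive \<epsilon> t k2 u2"
        using neg'[of t n u'] k(1) insert.prems by auto
      have "\<not> alive \<epsilon> t' (max k k2) u2" if "t' \<in> insert t X" for t' \<epsilon>
      proof
        assume a: "alive \<epsilon> t' (max k k2) u2"
        show False
        proof (cases "t' = t")
          case True
          then show False using alive_mono[OF a, of k2 u2] k2(3) by simp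
        next
          case False
          then show False using alive_mono[OF a _ k2(2), of k] k(3) that by simp
        qed
      qed
      moreover have "prefix u u2" using k(2) k2(2) by (rule prefix_order.trans)
      ultimately show ?case using k2(1) by (intro exI[of _ "max k k2"] exI[of _ u2]) simp
    qed
    have "\<exists>U. \<forall>n. valid (U n) \<and> (prefix (U n) (U (Suc n)) \<and>
        (\<exists>k. \<forall>t\<in>tups B' d n. \<forall>\<epsilon>. \<not> alive \<epsilon> t k (U (Suc n))))"
    proof (rule dependent_nat_choice)
      have "valid []" by (simp add: valid_def)
      then show "\<exists>u. valid u" ..
    next
      fix u n assume "valid u"
      then show "\<exists>u'. valid u' \<and> prefix u u' \<and> (\<exists>k. \<forall>t\<in>tups B' d n. \<forall>\<epsilon>. \<not> alive \<epsilon> t k u')"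
        using fin[OF finite_tups[OF B'] order_refl, of u] by blast
    qed
    then obtain U where U: "\<And>n. valid (U n)" "\<And>n. prefix (U n) (U (Suc n))"
      "\<And>n. \<exists>k. \<forall>t\<in>tups B' d n. \<forall>\<epsilon>. \<not> alive \<epsilon> t k (U (Suc n))" by blast
    have Um: "prefix (U n) (U m)" if "n \<le> m" for n m
      using that by (induction m rule: dec_induct) (use U(2) prefix_order.trans in blast)+
    \<comment> \<open>g below colours level n by f on a level J n beyond n that is labelled U n.\<close>
    obtain J where J: "\<And>n. n \<le> J n" "\<And>n. w (J n) = U n"
    proof -
      have "\<exists>j\<ge>n. w j = U n" for n using winf U(1)[of n] unfolding valid_def by simp
      then have "\<exists>J. \<forall>n. n \<le> J n \<and> w (J n) = U n" by (intro choice) auto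
      then show ?thesis using that by auto
    qed
    obtain n0 t \<epsilon> where t: "t \<in> tups B' d n0"
      and g: "\<And>k. mono_lift B' d (\<lambda>n y. f (J n) (map_tup (padt B' d (J n)) y)) t k \<epsilon>"
      using D B' unfolding HLdense_def by blast
    from U(3)[of n0] obtain K where "\<forall>t\<in>tups B' d n0. \<forall>\<epsilon>. \<not> alive \<epsilon> t K (U (Suc n0))" ..
    then have K: "\<not> alive \<epsilon> t K (U (Suc n0))" for \<epsilon> using t by simp
    \<comment> \<open>K is where t died. Lifting from beyond Suc n0 makes the label U m extend U (Suc n0).\<close>
    let ?k = "max K (Suc n0)"
    obtain m \<phi> where m: "lift B' d ?k m \<phi>"
      "\<And>x. x \<in> tups B' d ?k \<Longrightarrow> tup_le t x \<Longrightarrow> f (J m) (map_tup (padt B' d (J m)) (map_tup \<phi> x)) = \<epsilon>"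
      using g[of ?k] unfolding mono_lift_def by blast
    have km: "?k \<le> m" using m(1) by (simp add: lift_def)
    have "lift B' d ?k (J m) (\<lambda>i s. padt B' d (J m) i (\<phi> i s))"
      using lift_comp[OF m(1) lift_padt[OF B' J(1)]] .
    moreover have "?k \<le> J m" using km J(1)[of m] by (rule order_trans)
    moreover have "prefix (U m) (w (J m))" using J(2)[of m] by simp
    ultimately have "alive \<epsilon> t ?k (U m)" unfolding alive_def
      using m(2) unfolding map_tup_def
      by (intro exI[of _ "J m"] exI[of _ "\<lambda>i s. padt B' d (J m) i (\<phi> i s)"]) simp
    then have "alive \<epsilon> t K (U (Suc n0))"
      by (rule alive_mono) (use Um[of "Suc n0" m] km in simp_all)
    then show False using K by simp
  qed
  obtain n0 t u \<epsilon> where t: "t \<in> tups B' d n0" and u: "valid u"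
    and al: "\<And>k u'. valid u' \<Longrightarrow> prefix u u' \<Longrightarrow> alive \<epsilon> t k u'"
  proof -
    obtain n t u where t: "t \<in> tups B' d n" "valid u"
      and ex': "\<forall>k u'. valid u' \<and> prefix u u' \<longrightarrow> (\<exists>\<epsilon>. alive \<epsilon> t k u')"
      using claim1 by (elim exE conjE) (rule that; assumption)
    have ex: "\<exists>\<epsilon>. alive \<epsilon> t k u'" if "valid u'" "prefix u u'" for k u' using ex' that by simp
    show ?thesis
    \<comment> \<open>If False dies at k0, u0, then by monotonicity it is dead at all larger k and above u0,
      so True is alive there.\<close>
    proof (cases "\<forall>k u'. valid u' \<longrightarrow> prefix u u' \<longrightarrow> alive False t k u'")
      case True then show ?thesis by (intro that[OF t(1,2), of False]) simp
    next
      case False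
      then obtain k0 u0 where u0: "valid u0" "prefix u u0" "\<not> alive False t k0 u0" by blast
      have "alive True t k u'" if vu: "valid u'" "prefix u0 u'" for k u'
      proof -
        obtain \<epsilon> where e: "alive \<epsilon> t (max k k0) u'"
          using ex[OF vu(1) prefix_order.trans[OF u0(2) vu(2)]] ..
        then have "\<epsilon> = True" using alive_mono[OF e, of k0 u0] u0(3) vu by (cases \<epsilon>) simp_all
        then show ?thesis using alive_mono[OF e, of k u'] by simp
      qed
      then show ?thesis by (rule that[OF t(1) u0(1), of True])
    qed
  qed
  \<comment> \<open>The tuple T of the weak form consists of E t' and u', on the common level l n.\<close>
  define n where "n = max n0 (length u)"
  have ln: "n \<le> l n" for n using strong_increasing[OF st] .
  define t' where "t' = map_tup (padt B' d n) t"
  have lp: "lift B' d n0 n (padt B' d n)" using lift_padt[OF B'] by (simp add: n_def)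
  have t': "t' \<in> tups B' d n" "tup_le t t'" using lift_tups[OF lp t] by (simp_all add: t'_def)
  define u' where "u' = pad B (l n) u"
  have "length u \<le> l n" using ln[of n] by (simp add: n_def)
  then have u': "u' \<in> seqs B (l n)" "prefix u u'"
    using pad_seqs[OF B u[unfolded valid_def]] by (simp_all add: u'_def)
  \<comment> \<open>Successor v of u' is settled on level j if the tuples above t', extended by phi and cut
    back to level j, have f-colour eps.\<close>
  define reach where "reach N \<phi> j v \<longleftrightarrow> j \<le> N \<and> prefix (u' @ [v]) (w j) \<and>
      (\<forall>x\<in>tups B' d (Suc n). tup_le t' x \<longrightarrow> f j (\<lambda>i. take j (map_tup \<phi> x i)) = \<epsilon>)" for N \<phi> j v
  have reachD: "j \<le> N" "prefix (u' @ [v]) (w j)"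
    "x \<in> tups B' d (Suc n) \<Longrightarrow> tup_le t' x \<Longrightarrow> f j (\<lambda>i. take j (map_tup \<phi> x i)) = \<epsilon>"
    if "reach N \<phi> j v" for N \<phi> j v x
    using that unfolding reach_def by simp_all
  have iter: "\<exists>N \<phi> J. lift B' d (Suc n) N \<phi> \<and> (\<forall>v\<in>V. reach N \<phi> (J v) v)"
    if "finite V" "V \<subseteq> B (l n)" for V
    using that
  proof (induction V rule: finite_induct)
    case empty
    have "lift B' d (Suc n) (Suc n) (\<lambda>i s. s)" by (simp add: lift_def)
    then show ?case by (intro exI[of _ "Suc n"] exI[of _ "\<lambda>i s. s"]) simp
  next
    case (insert v V)
    then have "\<exists>N \<phi> J. lift B' d (Suc n) N \<phi> \<and> (\<forall>v\<in>V. reach N \<phi> (J v) v)" by simp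
    then obtain N \<phi> J where N: "lift B' d (Suc n) N \<phi>" and J: "\<forall>v\<in>V. reach N \<phi> (J v) v"
      by (elim exE conjE) (rule that; assumption)
    note J = J[rule_format]
    have "valid (u' @ [v])" "prefix u (u' @ [v])"
      using u' insert.prems length_seqs[OF u'(1)] by (auto simp: valid_def)
    from al[OF this, of N] obtain j \<psi> where j: "N \<le> j" "prefix (u' @ [v]) (w j)" "lift B' d N j \<psi>"
      "\<And>x. x \<in> tups B' d N \<Longrightarrow> tup_le t x \<Longrightarrow> f j (map_tup \<psi> x) = \<epsilon>" unfolding alive_def by blast
    \<comment> \<open>Extending phi further does not affect the successors settled earlier: their colour
      depends on the first J v letters only.\<close>
    define \<phi>' where "\<phi>' = (\<lambda>i s. \<psi> i (\<phi> i s))"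
    have L: "lift B' d (Suc n) j \<phi>'" unfolding \<phi>'_def using lift_comp[OF N j(3)] .
    have ap: "map_tup \<phi>' x = map_tup \<psi> (map_tup \<phi> x)" for x by (simp add: map_tup_def \<phi>'_def)
    define J' where "J' = J(v := j)"
    have "reach j \<phi>' (J' v') v'" if v': "v' \<in> insert v V" for v'
    proof (cases "v' = v")
      case True
      have "f j (\<lambda>i. take j (map_tup \<phi>' x i)) = \<epsilon>" if x: "x \<in> tups B' d (Suc n)" "tup_le t' x" for x
      proof -
        have "map_tup \<phi>' x \<in> tups B' d j" using lift_tups[OF L x(1)] by blast
        then have "take j (map_tup \<phi>' x i) = map_tup \<phi>' x i" for i
          using length_seqs by (cases "i < d") (auto simp: tups_def)
        moreover have "f j (map_tup \<phi>' x) = \<epsilon>" unfolding ap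
          using j(4) lift_tups[OF N x(1)] t'(2) x(2) tup_le_trans by blast
        ultimately show ?thesis by simp
      qed
      then show ?thesis using True j by (simp add: J'_def reach_def)
    next
      case False
      then have vV: "v' \<in> V" "J' v' = J v'" using v' by (auto simp: J'_def)
      have "f (J v') (\<lambda>i. take (J v') (map_tup \<phi>' x i)) = \<epsilon>" if x: "x \<in> tups B' d (Suc n)" "tup_le t' x" for x
      proof -
        have p: "map_tup \<phi> x \<in> tups B' d N" using lift_tups[OF N x(1)] by blast
        have "take (J v') (map_tup \<phi>' x i) = take (J v') (map_tup \<phi> x i)" for i
          unfolding ap using lift_take[OF j(3) p reachD(1)[OF J[OF vV(1)]]] .
        then show ?thesis using reachD(3)[OF J[OF vV(1)] x] by simp
      qed
      then show ?thesis using vV reachD(1,2)[OF J[OF vV(1)]] j(1) by (simp add: reach_def)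
    qed
    then show ?case using L by (intro exI[of _ j] exI[of _ \<phi>'] exI[of _ J']) simp
  qed
  have finB: "finite (B (l n))" using B by (simp add: alphabet_def)
  obtain N \<phi> J where N: "lift B' d (Suc n) N \<phi>"
    and Jr: "\<forall>v\<in>B (l n). reach N \<phi> (J v) v"
    using iter[OF finB order_refl]
    by (elim exE conjE) (rule that; assumption)
  note J = reachD[OF Jr[rule_format]]
  \<comment> \<open>At level N2 and beyond each branch J v has passed through its node w (J v).\<close>
  define N2 where "N2 = N + (\<Sum>v\<in>B (l n). length (w (J v)))"
  have N2: "N \<le> N2" "\<And>v. v \<in> B (l n) \<Longrightarrow> length (w (J v)) \<le> N2"
  proof -
    show "N \<le> N2" by (simp add: N2_def)
    fix v assume "v \<in> B (l n)"
    then have "length (w (J v)) \<le> (\<Sum>v\<in>B (l n). length (w (J v)))"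
      using B by (intro member_le_sum) (auto simp: alphabet_def)
    then show "length (w (J v)) \<le> N2" by (simp add: N2_def)
  qed
  have nN: "Suc n \<le> N" using N by (simp add: lift_def)
  define \<psi> where "\<psi> = padt B' d N2"
  have L\<psi>: "lift B' d N N2 \<psi>" unfolding \<psi>_def using lift_padt[OF B' N2(1)] .
  define h where "h = (\<lambda>i s. \<psi> i (\<phi> i s))"
  have Lh: "lift B' d (Suc n) N2 h" unfolding h_def using lift_comp[OF N L\<psi>] .
  have h: "h i s \<in> seqs B' N2" "prefix s (h i s)" if "i < d" "s \<in> seqs B' (Suc n)" for i s
    using Lh that by (auto simp: lift_def)
  define M where "M = l N2"
  have lM: "Suc (l n) \<le> M" using st nN N2(1) unfolding M_def strong_def by (simp add: Suc_leI strict_mono_less)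
  define \<Phi> where "\<Phi> i s = (if i < d then (if prefix (E i (t' i)) s then E i (h i (t' i @ [last s])) else pad B M s)
    else if i = d then (if prefix u' s then xb (J (last s)) M else pad B M s) else [])" for i s
  define T where "T = (map_tup E t')(d := u')"
  have Ed: "E i [] = []" if "i \<ge> d" for i using st that by (simp add: strong_def)
  have ti: "t' i \<in> seqs B' n" if "i < d" for i using t' that by (simp add: tups_def)
  have T: "T \<in> tups B (Suc d) (l n)"
    using u'(1) st'(1) ti t'(1) Ed by (auto simp: T_def tups_def map_tup_def less_Suc_eq)
  have stepE: "\<exists>v\<in>B' n. s = E i (t' i) @ [v]"
    if "i < d" "s \<in> seqs B (Suc (l n))" "prefix (E i (t' i)) s" for i s
    using seqs_prefix_snoc[OF st'(1)[OF that(1) ti[OF that(1)]] that(2,3)] by (simp add: B'_def)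
  have stepu: "\<exists>v\<in>B (l n). s = u' @ [v]" if "s \<in> seqs B (Suc (l n))" "prefix u' s" for s
    using seqs_prefix_snoc[OF u'(1) that] .
  have L\<Phi>: "lift B (Suc d) (Suc (l n)) M \<Phi>" unfolding lift_def
  proof (intro conjI allI impI ballI)
    show "Suc (l n) \<le> M" by fact
    fix i s assume i: "i < Suc d" and s: "s \<in> seqs B (Suc (l n))"
    have "\<Phi> i s \<in> seqs B M \<and> prefix s (\<Phi> i s)"
    proof (cases "i < d")
      case True
      show ?thesis
      proof (cases "prefix (E i (t' i)) s")
        case p: True
        then obtain v where v: "v \<in> B' n" "s = E i (t' i) @ [v]" using stepE True s by blast
        have tv: "t' i @ [v] \<in> seqs B' (Suc n)" using ti[OF True] v by simp
        note ch = h[OF True tv]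
        obtain z where z: "h i (t' i @ [v]) = (t' i @ [v]) @ z" using ch(2) by (auto simp: prefix_def)
        have "prefix (E i (t' i @ [v])) (E i (h i (t' i @ [v])))"
          using strong_prefix[OF st True] ch(1) z unfolding B'_def by metis
        then have "prefix s (E i (h i (t' i @ [v])))"
          using st'(2)[OF True ti[OF True] v(1)] v(2) prefix_order.trans by blast
        then show ?thesis using st'(1)[OF True ch(1)] True p v by (simp add: \<Phi>_def M_def)
      next
        case False
        then show ?thesis using True pad_seqs[OF B s lM] by (simp add: \<Phi>_def)
      qed
    next
      case False
      then have i: "i = d" using i by simp
      show ?thesis
      proof (cases "prefix u' s")
        case True
        then obtain v where v: "v \<in> B (l n)" "s = u' @ [v]" using stepu s by blast
        have "length (w (J v)) \<le> M" using N2(2)[OF v(1)] ln[of N2] by (simp add: M_def)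
        then have "prefix s (xb (J v) M)" using xbw J(2)[OF v(1)] v prefix_order.trans by blast
        then show ?thesis using i True v xb by (simp add: \<Phi>_def)
      next
        case False
        then show ?thesis using i pad_seqs[OF B s lM] by (simp add: \<Phi>_def)
      qed
    qed
    then show "\<Phi> i s \<in> seqs B M" "prefix s (\<Phi> i s)" by auto
  qed (simp add: \<Phi>_def)
  have "c M (map_tup \<Phi> x) = \<epsilon>" if x: "x \<in> tups B (Suc d) (Suc (l n))" "tup_le T x" for x
  proof -
    have xE: "\<exists>v\<in>B' n. x i = E i (t' i) @ [v]" if "i < d" for i
      using stepE[OF that, of "x i"] x that unfolding tup_le_def T_def
      by (auto simp: tups_def map_tup_def) (metis nat_neq_iff)
    have "\<exists>v\<in>B (l n). x d = u' @ [v]"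
      using stepu[of "x d"] x unfolding tup_le_def T_def by (auto simp: tups_def) (metis)
    then obtain v where v: "v \<in> B (l n)" "x d = u' @ [v]" by blast
    define y where "y i = (if i < d then t' i @ [last (x i)] else [])" for i
    have y: "y \<in> tups B' d (Suc n)" using xE ti by (fastforce simp: y_def tups_def)
    have ty: "tup_le t' y" using t'(1) by (auto simp: tup_le_def y_def tups_def)
    have "map_tup \<Phi> x i = ((map_tup E (map_tup h y))(d := xb (J v) M)) i" for i
    proof -
      consider "i < d" | "i = d" | "i > d" by linarith
      then show ?thesis
      proof cases
        case 1 then show ?thesis using xE[OF 1] by (auto simp: map_tup_def \<Phi>_def y_def)
      next
        case 2 then show ?thesis using v by (simp add: map_tup_def \<Phi>_def)
      next
        case 3 then show ?thesis using Lh Ed by (simp add: map_tup_def \<Phi>_def y_def lift_def)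
      qed
    qed
    then have "c M (map_tup \<Phi> x) = cc (J v) (l N2) (map_tup E (map_tup h y))"
      unfolding cc_def M_def[symmetric] by (metis ext)
    also have "\<dots> = f (J v) (\<lambda>i. take (J v) (map_tup h y i))"
      using homD lift_tups(1)[OF Lh y] J(1)[OF v(1)] N2(1) order_trans by blast
    also have "map_tup h y = map_tup \<psi> (map_tup \<phi> y)" by (simp add: h_def map_tup_def)
    also have "(\<lambda>i. take (J v) (map_tup \<psi> (map_tup \<phi> y) i)) = (\<lambda>i. take (J v) (map_tup \<phi> y i))"
      using lift_take[OF L\<psi> lift_tups(1)[OF N y] J(1)[OF v(1)]] by (rule ext)
    also have "f (J v) (\<lambda>i. take (J v) (map_tup \<phi> y i)) = \<epsilon>" using J(3)[OF v(1) y ty] .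
    finally show ?thesis .
  qed
  then have "mono_lift B (Suc d) c T (Suc (l n)) \<epsilon>" unfolding mono_lift_def using L\<Phi> by blast
  then show "\<exists>n. \<exists>t\<in>tups B (Suc d) n. \<exists>\<epsilon>. mono_lift B (Suc d) c t (Suc n) \<epsilon>" using T by blast
qed

text \<open>
  Without trees a level is a single point, so the level \<open>1\<close> itself is a monochromatic lift.
\<close>

lemma HLweak_0: "HLweak 0"
  unfolding HLweak_def
proof (intro allI impI)
  fix B and c :: "nat \<Rightarrow> (nat \<Rightarrow> nat list) \<Rightarrow> bool"
  have t: "tups B 0 n = {\<lambda>_. []}" for n by (auto simp: tups_def)
  have "mono_lift B 0 c (\<lambda>_. []) (Suc 0) (c (Suc 0) (\<lambda>_. []))"
    unfolding mono_lift_def t by (intro exI[of _ "Suc 0"] exI[of _ "\<lambda>i s. s"]) (auto simp: lift_def map_tup_def)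
  then show "\<exists>n. \<exists>t\<in>tups B 0 n. \<exists>\<epsilon>. mono_lift B 0 c t (Suc n) \<epsilon>" by (metis t singletonI)
qed

lemma HLweak_all: "HLweak d"
  by (induction d) (simp_all add: HLweak_0 HLweak_Suc)

lemma Halpern_Lauchli_sequences:
  assumes "alphabet B"
  shows "(\<forall>k. mono_lift B d c (\<lambda>_. []) k True) \<or> (\<exists>n. \<exists>t\<in>tups B d n. \<forall>k. mono_lift B d c t k False)"
  using Halpern_Lauchli_dense_asym[OF HLstrong_if_dense[OF HLdense_if_weak[OF HLweak_all]] assms] .

section \<open>The Baire property and the Souslin operation\<close>

text \<open>
  Baire category relative to a family of sets that plays the role of a base of nonempty open sets.
\<close>

definition nowhere_dense_wrt :: "'x set set \<Rightarrow> 'x set \<Rightarrow> bool" where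
  "nowhere_dense_wrt \<B> N \<longleftrightarrow> (\<forall>b\<in>\<B>. \<exists>b'\<in>\<B>. b' \<subseteq> b \<and> b' \<inter> N = {})"

definition meagre_wrt :: "'x set set \<Rightarrow> 'x set \<Rightarrow> bool" where
  "meagre_wrt \<B> M \<longleftrightarrow> (\<exists>F. countable F \<and> (\<forall>N\<in>F. nowhere_dense_wrt \<B> N) \<and> M \<subseteq> \<Union>F)"

text \<open>
  The Baire property, expressed by density of the basic sets on which \<open>A\<close> is meagre or comeagre. This
  form is symmetric in \<open>A\<close> and its complement.
\<close>

definition baire_wrt :: "'x set set \<Rightarrow> 'x set \<Rightarrow> bool" where
  "baire_wrt \<B> A \<longleftrightarrow> (\<forall>b\<in>\<B>. \<exists>b'\<in>\<B>. b' \<subseteq> b \<and> (meagre_wrt \<B> (b' \<inter> A) \<or> meagre_wrt \<B> (b' - A)))"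

lemma meagre_subset: "meagre_wrt \<B> M \<Longrightarrow> N \<subseteq> M \<Longrightarrow> meagre_wrt \<B> N"
  unfolding meagre_wrt_def by (meson order_trans)

lemma meagre_nowhere_dense: "nowhere_dense_wrt \<B> N \<Longrightarrow> meagre_wrt \<B> N"
  unfolding meagre_wrt_def by (intro exI[of _ "{N}"]) auto

lemma meagre_UN:
  assumes "countable I" "\<And>i. i \<in> I \<Longrightarrow> meagre_wrt \<B> (M i)"
  shows "meagre_wrt \<B> (\<Union>i\<in>I. M i)"
proof -
  have "\<forall>i\<in>I. \<exists>F. countable F \<and> (\<forall>N\<in>F. nowhere_dense_wrt \<B> N) \<and> M i \<subseteq> \<Union>F"
    using assms(2) unfolding meagre_wrt_def by blast
  then obtain F where F: "\<forall>i\<in>I. countable (F i) \<and> (\<forall>N\<in>F i. nowhere_dense_wrt \<B> N) \<and> M i \<subseteq> \<Union>(F i)"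
    by (rule bchoice[THEN exE])
  show ?thesis unfolding meagre_wrt_def
  proof (intro exI[of _ "\<Union>i\<in>I. F i"] conjI)
    show "countable (\<Union>i\<in>I. F i)" using assms(1) F by (intro countable_UN) auto
    show "\<forall>N\<in>\<Union>i\<in>I. F i. nowhere_dense_wrt \<B> N" using F by blast
    show "(\<Union>i\<in>I. M i) \<subseteq> \<Union> (\<Union>i\<in>I. F i)" using F by fastforce
  qed
qed

lemma meagre_Un: "meagre_wrt \<B> M \<Longrightarrow> meagre_wrt \<B> N \<Longrightarrow> meagre_wrt \<B> (M \<union> N)"
  using meagre_UN[of "{True, False}" \<B> "\<lambda>i. if i then M else N"] by (simp add: Un_commute)

lemma baire_compl:
  assumes "baire_wrt \<B> A" "\<Union>\<B> \<subseteq> X" shows "baire_wrt \<B> (X - A)"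
proof -
  have "b \<inter> (X - A) = b - A" "b - (X - A) = b \<inter> A" if "b \<in> \<B>" for b
    using assms(2) that by blast+
  then show ?thesis using assms(1) unfolding baire_wrt_def by metis
qed

lemma baire_Un:
  assumes "baire_wrt \<B> A" "baire_wrt \<B> C" shows "baire_wrt \<B> (A \<union> C)"
  unfolding baire_wrt_def
proof
  fix b assume "b \<in> \<B>"
  then obtain b1 where b1: "b1 \<in> \<B>" "b1 \<subseteq> b" "meagre_wrt \<B> (b1 \<inter> A) \<or> meagre_wrt \<B> (b1 - A)"
    using assms(1) unfolding baire_wrt_def by blast
  then obtain b2 where b2: "b2 \<in> \<B>" "b2 \<subseteq> b1" "meagre_wrt \<B> (b2 \<inter> C) \<or> meagre_wrt \<B> (b2 - C)"
    using assms(2) unfolding baire_wrt_def by blast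
  have "meagre_wrt \<B> (b2 \<inter> A) \<or> meagre_wrt \<B> (b2 - A)"
    using b1(3) b2(2) meagre_subset by (metis Diff_mono Int_mono order_refl)
  then have "meagre_wrt \<B> (b2 \<inter> (A \<union> C)) \<or> meagre_wrt \<B> (b2 - (A \<union> C))"
    using b2(3) meagre_Un meagre_subset by (metis Diff_mono Int_Un_distrib order_refl sup_ge1 sup_ge2)
  then show "\<exists>b'\<in>\<B>. b' \<subseteq> b \<and> (meagre_wrt \<B> (b' \<inter> (A \<union> C)) \<or> meagre_wrt \<B> (b' - (A \<union> C)))"
    using b1 b2 by blast
qed

text \<open>
  The hypothesis is openness with respect to the base, and such a set decides basic sets without any exception.
\<close>

lemma baire_open:
  assumes "\<And>b. b \<in> \<B> \<Longrightarrow> b \<inter> S \<noteq> {} \<Longrightarrow> \<exists>b'\<in>\<B>. b' \<subseteq> b \<inter> S"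
  shows "baire_wrt \<B> S"
proof -
  have m: "meagre_wrt \<B> {}" by (rule meagre_nowhere_dense) (auto simp: nowhere_dense_wrt_def)
  show ?thesis unfolding baire_wrt_def
  proof
    fix b assume b: "b \<in> \<B>"
    show "\<exists>b'\<in>\<B>. b' \<subseteq> b \<and> (meagre_wrt \<B> (b' \<inter> S) \<or> meagre_wrt \<B> (b' - S))"
    proof (cases "b \<inter> S = {}")
      case True then show ?thesis using b m by auto
    next
      case False
      then obtain b' where "b' \<in> \<B>" "b' \<subseteq> b \<inter> S" using assms b by blast
      moreover have "b' - S = {}" using calculation by blast
      ultimately show ?thesis using m by (metis le_inf_iff)
    qed
  qed
qed

text \<open>
  Nikodym's theorem. Let \<open>A s\<close> be the part of the Souslin set that comes from sequences extending \<open>s\<close>, and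
  \<open>O' s\<close> the largest open set in which \<open>A s\<close> is meagre, so that the complement of \<open>O' s\<close> is a hull of \<open>A s\<close>.
  Up to meagre sets, the hull of \<open>A s\<close> lies in \<open>X s\<close> and is covered by the hulls of the \<open>A (s @ [i])\<close>. A point
  outside the two exceptional sets that lies in the hull of \<open>A []\<close> therefore descends along a branch through
  hulls, and so belongs to the Souslin set: \<open>A []\<close> is meagre in \<open>O' []\<close> and comeagre outside.
\<close>

lemma baire_souslin:
  assumes cB: "countable \<B>" and ne: "{} \<notin> \<B>"
    and base: "\<And>b c. b \<in> \<B> \<Longrightarrow> c \<in> \<B> \<Longrightarrow> b \<inter> c \<noteq> {} \<Longrightarrow> \<exists>b'\<in>\<B>. b' \<subseteq> b \<inter> c"
    and X: "\<And>s. baire_wrt \<B> (X s)"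
  shows "baire_wrt \<B> (souslin_op X)"
proof -
  define A where "A s = {x. \<exists>\<sigma> :: nat \<Rightarrow> nat. map \<sigma> [0..<length s] = s \<and> (\<forall>n. x \<in> X (map \<sigma> [0..<n]))}" for s
  have A0: "A [] = souslin_op X" by (auto simp: A_def souslin_op_def)
  have AX: "A s \<subseteq> X s" for s by (auto simp: A_def) metis
  have AU: "A s \<subseteq> (\<Union>i. A (s @ [i]))" for s
  proof
    fix x assume "x \<in> A s"
    then obtain \<sigma> :: "nat \<Rightarrow> nat" where s: "map \<sigma> [0..<length s] = s" "\<forall>n. x \<in> X (map \<sigma> [0..<n])"
      by (auto simp: A_def)
    then have "x \<in> A (s @ [\<sigma> (length s)])" unfolding A_def by (auto intro!: exI[of _ \<sigma>])
    then show "x \<in> (\<Union>i. A (s @ [i]))" by blast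
  qed
  define Z where "Z s = {b \<in> \<B>. meagre_wrt \<B> (b \<inter> A s)}" for s
  define O' where "O' s = \<Union>(Z s)" for s
  define S where "S = \<Union>\<B>"
  have OA: "meagre_wrt \<B> (O' s \<inter> A s)" for s
  proof -
    have "countable (Z s)" using cB by (simp add: Z_def)
    then have "meagre_wrt \<B> (\<Union>b\<in>Z s. b \<inter> A s)" by (rule meagre_UN) (simp add: Z_def)
    then show ?thesis by (rule meagre_subset) (auto simp: O'_def)
  qed
  have OI: "b \<subseteq> O' s" if "b \<in> \<B>" "meagre_wrt \<B> (b \<inter> A s)" for b s
    using that by (auto simp: O'_def Z_def)
  have sub: "\<exists>b'\<in>\<B>. b' \<subseteq> b \<and> b' \<subseteq> O' s" if A: "b \<in> \<B>" "b \<inter> O' s \<noteq> {}" for b s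
  proof -
    obtain c where c: "c \<in> Z s" "b \<inter> c \<noteq> {}" using A(2) by (auto simp: O'_def)
    then obtain b' where "b' \<in> \<B>" "b' \<subseteq> b \<inter> c" using base[OF A(1), of c] by (auto simp: Z_def)
    then show ?thesis using c by (intro bexI[of _ b']) (auto simp: O'_def)
  qed
  \<comment> \<open>R s: points of the hull of A s missed by all hulls one step further; V s: points of the hull outside X s.\<close>
  define R where "R s = {x \<in> S. x \<notin> O' s \<and> (\<forall>i. x \<in> O' (s @ [i]))}" for s
  define V where "V s = {x \<in> S. x \<notin> O' s \<and> x \<notin> X s}" for s
  have R: "nowhere_dense_wrt \<B> (R s)" for s
    unfolding nowhere_dense_wrt_def
  proof
    fix b assume b: "b \<in> \<B>"
    show "\<exists>b'\<in>\<B>. b' \<subseteq> b \<and> b' \<inter> R s = {}"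
    proof (cases "b \<inter> O' s = {}")
      case False
      then show ?thesis using sub[OF b] by (fastforce simp: R_def)
    next
      case True
      show ?thesis
      proof (rule ccontr)
        assume no: "\<not> ?thesis"
        \<comment> \<open>If no basic subset of b avoids R s, then O' (s @ [i]) is dense in b for all i, whence A s is
          meagre in b and b lies inside O' s.\<close>
        have "nowhere_dense_wrt \<B> (b - O' (s @ [i]))" for i
          unfolding nowhere_dense_wrt_def
        proof
          fix c assume c: "c \<in> \<B>"
          show "\<exists>c'\<in>\<B>. c' \<subseteq> c \<and> c' \<inter> (b - O' (s @ [i])) = {}"
          proof (cases "c \<inter> b = {}")
            case True then show ?thesis using c by blast
          next
            case False
            then obtain c1 where c1: "c1 \<in> \<B>" "c1 \<subseteq> c \<inter> b" using base[OF c b] by blast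
            have "c1 \<inter> O' (s @ [i]) \<noteq> {}"
            proof
              assume "c1 \<inter> O' (s @ [i]) = {}"
              then have "c1 \<inter> R s = {}" by (auto simp: R_def)
              then show False using no c1 by blast
            qed
            then obtain c2 where "c2 \<in> \<B>" "c2 \<subseteq> c1" "c2 \<subseteq> O' (s @ [i])" using sub[OF c1(1)] by blast
            then show ?thesis using c1 by blast
          qed
        qed
        then have 1: "meagre_wrt \<B> (\<Union>i. b - O' (s @ [i]))" by (intro meagre_UN meagre_nowhere_dense) auto
        have 2: "meagre_wrt \<B> (\<Union>i. O' (s @ [i]) \<inter> A (s @ [i]))" using OA by (intro meagre_UN) auto
        have "b \<inter> A s \<subseteq> (\<Union>i. b - O' (s @ [i])) \<union> (\<Union>i. O' (s @ [i]) \<inter> A (s @ [i]))"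
          using AU[of s] by blast
        then have "meagre_wrt \<B> (b \<inter> A s)" using meagre_Un[OF 1 2] meagre_subset by blast
        then have "b \<subseteq> O' s" using OI b by blast
        then have "b = {}" using True by blast
        then show False using b ne by simp
      qed
    qed
  qed
  have V: "meagre_wrt \<B> (V s)" for s
  proof -
    define D where "D = {b \<in> \<B>. meagre_wrt \<B> (b \<inter> V s)}"
    have "\<exists>b'\<in>D. b' \<subseteq> b" if b: "b \<in> \<B>" for b
    proof -
      obtain b' where b': "b' \<in> \<B>" "b' \<subseteq> b" "meagre_wrt \<B> (b' \<inter> X s) \<or> meagre_wrt \<B> (b' - X s)"
        using X[of s] b unfolding baire_wrt_def by blast
      have "meagre_wrt \<B> (b' \<inter> V s)"
        using b'(3)
      proof
        assume "meagre_wrt \<B> (b' \<inter> X s)"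
        then have m: "meagre_wrt \<B> (b' \<inter> A s)" by (rule meagre_subset) (use AX in blast)
        then have "b' \<inter> V s = {}" using OI[OF b'(1) m] by (auto simp: V_def)
        then show ?thesis using m meagre_subset by (metis empty_subsetI)
      next
        assume "meagre_wrt \<B> (b' - X s)"
        then show ?thesis by (rule meagre_subset) (auto simp: V_def)
      qed
      then show ?thesis using b' by (auto simp: D_def)
    qed
    then have "nowhere_dense_wrt \<B> (S - \<Union>D)"
      unfolding nowhere_dense_wrt_def D_def by blast
    moreover have "meagre_wrt \<B> (\<Union>b\<in>D. b \<inter> V s)"
      using cB by (intro meagre_UN) (auto simp: D_def)
    ultimately have "meagre_wrt \<B> ((S - \<Union>D) \<union> (\<Union>b\<in>D. b \<inter> V s))"
      using meagre_Un[OF meagre_nowhere_dense] by blast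
    then show ?thesis by (rule meagre_subset) (auto simp: V_def)
  qed
  have "meagre_wrt \<B> ((\<Union>s. R s) \<union> (\<Union>s. V s))"
    using R V by (intro meagre_Un meagre_UN) (auto intro: meagre_nowhere_dense)
  moreover have "S - O' [] - A [] \<subseteq> (\<Union>s. R s) \<union> (\<Union>s. V s)"
  proof
    fix x assume x: "x \<in> S - O' [] - A []"
    show "x \<in> (\<Union>s. R s) \<union> (\<Union>s. V s)"
    proof (rule ccontr)
      assume no: "\<not> ?thesis"
      have nx: "\<exists>i. x \<notin> O' (s @ [i])" if "x \<notin> O' s" for s using no x that by (auto simp: R_def)
      have inX: "x \<in> X s" if "x \<notin> O' s" for s using no x that by (auto simp: V_def)
      define \<tau> where "\<tau> = rec_nat [] (\<lambda>_ s. s @ [SOME i. x \<notin> O' (s @ [i])])"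
      have \<tau>: "\<tau> 0 = []" "\<tau> (Suc n) = \<tau> n @ [SOME i. x \<notin> O' (\<tau> n @ [i])]" for n by (simp_all add: \<tau>_def)
      have t: "x \<notin> O' (\<tau> n) \<and> length (\<tau> n) = n" for n
      proof (induction n)
        case 0 then show ?case using x \<tau> by simp
      next
        case (Suc n)
        then show ?case using someI_ex[OF nx[of "\<tau> n"]] \<tau> by simp
      qed
      define \<sigma> where "\<sigma> n = last (\<tau> (Suc n))" for n
      have "map \<sigma> [0..<n] = \<tau> n" for n
        by (induction n) (use \<tau> in \<open>simp_all add: \<sigma>_def\<close>)
      then have "x \<in> A []" unfolding A_def using inX t by (auto intro!: exI[of _ \<sigma>])
      then show False using x by blast
    qed
  qed
  ultimately have big: "meagre_wrt \<B> (S - O' [] - A [])" by (rule meagre_subset)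
  show ?thesis unfolding A0[symmetric] baire_wrt_def
  proof
    fix b assume b: "b \<in> \<B>"
    show "\<exists>b'\<in>\<B>. b' \<subseteq> b \<and> (meagre_wrt \<B> (b' \<inter> A []) \<or> meagre_wrt \<B> (b' - A []))"
    proof (cases "b \<inter> O' [] = {}")
      case True
      then have "b - A [] \<subseteq> S - O' [] - A []" using b by (auto simp: S_def)
      then show ?thesis using b big meagre_subset by blast
    next
      case False
      then obtain b' where b': "b' \<in> \<B>" "b' \<subseteq> b" "b' \<subseteq> O' []" using sub[OF b] by blast
      have "meagre_wrt \<B> (b' \<inter> A [])" by (rule meagre_subset[OF OA]) (use b' in blast)
      then show ?thesis using b' by blast
    qed
  qed
qed

text \<open>
  The preimages under \<open>f\<close> that have the Baire property come from an algebra that contains the open sets and is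
  closed under the Souslin operation, hence from all Souslin measurable sets.
\<close>

lemma souslin_measurable_baire:
  assumes P: "P \<in> souslin_measurable_sets X"
    and cB: "countable \<B>" and ne: "{} \<notin> \<B>"
    and base: "\<And>b c. b \<in> \<B> \<Longrightarrow> c \<in> \<B> \<Longrightarrow> b \<inter> c \<noteq> {} \<Longrightarrow> \<exists>b'\<in>\<B>. b' \<subseteq> b \<inter> c"
    and f: "f ` \<Union>\<B> \<subseteq> topspace X"
    and cont: "\<And>b S. openin X S \<Longrightarrow> b \<in> \<B> \<Longrightarrow> b \<inter> f -` S \<noteq> {} \<Longrightarrow> \<exists>b'\<in>\<B>. b' \<subseteq> b \<inter> f -` S"
  shows "baire_wrt \<B> (f -` P)"
proof -
  define M where "M = {S. S \<subseteq> topspace X \<and> baire_wrt \<B> (f -` S)}"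
  have co: "topspace X - A \<in> M" if "A \<in> M" for A
  proof -
    have "baire_wrt \<B> (UNIV - f -` A)" using that by (intro baire_compl) (auto simp: M_def)
    moreover have "b \<inter> (UNIV - f -` A) = b \<inter> f -` (topspace X - A)"
      "b - (UNIV - f -` A) = b - f -` (topspace X - A)" if "b \<in> \<B>" for b
      using f that by blast+
    ultimately have "baire_wrt \<B> (f -` (topspace X - A))" unfolding baire_wrt_def by metis
    then show ?thesis by (auto simp: M_def)
  qed
  have op: "S \<in> M" if "openin X S" for S
  proof -
    have "baire_wrt \<B> (f -` S)" by (rule baire_open) (rule cont[OF that])
    then show ?thesis using openin_subset[OF that] by (simp add: M_def)
  qed
  have "algebra (topspace X) M" unfolding algebra_iff_Un
  proof (intro conjI ballI)
    show "M \<subseteq> Pow (topspace X)" by (auto simp: M_def)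
    show "{} \<in> M" using op by simp
    show "a \<union> b \<in> M" if "a \<in> M" "b \<in> M" for a b
      using that baire_Un[of \<B> "f -` a" "f -` b"] by (auto simp: M_def vimage_Un)
  qed (rule co)
  moreover have "souslin_op F \<in> M" if F: "range F \<subseteq> M" for F
  proof -
    have "f -` souslin_op F = souslin_op (\<lambda>s. f -` F s)" by (auto simp: souslin_op_def)
    moreover have "baire_wrt \<B> (souslin_op (\<lambda>s. f -` F s))"
      using F by (intro baire_souslin[OF cB ne base]) (auto simp: M_def)
    moreover have "souslin_op F \<subseteq> topspace X" using F by (fastforce simp: souslin_op_def M_def)
    ultimately show ?thesis by (simp add: M_def)
  qed
  ultimately have "P \<in> M" using P op unfolding souslin_measurable_sets_def by blast
  then show ?thesis by (simp add: M_def)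
qed

text \<open>
  Each basic set that decides \<open>A\<close> does so up to a meagre set. The base being countable, all these exceptions
  can be covered by a single sequence of nowhere dense sets.
\<close>

lemma baire_decided:
  assumes cB: "countable \<B>" and A: "baire_wrt \<B> A"
  shows "\<exists>F :: nat \<Rightarrow> 'x set. (\<forall>n. nowhere_dense_wrt \<B> (F n)) \<and>
    (\<forall>b\<in>\<B>. \<exists>b'\<in>\<B>. b' \<subseteq> b \<and> (b' - (\<Union>n. F n) \<subseteq> A \<or> (b' - (\<Union>n. F n)) \<inter> A = {}))"
proof -
  define D1 D2 where "D1 = {b \<in> \<B>. meagre_wrt \<B> (b \<inter> A)}" and "D2 = {b \<in> \<B>. meagre_wrt \<B> (b - A)}"
  have "countable D1" "countable D2" using cB by (simp_all add: D1_def D2_def)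
  then have "meagre_wrt \<B> ((\<Union>b\<in>D1. b \<inter> A) \<union> (\<Union>b\<in>D2. b - A))"
    by (intro meagre_Un meagre_UN) (auto simp: D1_def D2_def)
  then obtain F where F: "countable F" "\<forall>N\<in>F. nowhere_dense_wrt \<B> N" "(\<Union>b\<in>D1. b \<inter> A) \<union> (\<Union>b\<in>D2. b - A) \<subseteq> \<Union>F"
    unfolding meagre_wrt_def by (elim exE conjE) (rule that; assumption)
  have e: "nowhere_dense_wrt \<B> {}" by (auto simp: nowhere_dense_wrt_def)
  define G where "G = from_nat_into (insert {} F)"
  have rG: "range G = insert {} F" using F(1) by (simp add: G_def range_from_nat_into)
  show ?thesis
  proof (intro exI[of _ G] conjI allI ballI)
    show "nowhere_dense_wrt \<B> (G n)" for n using rG F(2) e by (metis insertE rangeI)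
    fix b assume "b \<in> \<B>"
    then obtain b' where b': "b' \<in> \<B>" "b' \<subseteq> b" "b' \<in> D1 \<or> b' \<in> D2"
      using A by (auto simp: baire_wrt_def D1_def D2_def)
    have "(\<Union>b\<in>D1. b \<inter> A) \<union> (\<Union>b\<in>D2. b - A) \<subseteq> (\<Union>n. G n)" using F(3) rG by simp
    then show "\<exists>b'\<in>\<B>. b' \<subseteq> b \<and> (b' - (\<Union>n. G n) \<subseteq> A \<or> (b' - (\<Union>n. G n)) \<inter> A = {})"
      using b'(3) by (intro bexI[OF _ b'(1)] conjI b'(2)) blast
  qed
qed

section \<open>Sets with a minimum and their owners\<close>

text \<open>
  The order-theoretic skeleton of a level product. The points of the space under consideration are the subsets of \<open>Q\<close>
  with a minimum, that is, the index sets of the unions in the span of a subspace.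
\<close>

locale levelled_poset =
  fixes Q :: "'q set" and lev :: "'q \<Rightarrow> nat" and le :: "'q \<Rightarrow> 'q \<Rightarrow> bool"
  assumes le_refl: "t \<in> Q \<Longrightarrow> le t t"
    and le_trans: "s \<in> Q \<Longrightarrow> t \<in> Q \<Longrightarrow> u \<in> Q \<Longrightarrow> le s t \<Longrightarrow> le t u \<Longrightarrow> le s u"
    and le_lev: "s \<in> Q \<Longrightarrow> t \<in> Q \<Longrightarrow> le s t \<Longrightarrow> s = t \<or> lev s < lev t"
    and finite_below: "finite {t \<in> Q. lev t < N}"
begin

definition low :: "nat \<Rightarrow> 'q set" where "low N = {t \<in> Q. lev t < N}"

definition has_min :: "'q set \<Rightarrow> bool" where
  "has_min \<Gamma> \<longleftrightarrow> \<Gamma> \<subseteq> Q \<and> (\<exists>m\<in>\<Gamma>. \<forall>t\<in>\<Gamma>. le m t)"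

text \<open>
  The intersection with the finite set \<^term>\<open>low N\<close> is prescribed, as for basic open sets of a product. In the
  members of \<open>cylinders\<close> the prescribed part is nonempty, so it contains the minimum of every element.
\<close>

definition cyl :: "'q set \<Rightarrow> nat \<Rightarrow> 'q set set" where
  "cyl \<Gamma> N = {\<Delta>. has_min \<Delta> \<and> \<Delta> \<inter> low N = \<Gamma>}"

definition cylinders :: "'q set set set" where
  "cylinders = {cyl \<Gamma> N | \<Gamma> N. has_min \<Gamma> \<and> \<Gamma> \<subseteq> low N}"

lemma low_Q: "low N \<subseteq> Q" by (auto simp: low_def)
lemma low_mono: "N \<le> N' \<Longrightarrow> low N \<subseteq> low N'" by (auto simp: low_def)
lemma finite_low: "finite (low N)" using finite_below by (simp add: low_def)

lemma cyl_self: "has_min \<Gamma> \<Longrightarrow> \<Gamma> \<subseteq> low N \<Longrightarrow> \<Gamma> \<in> cyl \<Gamma> N"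
  by (auto simp: cyl_def)

lemma has_min_low:
  assumes "has_min \<Gamma>" "\<Gamma> \<inter> low N \<noteq> {}" shows "has_min (\<Gamma> \<inter> low N)"
proof -
  obtain m where m: "\<Gamma> \<subseteq> Q" "m \<in> \<Gamma>" "\<forall>t\<in>\<Gamma>. le m t" using assms(1) by (auto simp: has_min_def)
  obtain t where t: "t \<in> \<Gamma>" "t \<in> Q" "lev t < N" using assms(2) by (auto simp: low_def)
  then have "m = t \<or> lev m < lev t" using le_lev m by blast
  then have "m \<in> low N" using t m by (auto simp: low_def)
  then show ?thesis using m by (auto simp: has_min_def)
qed

lemma cyl_antimono: "\<Gamma>' \<inter> low N = \<Gamma> \<Longrightarrow> N \<le> N' \<Longrightarrow> cyl \<Gamma>' N' \<subseteq> cyl \<Gamma> N"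
  using low_mono by (auto simp: cyl_def)

lemma countable_cylinders: "countable cylinders"
proof -
  have "cylinders \<subseteq> (\<Union>N. (\<lambda>\<Gamma>. cyl \<Gamma> N) ` Pow (low N))" by (auto simp: cylinders_def)
  moreover have "countable (\<Union>N. (\<lambda>\<Gamma>. cyl \<Gamma> N) ` Pow (low N))"
    by (rule countable_UN[OF countableI_type]) (intro countable_image countable_finite, simp add: finite_low)
  ultimately show ?thesis by (rule countable_subset)
qed

lemma cylinders_nonempty: "{} \<notin> cylinders"
  using cyl_self by (auto simp: cylinders_def)

lemma cyl_inside:
  assumes "\<Delta> \<in> b" "b \<in> cylinders"
  shows "\<exists>N0. \<forall>N\<ge>N0. cyl (\<Delta> \<inter> low N) N \<subseteq> b \<and> cyl (\<Delta> \<inter> low N) N \<in> cylinders \<and> \<Delta> \<in> cyl (\<Delta> \<inter> low N) N"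
proof -
  obtain \<Gamma> N0 where b: "b = cyl \<Gamma> N0" "has_min \<Gamma>" "\<Gamma> \<subseteq> low N0" using assms(2) by (auto simp: cylinders_def)
  have d: "has_min \<Delta>" "\<Delta> \<inter> low N0 = \<Gamma>" using assms(1) b by (auto simp: cyl_def)
  have g: "\<Gamma> \<noteq> {}" using b(2) by (auto simp: has_min_def)
  show ?thesis
  proof (intro exI[of _ N0] allI impI conjI)
    fix N assume N: "N0 \<le> N"
    show "cyl (\<Delta> \<inter> low N) N \<subseteq> b" unfolding b(1)
      using d(2) low_mono[OF N] by (intro cyl_antimono[OF _ N]) blast
    have "\<Delta> \<inter> low N \<noteq> {}" using g d(2) low_mono[OF N] by blast
    then have "has_min (\<Delta> \<inter> low N)" by (rule has_min_low[OF d(1)])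
    then show "cyl (\<Delta> \<inter> low N) N \<in> cylinders" by (auto simp: cylinders_def)
    show "\<Delta> \<in> cyl (\<Delta> \<inter> low N) N" using d by (simp add: cyl_def)
  qed
qed

lemma cylinders_base:
  assumes "b \<in> cylinders" "c \<in> cylinders" "b \<inter> c \<noteq> {}"
  shows "\<exists>b'\<in>cylinders. b' \<subseteq> b \<inter> c"
proof -
  obtain \<Delta> where d: "\<Delta> \<in> b" "\<Delta> \<in> c" using assms(3) by blast
  obtain N1 where N1: "\<forall>N\<ge>N1. cyl (\<Delta> \<inter> low N) N \<subseteq> b \<and> cyl (\<Delta> \<inter> low N) N \<in> cylinders \<and> \<Delta> \<in> cyl (\<Delta> \<inter> low N) N"
    using cyl_inside[OF d(1) assms(1)] by blast
  obtain N2 where N2: "\<forall>N\<ge>N2. cyl (\<Delta> \<inter> low N) N \<subseteq> c \<and> cyl (\<Delta> \<inter> low N) N \<in> cylinders \<and> \<Delta> \<in> cyl (\<Delta> \<inter> low N) N"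
    using cyl_inside[OF d(2) assms(2)] by blast
  show ?thesis using N1 N2 by (intro bexI[of _ "cyl (\<Delta> \<inter> low (max N1 N2)) (max N1 N2)"]) auto
qed

text \<open>
  A partial function \<open>ow\<close>, considered on the levels below \<open>N\<close>, assigns owners; \<^const>\<open>None\<close> means that the
  element is discarded. The new subspace attaches to a retained index the union over all elements it
  owns. The roots, which own themselves, are the indices retained so far.
\<close>

definition owned_by :: "nat \<Rightarrow> ('q \<Rightarrow> 'q option) \<Rightarrow> 'q set \<Rightarrow> 'q set" where
  "owned_by N ow \<Gamma> = {s \<in> low N. \<exists>u\<in>\<Gamma>. ow s = Some u}"

definition roots :: "nat \<Rightarrow> ('q \<Rightarrow> 'q option) \<Rightarrow> 'q set" where
  "roots N ow = {t \<in> low N. ow t = Some t}"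

definition owned :: "nat \<Rightarrow> ('q \<Rightarrow> 'q option) \<Rightarrow> bool" where
  "owned N ow \<longleftrightarrow> (\<forall>s\<in>low N. \<forall>t. ow s = Some t \<longrightarrow> t \<in> roots N ow \<and> le t s)"

text \<open>
  A continuation of the assignment to further levels in which no new roots appear.
\<close>

definition extends :: "nat \<Rightarrow> ('q \<Rightarrow> 'q option) \<Rightarrow> nat \<Rightarrow> ('q \<Rightarrow> 'q option) \<Rightarrow> bool" where
  "extends N ow N' ow' \<longleftrightarrow> N \<le> N' \<and> (\<forall>s. lev s < N \<longrightarrow> ow' s = ow s) \<and>
     (\<forall>s\<in>low N'. \<forall>t. N \<le> lev s \<longrightarrow> ow' s = Some t \<longrightarrow> t \<in> roots N ow \<and> le t s)"

lemma extends_refl: "extends N ow N ow" by (auto simp: extends_def low_def)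

lemma roots_extends:
  assumes "extends N ow N' ow'" shows "roots N' ow' = roots N ow"
proof (rule set_eqI)
  fix t show "t \<in> roots N' ow' \<longleftrightarrow> t \<in> roots N ow"
    using assms by (cases "lev t < N") (auto simp: extends_def roots_def low_def)
qed

lemma extends_trans:
  assumes e1: "extends N ow N' ow'" and e2: "extends N' ow' N'' ow''" shows "extends N ow N'' ow''"
  unfolding extends_def
proof (intro conjI allI impI ballI)
  show "N \<le> N''" using assms by (simp add: extends_def)
  show "ow'' s = ow s" if "lev s < N" for s using assms that by (simp add: extends_def)
  fix s t assume s: "s \<in> low N''" "N \<le> lev s" "ow'' s = Some t"
  show "t \<in> roots N ow" "le t s"
  proof -
    have "t \<in> roots N ow \<and> le t s"
    proof (cases "lev s < N'")
      case True
      then have "ow' s = Some t" "s \<in> low N'" using e2 s by (auto simp: extends_def low_def)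
      then show ?thesis using e1 s(2) by (simp add: extends_def)
    next
      case False
      then show ?thesis using e2 s roots_extends[OF e1] by (auto simp: extends_def)
    qed
    then show "t \<in> roots N ow" "le t s" by auto
  qed
qed

lemma owned_extends:
  assumes "owned N ow" and e: "extends N ow N' ow'" shows "owned N' ow'"
  unfolding owned_def roots_extends[OF e]
proof (intro ballI allI impI)
  fix s t assume s: "s \<in> low N'" "ow' s = Some t"
  show "t \<in> roots N ow \<and> le t s"
  proof (cases "lev s < N")
    case True
    then have "s \<in> low N" "ow s = Some t" using s e by (auto simp: low_def extends_def)
    then show ?thesis using assms(1) by (simp add: owned_def)
  next
    case False then show ?thesis using s e by (auto simp: extends_def)
  qed
qed

lemma owned_by_extends:
  assumes "extends N ow N' ow'" shows "owned_by N' ow' \<Gamma> \<inter> low N = owned_by N ow \<Gamma>"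
  using assms by (auto simp: owned_by_def extends_def low_def)

lemma owned_by_has_min:
  assumes "owned N ow" "t \<in> \<Gamma>" "t \<in> roots N ow" "\<Gamma> \<subseteq> Q" "\<And>s. s \<in> \<Gamma> \<Longrightarrow> le t s"
  shows "t \<in> owned_by N ow \<Gamma>" "s \<in> owned_by N ow \<Gamma> \<Longrightarrow> le t s" "has_min (owned_by N ow \<Gamma>)"
proof -
  show 1: "t \<in> owned_by N ow \<Gamma>" using assms by (auto simp: owned_by_def roots_def)
  have 2: "le t s" if "s \<in> owned_by N ow \<Gamma>" for s
  proof -
    obtain u where u: "u \<in> \<Gamma>" "ow s = Some u" "s \<in> low N" using \<open>s \<in> owned_by N ow \<Gamma>\<close> by (auto simp: owned_by_def)
    then have "le u s" using assms(1) by (auto simp: owned_def)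
    then show ?thesis using le_trans[of t u s] assms u low_Q by blast
  qed
  then show "s \<in> owned_by N ow \<Gamma> \<Longrightarrow> le t s" .
  have "owned_by N ow \<Gamma> \<subseteq> Q" using low_Q by (auto simp: owned_by_def)
  then show "has_min (owned_by N ow \<Gamma>)" using 1 2 by (auto simp: has_min_def)
qed

text \<open>
  The possible traces, on the levels below \<open>N\<close>, of an index set of a union in the new span.
\<close>

definition patterns :: "nat \<Rightarrow> ('q \<Rightarrow> 'q option) \<Rightarrow> 'q set set" where
  "patterns N ow = {\<Gamma>. \<Gamma> \<subseteq> roots N ow \<and> (\<exists>t\<in>\<Gamma>. \<forall>s\<in>\<Gamma>. le t s)}"

lemma patterns_extends: "extends N ow N' ow' \<Longrightarrow> patterns N' ow' = patterns N ow"
  by (simp add: patterns_def roots_extends)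

lemma finite_patterns: "finite (patterns N ow)"
proof (rule finite_subset)
  show "patterns N ow \<subseteq> Pow (low N)" by (auto simp: patterns_def roots_def)
qed (simp add: finite_low)

definition open_dense :: "('q set set \<Rightarrow> bool) \<Rightarrow> bool" where
  "open_dense ok \<longleftrightarrow> (\<forall>b\<in>cylinders. \<exists>b'\<in>cylinders. b' \<subseteq> b \<and> ok b') \<and>
     (\<forall>b b'. ok b \<longrightarrow> b' \<subseteq> b \<longrightarrow> ok b')"

lemma open_denseD:
  assumes "open_dense ok"
  shows "b \<in> cylinders \<Longrightarrow> \<exists>b'\<in>cylinders. b' \<subseteq> b \<and> ok b'" "ok b \<Longrightarrow> b' \<subseteq> b \<Longrightarrow> ok b'"
  using assms unfolding open_dense_def by blast+

text \<open>
  The set owned by \<open>\<Gamma>\<close> spans a cylinder, which contains a smaller one with the desired property. Giving the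
  additional elements of the smaller cylinder to the least element \<open>t\<close> of \<open>\<Gamma>\<close> is possible since they all lie
  above \<open>t\<close>.
\<close>

lemma decide_pattern:
  assumes ow: "owned N ow" and \<Gamma>: "\<Gamma> \<in> patterns N ow"
    and od: "open_dense ok"
  shows "\<exists>N' ow'. extends N ow N' ow' \<and> ok (cyl (owned_by N' ow' \<Gamma>) N')"
proof -
  obtain t where t: "t \<in> \<Gamma>" "\<And>s. s \<in> \<Gamma> \<Longrightarrow> le t s" and \<Gamma>r: "\<Gamma> \<subseteq> roots N ow"
    using \<Gamma> unfolding patterns_def by blast
  have \<Gamma>Q: "\<Gamma> \<subseteq> Q" using \<Gamma>r low_Q by (auto simp: roots_def)
  have tr: "t \<in> roots N ow" using t \<Gamma>r by blast
  let ?p = "owned_by N ow \<Gamma>"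
  note pm = owned_by_has_min[OF ow t(1) tr \<Gamma>Q t(2)]
  have "?p \<subseteq> low N" by (auto simp: owned_by_def)
  then have "cyl ?p N \<in> cylinders" using pm(3) by (auto simp: cylinders_def)
  then obtain b' where b': "b' \<in> cylinders" "b' \<subseteq> cyl ?p N" "ok b'" using open_denseD(1)[OF od] by blast
  then obtain \<Gamma>1 N1 where G1: "b' = cyl \<Gamma>1 N1" "has_min \<Gamma>1" "\<Gamma>1 \<subseteq> low N1" by (auto simp: cylinders_def)
  define N' where "N' = max N N1"
  define ow' where "ow' s = (if lev s < N then ow s else if s \<in> \<Gamma>1 then Some t else None)" for s
  have "\<Gamma>1 \<in> cyl ?p N" using cyl_self[OF G1(2,3)] b'(2) G1(1) by blast
  then have G1N: "\<Gamma>1 \<inter> low N = ?p" by (simp add: cyl_def)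
  have G1Q: "\<Gamma>1 \<subseteq> Q" using G1(2) by (simp add: has_min_def)
  have tup_le: "le t s" if s: "s \<in> \<Gamma>1" for s
  proof -
    obtain m where m: "m \<in> \<Gamma>1" "\<forall>s\<in>\<Gamma>1. le m s" using G1(2) by (auto simp: has_min_def)
    have "t \<in> \<Gamma>1" "t \<in> low N" using pm(1) G1N by auto
    then have "m = t \<or> lev m < lev t" using le_lev m G1Q by blast
    then have "m \<in> low N" using \<open>t \<in> low N\<close> m(1) G1Q by (auto simp: low_def)
    then have "le t m" using pm(2) G1N m(1) by blast
    then show ?thesis using le_trans[of t m s] m s G1Q \<open>t \<in> \<Gamma>1\<close> by blast
  qed
  have ext: "extends N ow N' ow'"
    using tr tup_le by (auto simp: extends_def N'_def ow'_def split: if_splits)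
  have "owned_by N' ow' \<Gamma> = \<Gamma>1"
  proof (rule set_eqI)
    fix s
    show "s \<in> owned_by N' ow' \<Gamma> \<longleftrightarrow> s \<in> \<Gamma>1"
    proof (cases "lev s < N")
      case True
      have "s \<in> owned_by N' ow' \<Gamma> \<longleftrightarrow> s \<in> ?p"
        using True by (auto simp: owned_by_def low_def ow'_def N'_def)
      also have "\<dots> \<longleftrightarrow> s \<in> \<Gamma>1" using True G1N G1Q by (auto simp: low_def)
      finally show ?thesis .
    next
      case False
      then show ?thesis using t(1) G1(3) by (auto simp: owned_by_def low_def ow'_def N'_def)
    qed
  qed
  moreover have "cyl \<Gamma>1 N' \<subseteq> cyl \<Gamma>1 N1"
    using G1(3) by (intro cyl_antimono) (auto simp: N'_def)
  ultimately have "ok (cyl (owned_by N' ow' \<Gamma>) N')" using open_denseD(2)[OF od b'(3)] G1(1) by simp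
  then show ?thesis using ext by blast
qed

text \<open>
  Later assignments only shrink the cylinder of a pattern, so decisions are never lost and finitely many patterns can
  be treated in turn.
\<close>

lemma ok_extends:
  assumes "ok (cyl (owned_by N ow \<Gamma>) N)" "extends N ow N' ow'"
    and od: "open_dense ok"
  shows "ok (cyl (owned_by N' ow' \<Gamma>) N')"
proof (rule open_denseD(2)[OF od assms(1)])
  show "cyl (owned_by N' ow' \<Gamma>) N' \<subseteq> cyl (owned_by N ow \<Gamma>) N"
    using owned_by_extends[OF assms(2)] assms(2) by (intro cyl_antimono) (auto simp: extends_def)
qed

lemma decide_patterns:
  assumes ow: "owned N ow"
    and od: "open_dense ok"
  shows "\<exists>N' ow'. extends N ow N' ow' \<and> (\<forall>\<Gamma>\<in>patterns N ow. ok (cyl (owned_by N' ow' \<Gamma>) N'))"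
proof -
  have "\<exists>N' ow'. extends N ow N' ow' \<and> (\<forall>\<Gamma>\<in>P. ok (cyl (owned_by N' ow' \<Gamma>) N'))"
    if "finite P" "P \<subseteq> patterns N ow" for P
    using that
  proof (induction P rule: finite_induct)
    case empty then show ?case using extends_refl by blast
  next
    case (insert \<Gamma> P)
    then obtain N1 ow1 where 1: "extends N ow N1 ow1" "\<forall>\<Gamma>\<in>P. ok (cyl (owned_by N1 ow1 \<Gamma>) N1)" by auto
    have "owned N1 ow1" "\<Gamma> \<in> patterns N1 ow1"
      using owned_extends[OF ow 1(1)] patterns_extends[OF 1(1)] insert.prems by auto
    from decide_pattern[OF this od] obtain N2 ow2
      where 2: "extends N1 ow1 N2 ow2" "ok (cyl (owned_by N2 ow2 \<Gamma>) N2)" by blast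
    have "ok (cyl (owned_by N2 ow2 \<Gamma>') N2)" if "\<Gamma>' \<in> P" for \<Gamma>'
      using 1(2) that by (intro ok_extends[OF _ 2(1) od]) auto
    then show ?case using extends_trans[OF 1(1) 2(1)] 2(2) by blast
  qed
  then show ?thesis using finite_patterns by blast
qed

text \<open>
  The level \<open>N\<close> is retained: its elements become roots. Then every pattern that these and the earlier
  roots can form is decided before the next level \<open>N'\<close> from \<open>L\<close> is reached.
\<close>

lemma fusion_step:
  assumes ow: "owned N ow" and L: "infinite L"
    and od: "open_dense ok"
  shows "\<exists>N' ow'. N' \<in> L \<and> N < N' \<and> owned N' ow' \<and> (\<forall>s. lev s < N \<longrightarrow> ow' s = ow s) \<and>
    (\<forall>s. lev s = N \<longrightarrow> ow' s = Some s) \<and> roots N' ow' = roots N ow \<union> {s \<in> Q. lev s = N} \<and>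
    (\<forall>\<Gamma>\<in>patterns N' ow'. ok (cyl (owned_by N' ow' \<Gamma>) N'))"
proof -
  define ow0 where "ow0 s = (if lev s = N then Some s else ow s)" for s
  have r0: "roots (Suc N) ow0 = roots N ow \<union> {s \<in> Q. lev s = N}"
    by (auto simp: roots_def low_def ow0_def)
  have "owned (Suc N) ow0" unfolding owned_def r0
    using ow le_refl by (auto simp: owned_def low_def ow0_def less_Suc_eq)
  note o0 = this
  obtain N1 ow1 where 1: "extends (Suc N) ow0 N1 ow1" "\<forall>\<Gamma>\<in>patterns (Suc N) ow0. ok (cyl (owned_by N1 ow1 \<Gamma>) N1)"
    using decide_patterns[OF o0 od] by blast
  obtain N' where N': "N' \<in> L" "N1 \<le> N'"
    using L by (meson finite_nat_set_iff_bounded nat_le_linear not_le)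
  define ow' where "ow' s = (if lev s < N1 then ow1 s else None)" for s
  have e1: "extends N1 ow1 N' ow'" using N' by (auto simp: extends_def ow'_def)
  have e: "extends (Suc N) ow0 N' ow'" using extends_trans[OF 1(1) e1] .
  have "ok (cyl (owned_by N' ow' \<Gamma>) N')" if "\<Gamma> \<in> patterns N' ow'" for \<Gamma>
    using that 1(2) patterns_extends[OF e] by (intro ok_extends[OF _ e1 od]) auto
  moreover have "N < N'" using e by (simp add: extends_def)
  moreover have "ow' s = ow s" if "lev s < N" for s using e that by (simp add: extends_def ow0_def)
  moreover have "ow' s = Some s" if "lev s = N" for s using e that by (simp add: extends_def ow0_def)
  ultimately show ?thesis using N' owned_extends[OF o0 e] roots_extends[OF e] r0
    by (intro exI[of _ N'] exI[of _ ow']) simp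
qed

lemma dense_decided:
  fixes F :: "nat \<Rightarrow> 'q set set"
  assumes nd: "\<And>n. nowhere_dense_wrt cylinders (F n)"
    and dec: "\<And>b. b \<in> cylinders \<Longrightarrow> \<exists>b'\<in>cylinders. b' \<subseteq> b \<and> P b'"
    and down: "\<And>b b'. P b \<Longrightarrow> b' \<subseteq> b \<Longrightarrow> P b'"
    and b: "b \<in> cylinders"
  shows "\<exists>b'\<in>cylinders. b' \<subseteq> b \<and> (P b' \<and> (\<forall>j<k. b' \<inter> F j = {}))"
proof (induction k)
  case 0 then show ?case using dec[OF b] by simp
next
  case (Suc k)
  then obtain b1 where b1: "b1 \<in> cylinders" "b1 \<subseteq> b" "P b1" "\<forall>j<k. b1 \<inter> F j = {}" by blast
  obtain b2 where b2: "b2 \<in> cylinders" "b2 \<subseteq> b1" "b2 \<inter> F k = {}"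
    using nd[of k] b1(1) unfolding nowhere_dense_wrt_def by blast
  have "\<forall>j<Suc k. b2 \<inter> F j = {}" using b1(4) b2 by (auto simp: less_Suc_eq)
  then show ?case using b1 b2 down[OF b1(3) b2(2)] by (intro bexI[OF _ b2(1)]) auto
qed

text \<open>
  Stage \<open>k\<close> retains level \<open>r k\<close> and decides all patterns both with respect to \<open>A\<close>, up to the exceptional
  sets, and with respect to avoiding the exceptional sets \<open>F j\<close> for \<open>j < k\<close>. A set of retained indices \<open>\<Gamma>\<close> with minimum
  \<open>t\<close> has traces that are patterns at all stages from that of \<open>t\<close> on, so what \<open>\<Gamma>\<close> owns avoids every \<open>F j\<close>. Its trace
  at the stage of \<open>t\<close> is \<open>{t}\<close>, since its other elements lie on higher levels; hence the decision made
  for the pattern \<open>{t}\<close> at this stage is valid for all such \<open>\<Gamma>\<close>.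
\<close>

lemma fusion:
  fixes F :: "nat \<Rightarrow> 'q set set"
  assumes L: "infinite L"
    and nd: "\<And>n. nowhere_dense_wrt cylinders (F n)"
    and dec: "\<forall>b\<in>cylinders.
      \<exists>b'\<in>cylinders. b' \<subseteq> b \<and> (b' - (\<Union>n. F n) \<subseteq> A \<or> (b' - (\<Union>n. F n)) \<inter> A = {})"
  shows "\<exists>(r :: nat \<Rightarrow> nat) ow. strict_mono r \<and> range r \<subseteq> L \<and> (\<forall>s\<in>Q. lev s \<in> range r \<longrightarrow> ow s = Some s) \<and>
    (\<forall>s\<in>Q. \<forall>t. ow s = Some t \<longrightarrow> t \<in> Q \<and> lev t \<in> range r \<and> le t s) \<and>
    (\<forall>t\<in>Q. lev t \<in> range r \<longrightarrow> (\<exists>\<epsilon>. \<forall>\<Gamma>. \<Gamma> \<subseteq> {s \<in> Q. lev s \<in> range r} \<longrightarrow> t \<in> \<Gamma> \<longrightarrow> (\<forall>s\<in>\<Gamma>. le t s) \<longrightarrow>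
       ({s \<in> Q. \<exists>u\<in>\<Gamma>. ow s = Some u} \<in> A) = \<epsilon>))"
proof -
  define U where "U = (\<Union>n. F n)"
  define P where "P b \<longleftrightarrow> b - U \<subseteq> A \<or> (b - U) \<inter> A = {}" for b
  define ok where "ok k b \<longleftrightarrow> P b \<and> (\<forall>j<k. b \<inter> F j = {})" for k b
  have Pd: "P b'" if "P b" "b' \<subseteq> b" for b b' using that unfolding P_def by blast
  have od: "open_dense (ok k)" for k
    unfolding open_dense_def
  proof (intro conjI ballI allI impI)
    fix b assume b: "b \<in> cylinders"
    show "\<exists>b'\<in>cylinders. b' \<subseteq> b \<and> ok k b'"
      unfolding ok_def using dec by (intro dense_decided[OF nd _ Pd b]) (auto simp: P_def U_def)
  next
    show "ok k b'" if "ok k b" "b' \<subseteq> b" for b b'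
      using that Pd unfolding ok_def by blast
  qed
  define Step where "Step k S S' \<longleftrightarrow> fst S < fst S' \<and> (\<forall>s. lev s < fst S \<longrightarrow> snd S' s = snd S s) \<and>
    (\<forall>s. lev s = fst S \<longrightarrow> snd S' s = Some s) \<and> roots (fst S') (snd S') = roots (fst S) (snd S) \<union> {s \<in> Q. lev s = fst S} \<and>
    (\<forall>\<Gamma>\<in>patterns (fst S') (snd S'). ok k (cyl (owned_by (fst S') (snd S') \<Gamma>) (fst S')))"
    for k and S S' :: "nat \<times> ('q \<Rightarrow> 'q option)"
  have "\<exists>S. \<forall>k. (fst (S k) \<in> L \<and> owned (fst (S k)) (snd (S k)) \<and> (k = 0 \<longrightarrow> roots (fst (S k)) (snd (S k)) = {})) \<and>
    Step k (S k) (S (Suc k))"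
  proof (rule dependent_nat_choice)
    obtain N where "N \<in> L" using L by fastforce
    then show "\<exists>S :: nat \<times> ('q \<Rightarrow> 'q option). fst S \<in> L \<and> owned (fst S) (snd S) \<and> ((0 :: nat) = 0 \<longrightarrow> roots (fst S) (snd S) = {})"
      by (intro exI[of _ "(N, \<lambda>_. None)"]) (simp add: owned_def roots_def)
  next
    fix S :: "nat \<times> ('q \<Rightarrow> 'q option)" and k :: nat
    assume S: "fst S \<in> L \<and> owned (fst S) (snd S) \<and> (k = 0 \<longrightarrow> roots (fst S) (snd S) = {})"
    obtain N' ow' where "N' \<in> L" "owned N' ow'" "Step k S (N', ow')"
      using fusion_step[OF conjunct1[OF conjunct2[OF S]] L od[of k]] unfolding Step_def by auto
    then show "\<exists>S'. (fst S' \<in> L \<and> owned (fst S') (snd S') \<and> (Suc k = 0 \<longrightarrow> roots (fst S') (snd S') = {})) \<and> Step k S S'"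
      by (intro exI[of _ "(N', ow')"]) simp
  qed
  then obtain S where S: "\<forall>k. (fst (S k) \<in> L \<and> owned (fst (S k)) (snd (S k)) \<and> (k = 0 \<longrightarrow> roots (fst (S k)) (snd (S k)) = {})) \<and>
    Step k (S k) (S (Suc k))" ..
  define r where "r k = fst (S k)" for k
  define w where "w k = snd (S k)" for k
  have rL: "r k \<in> L" and own: "owned (r k) (w k)" and st: "Step k (S k) (S (Suc k))" for k
    using S by (auto simp: r_def w_def)
  have sm: "strict_mono r" using st by (simp add: strict_mono_Suc_iff r_def Step_def)
  have ri: "k \<le> r k" for k using strict_mono_imp_increasing[OF sm] .
  have keep1: "w (Suc k) s = w k s" if "lev s < r k" for k s
    using st[of k] that by (simp add: Step_def r_def w_def)
  have keep: "w m s = w k s" if "k \<le> m" "lev s < r k" for k m s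
    using that(1)
  proof (induction m rule: dec_induct)
    case (step n)
    have "lev s < r n" using that(2) sm step(1) by (meson order_less_le_trans strict_mono_less_eq)
    then show ?case using keep1 step by simp
  qed simp
  \<comment> \<open>Stage Suc (lev s) is late enough: r (Suc n) exceeds n, and assignments are never revised.\<close>
  define ow where "ow s = w (Suc (lev s)) s" for s
  have low_r: "lev s < r (Suc (lev s))" for s using ri[of "Suc (lev s)"] by simp
  have ow: "w m s = ow s" if "lev s < r m" for m s
    using keep[of m "Suc (lev s)" s] keep[of "Suc (lev s)" m s] that low_r[of s] unfolding ow_def by (metis nat_le_linear)
  have roots_r: "roots (r k) (w k) = {s \<in> Q. lev s \<in> r ` {..<k}}" for k
  proof (induction k)
    case 0 then show ?case using S by (simp add: r_def w_def)
  next
    case (Suc k)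
    have "roots (r (Suc k)) (w (Suc k)) = roots (r k) (w k) \<union> {s \<in> Q. lev s = r k}"
      using st[of k] by (simp add: Step_def r_def w_def)
    then show ?case using Suc by (auto simp: lessThan_Suc)
  qed
  have a: "ow s = Some s" if "lev s = r k" for s k
    using st[of k] ow[of s "Suc k"] that sm by (simp add: Step_def r_def w_def strict_mono_less)
  have b: "t \<in> roots (r (Suc (lev s))) (w (Suc (lev s)))" "le t s" if "s \<in> Q" "ow s = Some t" for s t
    using own[of "Suc (lev s)"] low_r[of s] that unfolding owned_def ow_def low_def by blast+
  have c: "\<exists>\<epsilon>. \<forall>\<Gamma>. \<Gamma> \<subseteq> {s \<in> Q. lev s \<in> range r} \<longrightarrow> t \<in> \<Gamma> \<longrightarrow> (\<forall>s\<in>\<Gamma>. le t s) \<longrightarrow>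
      ({s \<in> Q. \<exists>u\<in>\<Gamma>. ow s = Some u} \<in> A) = \<epsilon>" if t: "t \<in> Q" "lev t = r k" for t k
  proof -
    define bt where "bt = cyl (owned_by (r (Suc k)) (w (Suc k)) {t}) (r (Suc k))"
    have main: "{s \<in> Q. \<exists>u\<in>\<Gamma>. ow s = Some u} \<in> bt - U"
      if \<Gamma>: "\<Gamma> \<subseteq> {s \<in> Q. lev s \<in> range r}" "t \<in> \<Gamma>" "\<forall>s\<in>\<Gamma>. le t s" for \<Gamma>
    proof -
      let ?G = "{s \<in> Q. \<exists>u\<in>\<Gamma>. ow s = Some u}"
      have tG: "t \<in> ?G" using t a \<Gamma>(2) by blast
      have "le t s" if "s \<in> ?G" for s
      proof -
        obtain u where u: "u \<in> \<Gamma>" "ow s = Some u" "s \<in> Q" using \<open>s \<in> ?G\<close> by blast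
        have "le u s" using b[OF u(3,2)] by blast
        then show ?thesis using le_trans[of t u s] u \<Gamma> t(1) by blast
      qed
      then have hm: "has_min ?G" using tG by (auto simp: has_min_def)
      have Gm: "?G \<inter> low (r (Suc m)) = owned_by (r (Suc m)) (w (Suc m)) (\<Gamma> \<inter> low (r (Suc m)))" for m
      proof (rule set_eqI)
        fix s
        show "s \<in> ?G \<inter> low (r (Suc m)) \<longleftrightarrow> s \<in> owned_by (r (Suc m)) (w (Suc m)) (\<Gamma> \<inter> low (r (Suc m)))"
        proof (cases "s \<in> low (r (Suc m))")
          case True
          then have w: "w (Suc m) s = ow s" by (intro ow) (simp add: low_def)
          have "u \<in> low (r (Suc m))" if "ow s = Some u" for u
            using own[of "Suc m", unfolded owned_def, rule_format, OF True, of u] that w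
            by (simp add: roots_def)
          moreover have "s \<in> Q" using True low_Q by blast
          ultimately show ?thesis using True unfolding owned_by_def mem_Collect_eq Int_iff w by blast
        qed (auto simp: owned_by_def)
      qed
      have inpat: "\<Gamma> \<inter> low (r (Suc m)) \<in> patterns (r (Suc m)) (w (Suc m))" if "k \<le> m" for m
      proof -
        have "lev t < r (Suc m)" using sm t(2) that by (simp add: strict_mono_less)
        then have "t \<in> \<Gamma> \<inter> low (r (Suc m))" using \<Gamma>(2) t by (auto simp: low_def)
        moreover have "\<Gamma> \<inter> low (r (Suc m)) \<subseteq> roots (r (Suc m)) (w (Suc m))"
          unfolding roots_r using \<Gamma>(1) sm by (auto simp: low_def strict_mono_less)
        ultimately show ?thesis using \<Gamma>(3) by (auto simp: patterns_def)
      qed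
      have okm: "ok m (cyl (?G \<inter> low (r (Suc m))) (r (Suc m)))" if "k \<le> m" for m
        using st[of m] inpat[OF that] unfolding Gm by (simp add: Step_def r_def w_def)
      have "?G \<notin> F j" for j
      proof -
        have "?G \<in> cyl (?G \<inter> low (r (Suc (max k (Suc j))))) (r (Suc (max k (Suc j))))" using hm by (simp add: cyl_def)
        moreover have "cyl (?G \<inter> low (r (Suc (max k (Suc j))))) (r (Suc (max k (Suc j)))) \<inter> F j = {}"
          using okm[of "max k (Suc j)"] by (simp add: ok_def)
        ultimately show ?thesis by blast
      qed
      then have "?G \<notin> U" by (simp add: U_def)
      moreover have "\<Gamma> \<inter> low (r (Suc k)) = {t}"
      proof
        show "{t} \<subseteq> \<Gamma> \<inter> low (r (Suc k))" using \<Gamma>(2) t sm by (simp add: low_def strict_mono_less)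
        show "\<Gamma> \<inter> low (r (Suc k)) \<subseteq> {t}"
        proof
          fix s assume s: "s \<in> \<Gamma> \<inter> low (r (Suc k))"
          then obtain i where i: "lev s = r i" "s \<in> Q" using \<Gamma>(1) by auto
          have "i \<le> k" using s i sm by (simp add: low_def strict_mono_less)
          then have "lev s \<le> lev t" using i t sm by (simp add: strict_mono_less_eq)
          then show "s \<in> {t}" using le_lev[of t s] \<Gamma>(3) s i t by auto
        qed
      qed
      ultimately show ?thesis using Gm[of k] hm by (simp add: bt_def cyl_def)
    qed
    have "{t} \<in> patterns (r (Suc k)) (w (Suc k))"
      unfolding patterns_def roots_r using t le_refl[OF t(1)] by auto
    then have "ok k bt" using st[of k] by (simp add: Step_def bt_def r_def w_def)
    then have "bt - U \<subseteq> A \<or> (bt - U) \<inter> A = {}" by (simp add: ok_def P_def)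
    then show ?thesis
    proof
      assume "bt - U \<subseteq> A" then show ?thesis using main by (intro exI[of _ True]) auto
    next
      assume "(bt - U) \<inter> A = {}" then show ?thesis using main by (intro exI[of _ False]) auto
    qed
  qed
  show ?thesis
  proof (rule exI[of _ r], rule exI[of _ ow], intro conjI)
    show "range r \<subseteq> L" using rL by auto
    show "\<forall>s\<in>Q. \<forall>t. ow s = Some t \<longrightarrow> t \<in> Q \<and> lev t \<in> range r \<and> le t s"
      using b unfolding roots_r by blast
  qed (use sm a c in auto)
qed

end

section \<open>Trees of infinite height\<close>

lemma enumerate_range_strict_mono:
  fixes r :: "nat \<Rightarrow> nat"
  assumes r: "strict_mono r"
  shows "enumerate (range r) q = r q"
proof (induction q rule: less_induct)
  case (less q)
  have inf: "infinite (range r)" using r strict_mono_imp_inj_on range_inj_infinite by blast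
  obtain j where j: "enumerate (range r) j = r q" using enumerate_Ex[OF inf] by blast
  consider "j < q" | "j = q" | "q < j" by linarith
  then show ?case
  proof cases
    case 1
    then show ?thesis using less.IH[OF 1] j r by (simp add: strict_mono_eq)
  next
    case 2 then show ?thesis using j by simp
  next
    case 3
    then have lt: "enumerate (range r) q < r q" using enumerate_mono[OF 3 inf] j by simp
    obtain i where i: "enumerate (range r) q = r i" using enumerate_in_set[OF inf] by blast
    then have "i < q" using lt r by (simp add: strict_mono_less)
    then show ?thesis using less.IH[of i] i enumerate_mono[OF \<open>i < q\<close> inf] by simp
  qed
qed

lemma max_chain_exists: "\<exists>C. C \<in> max_chains R"
proof -
  have "\<exists>M\<in>Chains R. \<forall>X\<in>Chains R. M \<subseteq> X \<longrightarrow> X = M"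
  proof (rule Zorn_Lemma, rule)
    fix \<C> assume c: "\<C> \<in> chains (Chains R)"
    then have sub: "\<C> \<subseteq> Chains R" "\<And>A B. A \<in> \<C> \<Longrightarrow> B \<in> \<C> \<Longrightarrow> A \<subseteq> B \<or> B \<subseteq> A"
      by (auto simp: chains_def chain_subset_def)
    show "\<Union>\<C> \<in> Chains R" unfolding Chains_def
    proof (intro CollectI ballI)
      fix a b assume "a \<in> \<Union>\<C>" "b \<in> \<Union>\<C>"
      then obtain A where "A \<in> \<C>" "a \<in> A" "b \<in> A" using sub(2) by blast
      then show "(a, b) \<in> R \<or> (b, a) \<in> R" using sub(1) by (auto simp: Chains_def)
    qed
  qed
  then show ?thesis by (auto simp: max_chains_def)
qed

text \<open>
  A finite chain has a largest element, above which there is another element, so it is not maximal.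
\<close>

lemma height_infinite_no_maximal:
  assumes R: "Partial_order R" and ne: "Field R \<noteq> {}" and nm: "\<And>t. t \<in> Field R \<Longrightarrow> aboveS R t \<noteq> {}"
  shows "tree_height R = \<infinity>"
proof -
  have refl: "\<And>t. t \<in> Field R \<Longrightarrow> (t, t) \<in> R" and tr: "trans R" and anti: "antisym R"
    using R partial_order_onD[OF R] by (auto simp: refl_on_def)
  have inf: "infinite C" if C: "C \<in> max_chains R" for C
  proof
    assume fin: "finite C"
    have ch: "C \<in> Chains R" and mx: "\<And>C'. C' \<in> Chains R \<Longrightarrow> C \<subseteq> C' \<Longrightarrow> C' = C"
      using C by (auto simp: max_chains_def)
    show False
    proof (cases "C = {}")
      case True
      obtain x where "x \<in> Field R" using ne by blast
      then have "{x} \<in> Chains R" using refl by (auto simp: Chains_def)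
      then show False using mx True by blast
    next
      case False
      have "finite A \<Longrightarrow> A \<noteq> {} \<Longrightarrow> A \<subseteq> C \<Longrightarrow> \<exists>m\<in>A. \<forall>c\<in>A. (c, m) \<in> R" for A
      proof (induction A rule: finite_ne_induct)
        case (singleton x)
        then show ?case using ch by (auto simp: Chains_def)
      next
        case (insert x A)
        then obtain m where m: "m \<in> A" "\<forall>c\<in>A. (c, m) \<in> R" by blast
        have xx: "(x, x) \<in> R" using insert.prems ch by (auto simp: Chains_def)
        have mm: "(m, m) \<in> R" using m by blast
        have "(x, m) \<in> R \<or> (m, x) \<in> R" using insert.prems ch m(1) by (auto simp: Chains_def)
        then show ?case
        proof
          assume "(x, m) \<in> R" then show ?thesis using m by (intro bexI[of _ m]) auto
        next
          assume "(m, x) \<in> R"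
          then have "\<forall>c\<in>A. (c, x) \<in> R" using m(2) tr by (meson transD)
          then show ?thesis using xx by (intro bexI[of _ x]) auto
        qed
      qed
      then obtain m where m: "m \<in> C" "\<forall>c\<in>C. (c, m) \<in> R" using fin False by blast
      then have "m \<in> Field R" by (auto simp: Field_def)
      then obtain x where x: "x \<noteq> m" "(m, x) \<in> R" using nm by (auto simp: aboveS_def)
      have "x \<in> Field R" using x(2) by (auto simp: Field_def)
      have cx: "\<forall>c\<in>C. (c, x) \<in> R" using m(2) x(2) tr by (meson transD)
      have "insert x C \<in> Chains R"
        using ch cx refl[OF \<open>x \<in> Field R\<close>] by (auto simp: Chains_def)
      then have "x \<in> C" using mx by blast
      then show False using m(2) x anti by (meson antisymD)
    qed
  qed
  show ?thesis unfolding tree_height_def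
  proof (rule the_equality)
    show "\<forall>C\<in>max_chains R. \<infinity> = (if finite C then enat (card C) else \<infinity>)" using inf by auto
    fix h assume "\<forall>C\<in>max_chains R. h = (if finite C then enat (card C) else \<infinity>)"
    then show "h = \<infinity>" using max_chain_exists[of R] inf by auto
  qed
qed

text \<open>
  Trees of infinite height, in terms of depths (numbers of strict predecessors).
\<close>

locale infinite_tree =
  fixes T :: "'a rel"
  assumes tree: "is_tree T" and height: "tree_height T = \<infinity>"
begin

definition depth :: "'a \<Rightarrow> nat" where "depth t = card (underS T t)"

lemma po: "Partial_order T" using tree by (simp add: is_tree_def)
lemma refl: "t \<in> Field T \<Longrightarrow> (t, t) \<in> T" using partial_order_onD(1)[OF po] by (simp add: refl_on_def)
lemma tr: "(s, t) \<in> T \<Longrightarrow> (t, u) \<in> T \<Longrightarrow> (s, u) \<in> T" using partial_order_onD(2)[OF po] by (meson transD)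
lemma anti: "(s, t) \<in> T \<Longrightarrow> (t, s) \<in> T \<Longrightarrow> s = t" using partial_order_onD(3)[OF po] by (meson antisymD)
lemma field: "(s, t) \<in> T \<Longrightarrow> s \<in> Field T" "(s, t) \<in> T \<Longrightarrow> t \<in> Field T" by (auto simp: Field_def)

lemma finite_underS: "finite (underS T t)"
proof (cases "t \<in> Field T")
  case True then show ?thesis using tree by (simp add: is_tree_def)
next
  case False
  then have "underS T t = {}" by (auto simp: underS_def Field_def)
  then show ?thesis by simp
qed

text \<open>
  Predecessor sets are well-ordered, hence linearly ordered.
\<close>

lemma comparable:
  assumes "(s, t) \<in> T" "(u, t) \<in> T" shows "(s, u) \<in> T \<or> (u, s) \<in> T"
proof (cases "s = t \<or> u = t")
  case True then show ?thesis using assms by auto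
next
  case False
  have "well_order_on (underS T t) (Restr T (underS T t))"
    using tree field(2)[OF assms(1)] by (simp add: is_tree_def)
  then have "total_on (underS T t) (Restr T (underS T t))"
    by (simp add: well_order_on_def linear_order_on_def)
  moreover have "s \<in> underS T t" "u \<in> underS T t" using False assms by (auto simp: underS_def)
  ultimately have "s = u \<or> (s, u) \<in> Restr T (underS T t) \<or> (u, s) \<in> Restr T (underS T t)"
    unfolding total_on_def by metis
  then show ?thesis using refl[OF field(1)[OF assms(1)]] by auto
qed

lemma depth_less: assumes "(s, t) \<in> T" "s \<noteq> t" shows "depth s < depth t"
  unfolding depth_def
proof (rule psubset_card_mono[OF finite_underS])
  have "s \<in> underS T t" "s \<notin> underS T s" using assms by (auto simp: underS_def)
  moreover have "underS T s \<subseteq> underS T t"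
  proof
    fix u assume "u \<in> underS T s"
    then have u: "(u, s) \<in> T" "u \<noteq> s" by (auto simp: underS_def)
    then show "u \<in> underS T t" using tr[OF u(1) assms(1)] anti[of u s] assms by (auto simp: underS_def)
  qed
  ultimately show "underS T s \<subset> underS T t" by blast
qed

lemma depth_eq: "(s, t) \<in> T \<Longrightarrow> (u, t) \<in> T \<Longrightarrow> depth s = depth u \<Longrightarrow> s = u"
  using comparable depth_less by (metis less_irrefl)

lemma depth_le: assumes "(s, t) \<in> T" "(u, t) \<in> T" "depth s \<le> depth u" shows "(s, u) \<in> T"
  using comparable[OF assms(1,2)] depth_less[of u s] assms(3) by fastforce

lemma level_iff: "t \<in> level T n \<longleftrightarrow> t \<in> Field T \<and> depth t = n"
  by (auto simp: level_def depth_def)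

text \<open>
  The deepest strict predecessor: by comparability, the others lie below it.
\<close>

lemma predecessor:
  assumes "t \<in> level T (Suc n)"
  shows "\<exists>p\<in>level T n. t \<in> imm_succs T p"
proof -
  have t: "t \<in> Field T" "depth t = Suc n" using assms by (auto simp: level_iff)
  have ne: "underS T t \<noteq> {}" using t(2) by (auto simp: depth_def)
  have fin: "finite (depth ` underS T t)" using finite_underS by simp
  have "Max (depth ` underS T t) \<in> depth ` underS T t" using fin ne by (intro Max_in) auto
  then obtain p where p: "p \<in> underS T t" "depth p = Max (depth ` underS T t)" by (metis imageE)
  then have p2: "depth s \<le> depth p" if "s \<in> underS T t" for s using fin that by simp
  have pt: "(p, t) \<in> T" "p \<noteq> t" using p(1) by (auto simp: underS_def)
  have eq: "underS T t = insert p (underS T p)"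
  proof
    show "underS T t \<subseteq> insert p (underS T p)"
    proof
      fix s assume s: "s \<in> underS T t"
      then have "(s, p) \<in> T" using depth_le[of s t p] pt p2[OF s] by (auto simp: underS_def)
      then show "s \<in> insert p (underS T p)" by (auto simp: underS_def)
    qed
    show "insert p (underS T p) \<subseteq> underS T t"
    proof
      fix u assume "u \<in> insert p (underS T p)"
      then have u: "(u, p) \<in> T" "u = p \<or> u \<noteq> p" using refl[OF field(1)[OF pt(1)]] by (auto simp: underS_def)
      then show "u \<in> underS T t" using tr[OF u(1) pt(1)] anti[of u p] pt by (auto simp: underS_def)
    qed
  qed
  have "p \<notin> underS T p" by (simp add: underS_def)
  then have "depth p = n" using t(2) eq finite_underS by (simp add: depth_def)
  moreover have "t \<in> imm_succs T p"
  proof -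
    have "False" if "u \<in> aboveS T p" "t \<in> aboveS T u" for u
      using that depth_less[of p u] depth_less[of u t] \<open>depth p = n\<close> t(2) by (auto simp: aboveS_def)
    then show ?thesis using pt by (auto simp: imm_succs_def aboveS_def)
  qed
  ultimately show ?thesis using field(1)[OF pt(1)] by (auto simp: level_iff)
qed

lemma ancestor:
  assumes "t \<in> level T n" "m \<le> n" shows "\<exists>s\<in>level T m. (s, t) \<in> T"
  using assms
proof (induction n arbitrary: t)
  case 0 then show ?case using refl[of t] by (intro bexI[of _ t]) (auto simp: level_iff)
next
  case (Suc n)
  show ?case
  proof (cases "m = Suc n")
    case True then show ?thesis using Suc.prems refl[of t] by (intro bexI[of _ t]) (auto simp: level_iff)
  next
    case False
    obtain p where p: "p \<in> level T n" "t \<in> imm_succs T p"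
      using predecessor[OF Suc.prems(1)] by blast
    then obtain s where "s \<in> level T m" "(s, p) \<in> T" using Suc.IH[OF p(1)] Suc.prems(2) False by auto
    moreover have "(p, t) \<in> T" using p(2) by (auto simp: imm_succs_def aboveS_def)
    ultimately show ?thesis using tr by blast
  qed
qed

lemma imm_succs_iff:
  assumes "p \<in> level T n" shows "t \<in> imm_succs T p \<longleftrightarrow> (p, t) \<in> T \<and> t \<in> level T (Suc n)"
proof
  assume t: "t \<in> imm_succs T p"
  then have pt: "(p, t) \<in> T" "p \<noteq> t" by (auto simp: imm_succs_def aboveS_def)
  have dt: "depth t > n" using depth_less[OF pt] assms by (simp add: level_iff)
  obtain s where s: "s \<in> level T (Suc n)" "(s, t) \<in> T"
    using ancestor[of t "depth t" "Suc n"] dt field(2)[OF pt(1)] by (auto simp: level_iff)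
  have "(p, s) \<in> T" using depth_le[OF pt(1) s(2)] s(1) assms by (simp add: level_iff)
  moreover have "s \<noteq> p" using s(1) assms by (auto simp: level_iff)
  ultimately have "s = t" using t s(2) by (auto simp: imm_succs_def aboveS_def)
  then show "(p, t) \<in> T \<and> t \<in> level T (Suc n)" using pt s by simp
next
  assume t: "(p, t) \<in> T \<and> t \<in> level T (Suc n)"
  have "False" if "u \<in> aboveS T p" "t \<in> aboveS T u" for u
    using that depth_less[of p u] depth_less[of u t] t assms by (auto simp: aboveS_def level_iff)
  moreover have "t \<noteq> p" using t assms by (auto simp: level_iff)
  ultimately show "t \<in> imm_succs T p" using t by (auto simp: imm_succs_def aboveS_def)
qed

text \<open>
  A maximal node and its predecessors would form a finite maximal chain. All maximal chains being equipotent,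
  the height would be finite.
\<close>

lemma no_maximal: assumes "t \<in> Field T" shows "aboveS T t \<noteq> {}"
proof
  assume e: "aboveS T t = {}"
  define C where "C = insert t (underS T t)"
  have Ct: "(s, t) \<in> T" if "s \<in> C" for s using that refl[OF assms] by (auto simp: C_def underS_def)
  have "C \<in> Chains T" unfolding Chains_def using comparable Ct by blast
  moreover have "C' = C" if "C' \<in> Chains T" "C \<subseteq> C'" for C'
  proof
    show "C' \<subseteq> C"
    proof
      fix s assume s: "s \<in> C'"
      then have "(s, t) \<in> T \<or> (t, s) \<in> T" using that by (auto simp: Chains_def C_def)
      then show "s \<in> C" using e by (auto simp: C_def underS_def aboveS_def)
    qed
  qed (rule that(2))
  ultimately have C: "C \<in> max_chains T" by (auto simp: max_chains_def)
  have fin: "finite C" using finite_underS by (simp add: C_def)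
  have all: "\<forall>C'\<in>max_chains T. C \<approx> C'" using tree C by (auto simp: is_tree_def)
  have "tree_height T = enat (card C)" unfolding tree_height_def
  proof (rule the_equality)
    show "\<forall>C'\<in>max_chains T. enat (card C) = (if finite C' then enat (card C') else \<infinity>)"
    proof
      fix C' assume "C' \<in> max_chains T"
      then obtain f where f: "bij_betw f C C'" using all by (auto simp: eqpoll_def)
      then show "enat (card C) = (if finite C' then enat (card C') else \<infinity>)"
        using fin bij_betw_finite[OF f] bij_betw_same_card[OF f] by simp
    qed
    fix h assume "\<forall>C'\<in>max_chains T. h = (if finite C' then enat (card C') else \<infinity>)"
    then show "h = enat (card C)" using C fin by auto
  qed
  then show False using height by simp
qed

lemma imm_succs_nonempty: assumes "p \<in> level T n" shows "imm_succs T p \<noteq> {}"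
proof -
  obtain t where t: "(p, t) \<in> T" "t \<noteq> p" using no_maximal assms by (auto simp: level_iff aboveS_def)
  have "depth t > n" using depth_less[OF t(1)] t(2) assms by (auto simp: level_iff)
  then obtain s where s: "s \<in> level T (Suc n)" "(s, t) \<in> T"
    using ancestor[of t "depth t" "Suc n"] field(2)[OF t(1)] by (auto simp: level_iff)
  have "(p, s) \<in> T" using depth_le[OF t(1) s(2)] s(1) assms by (simp add: level_iff)
  then show ?thesis using imm_succs_iff[OF assms] s by blast
qed

lemma extension:
  assumes "p \<in> level T n" "n \<le> m" shows "\<exists>q\<in>level T m. (p, q) \<in> T"
  using assms(2)
proof (induction m rule: dec_induct)
  case base then show ?case using assms(1) refl[of p] by (intro bexI[of _ p]) (auto simp: level_iff)
next
  case (step m)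
  then obtain q where q: "q \<in> level T m" "(p, q) \<in> T" by blast
  obtain t where "t \<in> imm_succs T q" using imm_succs_nonempty[OF q(1)] by blast
  then have "(q, t) \<in> T" "t \<in> level T (Suc m)" using imm_succs_iff[OF q(1)] by auto
  then show ?case using q(2) tr by blast
qed

lemma finite_imm_succs: "p \<in> level T n \<Longrightarrow> finite (imm_succs T p)"
  using tree no_maximal by (simp add: is_tree_def level_iff)

definition tree_root :: 'a where "tree_root = (SOME r. r \<in> Field T \<and> (\<forall>t\<in>Field T. (r, t) \<in> T))"

lemma tree_root: "tree_root \<in> Field T" "t \<in> Field T \<Longrightarrow> (tree_root, t) \<in> T"
proof -
  have "\<exists>r. r \<in> Field T \<and> (\<forall>t\<in>Field T. (r, t) \<in> T)" using tree by (auto simp: is_tree_def)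
  from someI_ex[OF this] show "tree_root \<in> Field T" "t \<in> Field T \<Longrightarrow> (tree_root, t) \<in> T" by (auto simp: tree_root_def)
qed

lemma level_0: "level T 0 = {tree_root}"
proof -
  have "u = tree_root" if "(u, tree_root) \<in> T" for u using anti[OF that tree_root(2)[OF field(1)[OF that]]] .
  then have "underS T tree_root = {}" by (auto simp: underS_def)
  then have "tree_root \<in> level T 0" using tree_root(1) by (simp add: level_iff depth_def)
  moreover have "t = tree_root" if "t \<in> level T 0" for t
    using that depth_less[OF tree_root(2), of t] by (auto simp: level_iff)
  ultimately show ?thesis by blast
qed

lemma finite_level: "finite (level T n)"
proof (induction n)
  case 0 then show ?case by (simp add: level_0)
next
  case (Suc n)
  have "level T (Suc n) \<subseteq> (\<Union>p\<in>level T n. imm_succs T p)"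
    using predecessor by blast
  then show ?case using Suc finite_imm_succs by (meson finite_UN_I finite_subset)
qed

text \<open>
  The tree is a monotone, level-preserving image of a tree of sequences: the letters index the immediate successors.
\<close>

definition node :: "nat list \<Rightarrow> 'a" where
  "node s = foldl (\<lambda>t. from_nat_into (imm_succs T t)) tree_root s"

lemma node_simps: "node [] = tree_root" "node (s @ [v]) = from_nat_into (imm_succs T (node s)) v"
  by (simp_all add: node_def)

lemma node_step:
  assumes "node s \<in> level T (length s)"
  shows "node (s @ [v]) \<in> level T (Suc (length s))" "(node s, node (s @ [v])) \<in> T"
  using imm_succs_iff[OF assms] from_nat_into[OF imm_succs_nonempty[OF assms], of v] by (auto simp: node_simps)

lemma node_level: "node s \<in> level T (length s)"
  by (induction s rule: rev_induct) (use level_0 node_step in \<open>auto simp: node_simps\<close>)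

lemma node_prefix: "prefix s s' \<Longrightarrow> (node s, node s') \<in> T"
proof -
  have "(node s, node (s @ r)) \<in> T" for r
  proof (induction r rule: rev_induct)
    case Nil then show ?case using refl node_level by (auto simp: level_iff)
  next
    case (snoc v r)
    then show ?case using node_step(2)[OF node_level, of "s @ r" v] tr by auto
  qed
  then show "prefix s s' \<Longrightarrow> (node s, node s') \<in> T" by (auto simp: prefix_def)
qed

text \<open>
  Surjectivity above a given sequence is what carries density above a tuple over from sequences to nodes.
\<close>

lemma node_surj:
  assumes B: "\<And>n p. p \<in> level T n \<Longrightarrow> {..<card (imm_succs T p)} \<subseteq> B n"
    and s: "s \<in> seqs B n"
  shows "p \<in> level T (n + k) \<Longrightarrow> (node s, p) \<in> T \<Longrightarrow> \<exists>s'\<in>seqs B (n + k). prefix s s' \<and> node s' = p"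
proof (induction k arbitrary: p)
  case 0
  have "depth (node s) = n" using node_level[of s] length_seqs[OF s] by (simp add: level_iff)
  then have "node s = p" using depth_eq[OF 0(2) refl] 0(1) by (simp add: level_iff)
  then show ?case using s by (intro bexI[of _ s]) auto
next
  case (Suc k)
  obtain q where q: "q \<in> level T (n + k)" "p \<in> imm_succs T q"
    using predecessor[of p "n + k"] Suc.prems(1) by auto
  have qp: "(q, p) \<in> T" using q(2) by (auto simp: imm_succs_def aboveS_def)
  have "depth (node s) = n" using node_level[of s] length_seqs[OF s] by (simp add: level_iff)
  then have "(node s, q) \<in> T" using depth_le[OF Suc.prems(2) qp] q(1) by (simp add: level_iff)
  then obtain s' where s': "s' \<in> seqs B (n + k)" "prefix s s'" "node s' = q" using Suc.IH[OF q(1)] by blast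
  obtain v where v: "v < card (imm_succs T q)" "from_nat_into (imm_succs T q) v = p"
    using bij_betw_imp_surj_on[OF bij_betw_from_nat_into_finite[OF finite_imm_succs[OF q(1)]]] q(2)
    by (metis imageE lessThan_iff)
  then have "v \<in> B (n + k)" using B[OF q(1)] by blast
  then show ?case using s' v by (intro bexI[of _ "s' @ [v]"]) (auto simp: node_simps)
qed

text \<open>
  In the tree of successors of \<open>\<tau>\<close> the levels are counted from \<open>n0\<close>; that tree again has no maximal
  nodes, so its height is infinite and \<^const>\<open>level_set\<close> collects all levels of it that meet \<open>D\<close>.
\<close>

lemma dense_aboveI:
  assumes \<tau>: "\<tau> \<in> level T n0" and D: "D \<subseteq> above T \<tau>" and r: "strict_mono r"
    and L: "{n. level T n \<inter> D \<noteq> {}} = range r"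
    and dom: "\<And>q p. p \<in> level T (n0 + q) \<Longrightarrow> (\<tau>, p) \<in> T \<Longrightarrow> \<exists>s\<in>D \<inter> level T (r q). (p, s) \<in> T"
  shows "dense_above T \<tau> D"
proof -
  define R where "R = succ_tree T \<tau>"
  have d\<tau>: "depth \<tau> = n0" "\<tau> \<in> Field T" using \<tau> by (auto simp: level_iff)
  have R: "(a, b) \<in> R \<longleftrightarrow> (a, b) \<in> T \<and> (\<tau>, a) \<in> T" for a b
    using tr by (auto simp: R_def succ_tree_def above_def)
  have FR: "Field R = above T \<tau>"
  proof
    show "Field R \<subseteq> above T \<tau>"
    proof
      fix x assume "x \<in> Field R"
      then obtain a b where "(a, b) \<in> R" "x = a \<or> x = b" by (auto simp: Field_def)
      then show "x \<in> above T \<tau>" using tr[of \<tau> a b] by (auto simp: R above_def)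
    qed
    show "above T \<tau> \<subseteq> Field R"
    proof
      fix x assume "x \<in> above T \<tau>"
      then have "(x, x) \<in> R" using refl[OF field(2), of \<tau> x] by (auto simp: R above_def)
      then show "x \<in> Field R" by (rule FieldI1)
    qed
  qed
  have poR: "Partial_order R"
    unfolding partial_order_on_def preorder_on_def
  proof (intro conjI)
    show "R \<subseteq> Field R \<times> Field R" by (auto simp: Field_def)
    show "refl_on (Field R) R" unfolding FR refl_on_def using refl[OF field(2)] R by (auto simp: above_def)
    show "trans R"
    proof (rule transI)
      fix a b c assume "(a, b) \<in> R" "(b, c) \<in> R"
      then show "(a, c) \<in> R" using tr[of a b c] by (simp add: R)
    qed
    show "antisym R"
    proof (rule antisymI)
      fix a b assume "(a, b) \<in> R" "(b, a) \<in> R"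
      then show "a = b" using anti[of a b] by (simp add: R)
    qed
  qed
  have hR: "tree_height R = \<infinity>"
  proof (rule height_infinite_no_maximal[OF poR])
    show "Field R \<noteq> {}" unfolding FR using refl[OF d\<tau>(2)] by (auto simp: above_def)
    fix t assume t: "t \<in> Field R"
    then have "(\<tau>, t) \<in> T" by (simp add: FR above_def)
    moreover obtain u where "u \<noteq> t" "(t, u) \<in> T"
      using no_maximal[OF field(2)[OF calculation]] by (auto simp: aboveS_def)
    ultimately show "aboveS R t \<noteq> {}" using R by (auto simp: aboveS_def)
  qed
  have dR: "card (underS R t) + n0 = depth t" if "(\<tau>, t) \<in> T" for t
  proof -
    have "underS T t = underS R t \<union> underS T \<tau>"
    proof
      show "underS T t \<subseteq> underS R t \<union> underS T \<tau>"
      proof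
        fix u assume "u \<in> underS T t"
        then have u: "(u, t) \<in> T" "u \<noteq> t" by (auto simp: underS_def)
        then show "u \<in> underS R t \<union> underS T \<tau>"
          using comparable[OF u(1) that] refl[OF field(1)[OF u(1)]] R by (auto simp: underS_def)
      qed
      show "underS R t \<union> underS T \<tau> \<subseteq> underS T t"
      proof
        fix u assume "u \<in> underS R t \<union> underS T \<tau>"
        then consider "(u, t) \<in> T" "u \<noteq> t" | "(u, \<tau>) \<in> T" "u \<noteq> \<tau>" by (auto simp: underS_def R)
        then show "u \<in> underS T t"
          using tr[of u \<tau> t] anti[of u \<tau>] that by cases (auto simp: underS_def)
      qed
    qed
    moreover have "underS R t \<inter> underS T \<tau> = {}"
    proof -
      have False if "(\<tau>, u) \<in> T" "(u, \<tau>) \<in> T" "u \<noteq> \<tau>" for u using anti[OF that(1,2)] that(3) by simp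
      then show ?thesis using R by (auto simp: underS_def)
    qed
    moreover have "finite (underS R t)" using calculation(1) finite_underS[of t] by simp
    ultimately show ?thesis using d\<tau> finite_underS by (simp add: depth_def card_Un_disjoint)
  qed
  have lR: "level R m = {t. (\<tau>, t) \<in> T \<and> depth t = n0 + m}" for m
  proof (rule set_eqI)
    fix t show "t \<in> level R m \<longleftrightarrow> t \<in> {t. (\<tau>, t) \<in> T \<and> depth t = n0 + m}"
      using dR[of t] by (cases "(\<tau>, t) \<in> T") (auto simp: level_def FR above_def)
  qed
  have lT: "level R m = level T (n0 + m) \<inter> above T \<tau>" for m
    unfolding lR using field by (auto simp: level_iff above_def)
  have rn: "n0 \<le> r q" for q
  proof -
    have "r q \<in> {n. level T n \<inter> D \<noteq> {}}" using L by blast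
    then obtain s where s: "s \<in> level T (r q)" "(\<tau>, s) \<in> T" using D by (auto simp: above_def)
    then show ?thesis using depth_less[OF s(2)] d\<tau> by (cases "\<tau> = s") (auto simp: level_iff)
  qed
  have DR: "D \<inter> Field R = D" using D FR by blast
  define r' where "r' q = r q - n0" for q
  have r': "strict_mono r'" using r rn unfolding strict_mono_Suc_iff r'_def by (simp add: diff_less_mono)
  have Ls: "level_set R D = range r'"
  proof -
    have "level_set R D = {m. n0 + m \<in> range r}"
      unfolding level_set_def hR lT using L D by (auto simp: set_eq_iff)
    also have "\<dots> = range r'"
    proof (rule set_eqI)
      fix m
      have "n0 + m = r q \<longleftrightarrow> m = r' q" for q using rn[of q] by (auto simp: r'_def)
      then show "m \<in> {m. n0 + m \<in> range r} \<longleftrightarrow> m \<in> range r'" by (simp add: image_iff)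
    qed
    finally show ?thesis .
  qed
  have "infinite (range r')" using r' strict_mono_imp_inj_on range_inj_infinite by blast
  moreover have "dominates R (D \<inter> level R (r' k)) (level R k)" for k
    unfolding dominates_def
  proof
    fix t assume t: "t \<in> level R k"
    then have t': "t \<in> level T (n0 + k)" "(\<tau>, t) \<in> T" by (auto simp: lT above_def)
    from dom[OF this] obtain s where s: "s \<in> D" "s \<in> level T (r k)" "(t, s) \<in> T" by blast
    have "s \<in> level R (r' k)" using s D rn[of k] by (auto simp: lT r'_def)
    then show "\<exists>s\<in>D \<inter> level R (r' k). (t, s) \<in> R" using s t' R by blast
  qed
  moreover have "D \<subseteq> Field R" using D FR by simp
  ultimately show ?thesis
    unfolding dense_above_def R_def[symmetric] DR dense_in_def Ls enumerate_range_strict_mono[OF r'] by blast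
qed

lemma succ_tree_root: "succ_tree T tree_root = T"
  using tree_root(2)[OF field(1)] tree_root(2)[OF field(2)] by (auto simp: succ_tree_def above_def)

lemma dense_above_root: "dense_above T tree_root D \<Longrightarrow> D \<subseteq> Field T \<Longrightarrow> dense_in T D"
  by (simp add: dense_above_def succ_tree_root inf_absorb1)

lemma dense_inD:
  assumes "dense_in T D"
  shows "infinite {n. level T n \<inter> D \<noteq> {}}" "level_set T D = {n. level T n \<inter> D \<noteq> {}}"
    "p \<in> level T k \<Longrightarrow> \<exists>s\<in>D \<inter> level T (enumerate {n. level T n \<inter> D \<noteq> {}} k). (p, s) \<in> T"
proof -
  show e: "level_set T D = {n. level T n \<inter> D \<noteq> {}}" by (simp add: level_set_def height)
  show "infinite {n. level T n \<inter> D \<noteq> {}}" using assms unfolding dense_in_def e by blast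
  show "p \<in> level T k \<Longrightarrow> \<exists>s\<in>D \<inter> level T (enumerate {n. level T n \<inter> D \<noteq> {}} k). (p, s) \<in> T"
    using assms unfolding dense_in_def e dominates_def by blast
qed

end

lemma listset_iff: "xs \<in> listset As \<longleftrightarrow> length xs = length As \<and> (\<forall>i<length As. xs ! i \<in> As ! i)"
proof (induction As arbitrary: xs)
  case Nil then show ?case by auto
next
  case (Cons A As)
  show ?case
  proof (cases xs)
    case Nil then show ?thesis by (simp add: set_Cons_def)
  next
    case (Cons x ys)
    then show ?thesis using Cons.IH[of ys] by (auto simp: set_Cons_def All_less_Suc2)
  qed
qed

section \<open>Vector trees and the space of sets with a minimum\<close>

text \<open>
  Vector trees of infinite height. The level of an element of the level product is read off its first coordinate.
\<close>

locale infinite_vector_tree =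
  fixes Ts :: "'a rel list"
  assumes vt: "vector_tree Ts" and vh: "vheight Ts = \<infinity>"
begin

abbreviation d :: nat where "d \<equiv> length Ts"

definition lev :: "'a list \<Rightarrow> nat" where "lev t = card (underS (Ts ! 0) (t ! 0))"

lemma d_pos: "0 < d" using vt by (simp add: vector_tree_def)

lemma infinite_tree_nth: "i < d \<Longrightarrow> infinite_tree (Ts ! i)"
proof
  assume i: "i < d"
  then show "is_tree (Ts ! i)" using vt by (simp add: vector_tree_def)
  have "hd Ts \<in> set Ts" using d_pos by simp
  then have "tree_height (Ts ! i) = tree_height (hd Ts)"
    using vt i nth_mem[OF i] unfolding vector_tree_def by blast
  then show "tree_height (Ts ! i) = \<infinity>" using vh by (simp add: vheight_def)
qed

lemmas node_level = infinite_tree.node_level[OF infinite_tree_nth]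
lemmas node_prefix = infinite_tree.node_prefix[OF infinite_tree_nth]
lemmas tr = infinite_tree.tr[OF infinite_tree_nth]
lemmas refl = infinite_tree.refl[OF infinite_tree_nth]

lemma level_set_eq: "i < d \<Longrightarrow> level_set (Ts ! i) D = {n. level (Ts ! i) n \<inter> D \<noteq> {}}"
  using infinite_tree.height[OF infinite_tree_nth] by (simp add: level_set_def)

lemma tree_product_iff:
  "t \<in> tree_product Ts \<longleftrightarrow> length t = d \<and> (\<forall>i<d. t ! i \<in> level (Ts ! i) (lev t))"
proof -
  have "t \<in> tree_product Ts \<longleftrightarrow> length t = d \<and> (\<exists>n. \<forall>i<d. t ! i \<in> level (Ts ! i) n)"
    by (auto simp: tree_product_def vh listset_iff)
  moreover have "n = lev t" if "\<forall>i<d. t ! i \<in> level (Ts ! i) n" for n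
    using that d_pos by (auto simp: level_def lev_def)
  ultimately show ?thesis by blast
qed

lemma level_product_iff:
  assumes "length Ds = d"
  shows "t \<in> level_product Ts Ds \<longleftrightarrow> t \<in> tree_product Ts \<and> (\<forall>i<d. t ! i \<in> Ds ! i)"
proof -
  have "t \<in> level_product Ts Ds \<longleftrightarrow> length t = d \<and> (\<exists>n. \<forall>i<d. t ! i \<in> Ds ! i \<inter> level (Ts ! i) n)"
    using assms by (auto simp: level_product_def vh listset_iff)
  moreover have "n = lev t" if "\<forall>i<d. t ! i \<in> Ds ! i \<inter> level (Ts ! i) n" for n
    using that d_pos by (auto simp: level_def lev_def)
  ultimately show ?thesis unfolding tree_product_iff by blast
qed

lemma coord_le_refl: "t \<in> tree_product Ts \<Longrightarrow> coord_le Ts t t"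
  using refl by (auto simp: tree_product_iff coord_le_def level_def)

lemma coord_le_trans: "coord_le Ts s t \<Longrightarrow> coord_le Ts t u \<Longrightarrow> coord_le Ts s u"
  using tr unfolding coord_le_def by blast

lemma coord_le_lev:
  assumes "s \<in> tree_product Ts" "t \<in> tree_product Ts" "coord_le Ts s t"
  shows "s = t \<or> lev s < lev t"
proof (cases "s = t")
  case False
  then obtain i where i: "i < d" "s ! i \<noteq> t ! i"
    using assms by (auto simp: tree_product_iff list_eq_iff_nth_eq)
  have "(s ! i, t ! i) \<in> Ts ! i" using assms(3) i by (simp add: coord_le_def)
  from infinite_tree.depth_less[OF infinite_tree_nth[OF i(1)] this i(2)]
  moreover have "s ! i \<in> level (Ts ! i) (lev s)" "t ! i \<in> level (Ts ! i) (lev t)"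
    using assms(1,2) i(1) by (simp_all add: tree_product_iff)
  ultimately have "lev s < lev t"
    by (simp add: infinite_tree.level_iff[OF infinite_tree_nth[OF i(1)]])
  then show ?thesis ..
qed simp

lemma coord_le_lev_le:
  "s \<in> tree_product Ts \<Longrightarrow> t \<in> tree_product Ts \<Longrightarrow> coord_le Ts s t \<Longrightarrow> lev s \<le> lev t"
  using coord_le_lev by fastforce

lemma levelled_poset:
  assumes "Q \<subseteq> tree_product Ts" shows "levelled_poset Q lev (coord_le Ts)"
proof
  show "coord_le Ts t t" if "t \<in> Q" for t using that assms coord_le_refl by blast
  show "coord_le Ts s u" if "coord_le Ts s t" "coord_le Ts t u" for s t u using that coord_le_trans by blast
  show "s = t \<or> lev s < lev t" if "s \<in> Q" "t \<in> Q" "coord_le Ts s t" for s t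
    using that assms coord_le_lev by blast
  fix N
  have "{t \<in> Q. lev t < N} \<subseteq> {t. set t \<subseteq> (\<Union>i<d. \<Union>n<N. level (Ts ! i) n) \<and> length t = d}"
  proof
    fix t assume t: "t \<in> {t \<in> Q. lev t < N}"
    then have tt: "length t = d" "\<forall>i<d. t ! i \<in> level (Ts ! i) (lev t)" using assms tree_product_iff by auto
    have "x \<in> (\<Union>i<d. \<Union>n<N. level (Ts ! i) n)" if x: "x \<in> set t" for x
    proof -
      obtain i where "i < d" "x = t ! i" using x tt(1) by (auto simp: in_set_conv_nth)
      then show ?thesis using tt(2) t by blast
    qed
    then show "t \<in> {t. set t \<subseteq> (\<Union>i<d. \<Union>n<N. level (Ts ! i) n) \<and> length t = d}" using tt by blast
  qed
  moreover have "finite {t. set t \<subseteq> (\<Union>i<d. \<Union>n<N. level (Ts ! i) n) \<and> length t = d}"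
    using infinite_tree.finite_level[OF infinite_tree_nth]
    by (intro finite_lists_length_eq finite_UN_I) auto
  ultimately show "finite {t \<in> Q. lev t < N}" by (rule finite_subset)
qed

lemma topspace_min_sets: "topspace (min_sets_topology Ts) = min_sets Ts"
  by (auto simp: min_sets_topology_def topspace_pullback_topology)

text \<open>
  An open set of the product topology contains, around each of its points, a box that restricts finitely many coordinates.
\<close>

lemma openin_min_setsD:
  assumes S: "openin (min_sets_topology Ts) S" and V: "V \<in> S"
  shows "\<exists>K. finite K \<and> K \<subseteq> tree_product Ts \<and> (\<forall>V'\<in>min_sets Ts. V' \<inter> K = V \<inter> K \<longrightarrow> V' \<in> S)"
proof -
  define g where "g V = restrict (\<lambda>t. t \<in> V) (tree_product Ts)" for V :: "'a list set"
  let ?X = "product_topology (\<lambda>_. discrete_topology (UNIV :: bool set)) (tree_product Ts)"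
  obtain W where W: "openin ?X W" "S = g -` W \<inter> min_sets Ts"
    using S unfolding min_sets_topology_def openin_pullback_topology g_def[abs_def] by blast
  obtain X where X: "finite {i \<in> tree_product Ts. X i \<noteq> UNIV}" "g V \<in> Pi\<^sub>E (tree_product Ts) X"
    "Pi\<^sub>E (tree_product Ts) X \<subseteq> W"
    using W V unfolding openin_product_topology_alt by (auto simp: topspace_discrete_topology)
  let ?K = "{i \<in> tree_product Ts. X i \<noteq> UNIV}"
  have "V' \<in> S" if V': "V' \<in> min_sets Ts" "V' \<inter> ?K = V \<inter> ?K" for V'
  proof -
    have "g V' \<in> Pi\<^sub>E (tree_product Ts) X"
    proof (rule PiE_I)
      fix i assume i: "i \<in> tree_product Ts"
      show "g V' i \<in> X i"
      proof (cases "X i = UNIV")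
        case False
        then have "i \<in> V' \<longleftrightarrow> i \<in> V" using V'(2) i by blast
        then have "g V' i = g V i" by (simp add: g_def)
        then show ?thesis using X(2) i by auto
      qed simp
    qed (simp add: g_def)
    then show ?thesis using X(3) W(2) V'(1) by blast
  qed
  then show ?thesis using X(1) by (intro exI[of _ ?K]) auto
qed

lemma union_has_min:
  assumes U: "is_subspace Ts Ds U" and \<Gamma>: "\<Gamma> \<subseteq> level_product Ts Ds" "t \<in> \<Gamma>" "\<forall>s\<in>\<Gamma>. coord_le Ts t s"
  shows "(\<Union>s\<in>\<Gamma>. U s) \<in> min_sets Ts" "is_minimum Ts (\<Union>s\<in>\<Gamma>. U s) t"
proof -
  have U': "U s \<subseteq> tree_product Ts" "is_minimum Ts (U s) s" if "s \<in> \<Gamma>" for s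
    using U that \<Gamma>(1) unfolding is_subspace_def min_sets_def by auto
  show m: "is_minimum Ts (\<Union>s\<in>\<Gamma>. U s) t"
    using U' \<Gamma>(2,3) coord_le_trans unfolding is_minimum_def by blast
  show "(\<Union>s\<in>\<Gamma>. U s) \<in> min_sets Ts" using m U'(1) by (auto simp: min_sets_def)
qed

text \<open>
  The minimum of the union lies in some \<open>U t\<close>, hence above \<open>t\<close>; as \<open>t\<close> itself belongs to the union, \<open>t\<close> is the
  minimum of the index set.
\<close>

lemma union_min_inv:
  assumes U: "is_subspace Ts Ds U" and len: "length Ds = d" and \<Gamma>: "\<Gamma> \<subseteq> level_product Ts Ds"
    and m: "(\<Union>s\<in>\<Gamma>. U s) \<in> min_sets Ts"
  shows "\<exists>t\<in>\<Gamma>. \<forall>s\<in>\<Gamma>. coord_le Ts t s"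
proof -
  have U': "U s \<subseteq> tree_product Ts" "is_minimum Ts (U s) s" if "s \<in> \<Gamma>" for s
    using U that \<Gamma>(1) unfolding is_subspace_def min_sets_def by auto
  obtain x where x: "is_minimum Ts (\<Union>s\<in>\<Gamma>. U s) x" using m by (auto simp: min_sets_def)
  then obtain t where t: "t \<in> \<Gamma>" "x \<in> U t" by (auto simp: is_minimum_def)
  have tU: "s \<in> U s" if "s \<in> \<Gamma>" for s using U'(2)[OF that] by (simp add: is_minimum_def)
  have "coord_le Ts t x" using U'(2)[OF t(1)] t(2) by (simp add: is_minimum_def)
  moreover have "coord_le Ts x s" if "s \<in> \<Gamma>" for s using x tU[OF that] that by (auto simp: is_minimum_def)
  ultimately show ?thesis using t(1) coord_le_trans by blast
qed

text \<open>
  Passing from an index set to the union is continuous: whether the union contains \<open>x\<close> is decided by the indices \<open>t\<close>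
  with \<open>x \<in> U t\<close>, and these lie below \<open>x\<close>, on levels up to that of \<open>x\<close>.
\<close>

lemma baire_preimage:
  assumes P: "P \<in> souslin_measurable_sets (min_sets_topology Ts)"
    and U: "is_subspace Ts Ds U"
  shows "baire_wrt (levelled_poset.cylinders (level_product Ts Ds) lev (coord_le Ts))
    ((\<lambda>\<Gamma>. \<Union>t\<in>\<Gamma>. U t) -` P)"
proof -
  have len: "length Ds = d" using U by (simp add: is_subspace_def vector_subset_def)
  let ?Q = "level_product Ts Ds"
  have Q: "?Q \<subseteq> tree_product Ts" using level_product_iff[OF len] by blast
  interpret levelled_poset ?Q lev "coord_le Ts" by (rule levelled_poset[OF Q])
  define f where "f \<Gamma> = (\<Union>t\<in>\<Gamma>. U t)" for \<Gamma>
  have fm: "f \<Gamma> \<in> min_sets Ts" if hm: "has_min \<Gamma>" for \<Gamma>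
  proof -
    obtain t where "t \<in> \<Gamma>" "\<forall>s\<in>\<Gamma>. coord_le Ts t s" "\<Gamma> \<subseteq> ?Q" using hm by (auto simp: has_min_def)
    then show ?thesis using union_has_min(1)[OF U] by (simp add: f_def)
  qed
  have Uin: "U t \<subseteq> tree_product Ts" "x \<in> U t \<Longrightarrow> coord_le Ts t x" if "t \<in> ?Q" for t x
    using U that unfolding is_subspace_def min_sets_def is_minimum_def by auto
  have "baire_wrt cylinders (f -` P)"
  proof (rule souslin_measurable_baire[OF P countable_cylinders cylinders_nonempty cylinders_base])
    show "f ` \<Union>cylinders \<subseteq> topspace (min_sets_topology Ts)"
      unfolding topspace_min_sets using fm by (auto simp: cylinders_def cyl_def)
    fix S b assume S: "openin (min_sets_topology Ts) S" and b: "b \<in> cylinders" "b \<inter> f -` S \<noteq> {}"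
    then obtain \<Delta> where \<Delta>: "\<Delta> \<in> b" "f \<Delta> \<in> S" by blast
    obtain K where K: "finite K" "K \<subseteq> tree_product Ts" "\<forall>V'\<in>min_sets Ts. V' \<inter> K = f \<Delta> \<inter> K \<longrightarrow> V' \<in> S"
      using openin_min_setsD[OF S \<Delta>(2)] by (elim exE conjE) (rule that; assumption)
    obtain N0 where N0: "\<forall>N\<ge>N0. cyl (\<Delta> \<inter> low N) N \<subseteq> b \<and> cyl (\<Delta> \<inter> low N) N \<in> cylinders \<and> \<Delta> \<in> cyl (\<Delta> \<inter> low N) N"
      using cyl_inside[OF \<Delta>(1) b(1)] by blast
    define N where "N = N0 + Suc (\<Sum>k\<in>K. lev k)"
    have NK: "lev k < N" if "k \<in> K" for k
      using member_le_sum[OF that _ K(1), of lev] by (simp add: N_def)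
    have sub: "x \<in> f \<Delta>1" if A: "x \<in> f \<Delta>2" "x \<in> K" "\<Delta>2 \<inter> low N \<subseteq> \<Delta>1" "\<Delta>2 \<subseteq> ?Q" for x \<Delta>1 \<Delta>2
    proof -
      obtain t where t: "t \<in> \<Delta>2" "x \<in> U t" using \<open>x \<in> f \<Delta>2\<close> by (auto simp: f_def)
      have tQ: "t \<in> ?Q" using t A by blast
      have "lev t \<le> lev x" using coord_le_lev_le[of t x] Uin(2)[OF tQ t(2)] tQ Q A(2) K(2) by blast
      then have "t \<in> \<Delta>1" using NK[OF A(2)] tQ t(1) A(3) by (auto simp: low_def)
      then show ?thesis using t(2) by (auto simp: f_def)
    qed
    have "\<Delta>' \<in> f -` S" if \<Delta>': "\<Delta>' \<in> cyl (\<Delta> \<inter> low N) N" for \<Delta>'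
    proof -
      have h: "has_min \<Delta>'" "\<Delta>' \<inter> low N = \<Delta> \<inter> low N" using \<Delta>' by (auto simp: cyl_def)
      have "has_min \<Delta>" using \<Delta>(1) b(1) by (auto simp: cylinders_def cyl_def)
      then have "\<Delta> \<subseteq> ?Q" "\<Delta>' \<subseteq> ?Q" using h(1) by (auto simp: has_min_def)
      then have "f \<Delta>' \<inter> K = f \<Delta> \<inter> K" using sub[of _ \<Delta> \<Delta>'] sub[of _ \<Delta>' \<Delta>] h(2) by blast
      then show ?thesis using K(3)[rule_format, OF fm[OF h(1)]] by simp
    qed
    then show "\<exists>b'\<in>cylinders. b' \<subseteq> b \<inter> f -` S" using N0[rule_format, of N]
      by (intro bexI[of _ "cyl (\<Delta> \<inter> low N) N"]) (auto simp: N_def)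
  qed
  then show ?thesis by (simp add: f_def[abs_def])
qed

end

lemma strict_mono_in_enumerate:
  fixes r :: "nat \<Rightarrow> nat"
  assumes r: "strict_mono r" "range r \<subseteq> L" and L: "infinite L"
  shows "\<exists>j\<ge>q. r q = enumerate L j"
proof -
  have "\<exists>j. enumerate L j = r n" for n using enumerate_Ex[OF L] r(2) by blast
  then have "\<exists>g. \<forall>n. enumerate L (g n) = r n" by (rule choice[OF allI])
  then obtain g where g: "\<And>n. enumerate L (g n) = r n" by blast
  have "strict_mono g"
  proof (rule strict_monoI)
    fix x y :: nat assume "x < y"
    then have "enumerate L (g x) < enumerate L (g y)" using g r(1) by (simp add: strict_mono_less)
    then show "g x < g y" using L by simp
  qed
  then show ?thesis using g strict_mono_imp_increasing by (metis)
qed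

context infinite_vector_tree
begin

section \<open>Dense vector subsets and the dichotomy\<close>

text \<open>
  The \<open>q\<close>-th level of a subsequence is at least the \<open>q\<close>-th level met by \<open>Ds\<close>, and nodes of lower
  levels can be prolonged first.
\<close>

lemma dense_below_levels:
  fixes r :: "nat \<Rightarrow> nat"
  assumes D: "dense_vector_subset Ts Ds" and r: "strict_mono r"
    and rL: "range r \<subseteq> {n. level (Ts ! 0) n \<inter> Ds ! 0 \<noteq> {}}"
    and i: "i < d" and p: "p \<in> level (Ts ! i) q"
  shows "\<exists>s\<in>Ds ! i \<inter> level (Ts ! i) (r q). (p, s) \<in> Ts ! i"
proof -
  interpret infinite_tree "Ts ! i" by (rule infinite_tree_nth[OF i])
  let ?L = "{n. level (Ts ! i) n \<inter> Ds ! i \<noteq> {}}"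
  have "level_set (Ts ! i) (Ds ! i) = level_set (Ts ! 0) (Ds ! 0)"
    using D i d_pos unfolding dense_vector_subset_def vector_subset_def by blast
  then have rL': "range r \<subseteq> ?L" using rL i d_pos by (simp add: level_set_eq)
  have de: "dense_in (Ts ! i) (Ds ! i)" using D i by (simp add: dense_vector_subset_def)
  obtain j where j: "q \<le> j" "r q = enumerate ?L j"
    using strict_mono_in_enumerate[OF r rL' dense_inD(1)[OF de]] by blast
  obtain p' where p': "p' \<in> level (Ts ! i) j" "(p, p') \<in> Ts ! i" using extension[OF p j(1)] by blast
  obtain s where "s \<in> Ds ! i \<inter> level (Ts ! i) (enumerate ?L j)" "(p', s) \<in> Ts ! i"
    using dense_inD(3)[OF de p'(1)] by blast
  then show ?thesis using p'(2) j(2) tr by auto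
qed

text \<open>
  The asymmetric theorem for dense vector subsets, on prescribed levels \<open>r 0 < r 1 < \<dots>\<close>. A tuple of sequences of
  length \<open>q\<close> names a tuple of nodes of level \<open>q\<close>, and \<open>\<delta>\<close> moves these up into \<open>Ds\<close>, to level \<open>r q\<close>; the
  theorem for sequences is applied to the induced colouring. The monochromatic lifts of increasing heights
  are taken on different levels, so their union is dense and its level product contains no tuples that mix
  different lifts.
\<close>

lemma Halpern_Lauchli:
  fixes \<kappa> :: "'a list \<Rightarrow> bool" and r :: "nat \<Rightarrow> nat"
  assumes D: "dense_vector_subset Ts Ds" and r: "strict_mono r"
    and rL: "range r \<subseteq> {n. level (Ts ! 0) n \<inter> Ds ! 0 \<noteq> {}}"
  obtains Ds' where "vector_subset Ts Ds'" "\<And>t. t \<in> level_product Ts Ds' \<Longrightarrow> t \<in> level_product Ts Ds \<and> lev t \<in> range r"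
      "\<And>t. t \<in> level_product Ts Ds' \<Longrightarrow> \<kappa> t" "dense_vector_subset Ts Ds'"
  | Ds' t where "vector_subset Ts Ds'" "\<And>t. t \<in> level_product Ts Ds' \<Longrightarrow> t \<in> level_product Ts Ds \<and> lev t \<in> range r"
      "\<And>t. t \<in> level_product Ts Ds' \<Longrightarrow> \<not> \<kappa> t" "t \<in> tree_product Ts" "dense_vector_subset_above Ts t Ds'"
proof -
  have lenD: "length Ds = d" using D by (simp add: dense_vector_subset_def vector_subset_def)
  define nd where "nd i = infinite_tree.node (Ts ! i)" for i
  \<comment> \<open>A common bound for the numbers of immediate successors on level n of all trees.\<close>
  define B where "B n = {..(\<Sum>i<d. \<Sum>p\<in>level (Ts ! i) n. card (imm_succs (Ts ! i) p))}" for n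
  have B: "alphabet B" by (auto simp: alphabet_def B_def)
  have Bc: "{..<card (imm_succs (Ts ! i) p)} \<subseteq> B n" if "i < d" "p \<in> level (Ts ! i) n" for i n p
  proof -
    have "card (imm_succs (Ts ! i) p) \<le> (\<Sum>p\<in>level (Ts ! i) n. card (imm_succs (Ts ! i) p))"
      using infinite_tree.finite_level[OF infinite_tree_nth[OF that(1)]] that(2)
      by (intro member_le_sum) auto
    also have "\<dots> \<le> (\<Sum>i<d. \<Sum>p\<in>level (Ts ! i) n. card (imm_succs (Ts ! i) p))"
      using that(1) by (intro member_le_sum[where f="\<lambda>i. \<Sum>p\<in>level (Ts ! i) n. card (imm_succs (Ts ! i) p)"]) auto
    finally show ?thesis by (auto simp: B_def)
  qed
  have surj: "\<exists>s'\<in>seqs B (n + k). prefix s s' \<and> nd i s' = p"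
    if "i < d" "s \<in> seqs B n" "p \<in> level (Ts ! i) (n + k)" "(nd i s, p) \<in> Ts ! i" for i s n k p
    unfolding nd_def
    using infinite_tree.node_surj[OF infinite_tree_nth[OF that(1)] Bc[OF that(1)] that(2,3)] that(4) by (simp add: nd_def)
  have ndl: "nd i s \<in> level (Ts ! i) n" if "i < d" "s \<in> seqs B n" for i s n
    using node_level[OF that(1), of s] length_seqs[OF that(2)] by (simp add: nd_def)
  have ndp: "(nd i s, nd i s') \<in> Ts ! i" if "i < d" "prefix s s'" for i s s'
    using node_prefix[OF that] by (simp add: nd_def)
  define \<delta> where "\<delta> i q p = (SOME s. s \<in> Ds ! i \<inter> level (Ts ! i) (r q) \<and> (p, s) \<in> Ts ! i)" for i q p
  have \<delta>: "\<delta> i q p \<in> Ds ! i" "\<delta> i q p \<in> level (Ts ! i) (r q)" "(p, \<delta> i q p) \<in> Ts ! i"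
    if "i < d" "p \<in> level (Ts ! i) q" for i q p
    using someI_ex[of "\<lambda>s. s \<in> Ds ! i \<inter> level (Ts ! i) (r q) \<and> (p, s) \<in> Ts ! i"]
      dense_below_levels[OF D r rL that] unfolding \<delta>_def by blast+
  define c where "c q x = \<kappa> (map (\<lambda>i. \<delta> i q (nd i (x i))) [0..<d])" for q and x :: "nat \<Rightarrow> nat list"
  have main: "\<exists>Ds'. vector_subset Ts Ds' \<and> (\<forall>t\<in>level_product Ts Ds'. t \<in> level_product Ts Ds \<and> lev t \<in> range r \<and> \<kappa> t = \<epsilon>) \<and>
      (\<forall>i<d. dense_above (Ts ! i) (nd i (t i)) (Ds' ! i))"
    if t: "t \<in> tups B d n0" and g: "\<And>k. mono_lift B d c t k \<epsilon>" for n0 t \<epsilon>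
  proof -
    obtain m \<phi> where mp: "\<And>k. lift B d k (m k) (\<phi> k)"
      "\<And>k x. x \<in> tups B d k \<Longrightarrow> tup_le t x \<Longrightarrow> c (m k) (map_tup (\<phi> k) x) = \<epsilon>"
      using g unfolding mono_lift_def by metis
    have mk: "k \<le> m k" for k using mp(1)[of k] by (simp add: lift_def)
    \<comment> \<open>Lift number q starts at height kk q and ends at m (kk q), below the start of the next one.\<close>
    define kk where "kk = rec_nat n0 (\<lambda>_ k. Suc (m k))"
    have kk: "kk 0 = n0" "kk (Suc q) = Suc (m (kk q))" for q by (simp_all add: kk_def)
    have kkq: "n0 + q \<le> kk q" for q
    proof (induction q)
      case (Suc q) then show ?case using mk[of "kk q"] by (simp add: kk)
    qed (simp add: kk)
    have smM: "strict_mono (\<lambda>q. m (kk q))"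
      unfolding strict_mono_Suc_iff
    proof
      fix q show "m (kk q) < m (kk (Suc q))" using mk[of "kk (Suc q)"] by (simp add: kk)
    qed
    define R where "R q = r (m (kk q))" for q
    have smR: "strict_mono R" using r smM by (simp add: R_def strict_mono_def)
    have ti: "t i \<in> seqs B n0" if "i < d" for i using t that by (simp add: tups_def)
    have lif: "\<phi> k i s \<in> seqs B (m k)" "prefix s (\<phi> k i s)" if "i < d" "s \<in> seqs B k" for i k s
      using mp(1)[of k] that by (auto simp: lift_def)
    define pt where "pt i q s = \<delta> i (m (kk q)) (nd i (\<phi> (kk q) i s))" for i q s
    have pt: "pt i q s \<in> Ds ! i" "pt i q s \<in> level (Ts ! i) (R q)" "(nd i s, pt i q s) \<in> Ts ! i"
      if "i < d" "s \<in> seqs B (kk q)" for i q s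
    proof -
      note n = ndl[OF that(1) lif(1)[OF that]]
      show "pt i q s \<in> Ds ! i" "pt i q s \<in> level (Ts ! i) (R q)"
        unfolding pt_def R_def using \<delta>(1,2)[OF that(1) n] by auto
      show "(nd i s, pt i q s) \<in> Ts ! i"
        unfolding pt_def using tr[OF that(1) ndp[OF that(1) lif(2)[OF that]] \<delta>(3)[OF that(1) n]] .
    qed
    define E where "E i = {pt i q s | q s. s \<in> seqs B (kk q) \<and> prefix (t i) s}" for i
    define Ds' where "Ds' = map E [0..<d]"
    have len': "length Ds' = d" and nth': "\<And>i. i < d \<Longrightarrow> Ds' ! i = E i" by (simp_all add: Ds'_def)
    have tk: "n0 \<le> kk q" for q using kkq[of q] by simp
    have ED: "E i \<subseteq> Ds ! i" if "i < d" for i using pt(1)[OF that] by (auto simp: E_def)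
    have Elev: "\<exists>q s. x = pt i q s \<and> s \<in> seqs B (kk q) \<and> prefix (t i) s \<and> n = R q"
      if x: "i < d" "x \<in> E i" "x \<in> level (Ts ! i) n" for i x n
    proof -
      obtain q s where s: "x = pt i q s" "s \<in> seqs B (kk q)" "prefix (t i) s" using x(2) by (auto simp: E_def)
      then have "x \<in> level (Ts ! i) (R q)" using pt(2)[OF x(1)] by simp
      then have "n = R q" using x(3) by (simp add: level_def)
      then show ?thesis using s by blast
    qed
    have L: "{n. level (Ts ! i) n \<inter> E i \<noteq> {}} = range R" if i: "i < d" for i
    proof
      show "{n. level (Ts ! i) n \<inter> E i \<noteq> {}} \<subseteq> range R" using Elev[OF i] by blast
      show "range R \<subseteq> {n. level (Ts ! i) n \<inter> E i \<noteq> {}}"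
      proof
        fix n assume "n \<in> range R"
        then obtain q where q: "n = R q" by blast
        have s: "pad B (kk q) (t i) \<in> seqs B (kk q)" using pad_seqs[OF B ti[OF i] tk] .
        have "pt i q (pad B (kk q) (t i)) \<in> level (Ts ! i) n \<inter> E i"
          using pt(2)[OF i s] s q prefix_pad[of "t i" B "kk q"] unfolding E_def by blast
        then show "n \<in> {n. level (Ts ! i) n \<inter> E i \<noteq> {}}" by blast
      qed
    qed
    have Dsub: "Ds ! i \<subseteq> Field (Ts ! i)" if "i < d" for i
      using D that by (simp add: dense_vector_subset_def vector_subset_def)
    have vs: "vector_subset Ts Ds'"
      unfolding vector_subset_def
      using len' nth' order_trans[OF ED Dsub] L by (simp add: level_set_eq)
    moreover have "x \<in> level_product Ts Ds \<and> lev x \<in> range r \<and> \<kappa> x = \<epsilon>" if x: "x \<in> level_product Ts Ds'" for x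
    proof -
      have x': "x \<in> tree_product Ts" "\<And>i. i < d \<Longrightarrow> x ! i \<in> E i"
        using x level_product_iff[OF len'] nth' by auto
      have xl: "length x = d" "\<And>i. i < d \<Longrightarrow> x ! i \<in> level (Ts ! i) (lev x)" using x'(1) by (auto simp: tree_product_iff)
      have "lev x \<in> {n. level (Ts ! 0) n \<inter> E 0 \<noteq> {}}" using x'(2) xl(2) d_pos by blast
      then obtain q where q: "lev x = R q" using L[OF d_pos] by blast
      have "\<exists>s. x ! i = pt i q s \<and> s \<in> seqs B (kk q) \<and> prefix (t i) s" if "i < d" for i
        using Elev[OF that x'(2)[OF that] xl(2)[OF that]] q smR by (auto simp: strict_mono_eq)
      then obtain y where y: "\<And>i. i < d \<Longrightarrow> x ! i = pt i q (y i) \<and> y i \<in> seqs B (kk q) \<and> prefix (t i) (y i)"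
        by metis
      define z where "z i = (if i < d then y i else [])" for i
      have z: "z \<in> tups B d (kk q)" "tup_le t z" using y t by (auto simp: z_def tups_def tup_le_def)
      have "x = map (\<lambda>i. pt i q (y i)) [0..<d]" using xl(1) y by (intro nth_equalityI) auto
      also have "\<dots> = map (\<lambda>i. \<delta> i (m (kk q)) (nd i (map_tup (\<phi> (kk q)) z i))) [0..<d]"
        by (auto simp: pt_def map_tup_def z_def)
      finally have "\<kappa> x = c (m (kk q)) (map_tup (\<phi> (kk q)) z)" by (simp add: c_def)
      also have "\<dots> = \<epsilon>" using mp(2)[OF z] .
      finally have "\<kappa> x = \<epsilon>" .
      moreover have "x \<in> level_product Ts Ds" using x' ED level_product_iff[OF lenD] by blast
      moreover have "lev x \<in> range r" using q by (simp add: R_def)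
      ultimately show ?thesis by blast
    qed
    moreover have "dense_above (Ts ! i) (nd i (t i)) (Ds' ! i)" if i: "i < d" for i
      unfolding nth'[OF i]
    proof (rule infinite_tree.dense_aboveI[OF infinite_tree_nth[OF i] ndl[OF i ti[OF i]] _ smR L[OF i]])
      show "E i \<subseteq> above (Ts ! i) (nd i (t i))"
      proof
        fix x assume "x \<in> E i"
        then obtain q s where s: "x = pt i q s" "s \<in> seqs B (kk q)" "prefix (t i) s" by (auto simp: E_def)
        then show "x \<in> above (Ts ! i) (nd i (t i))"
          using tr[OF i ndp[OF i s(3)] pt(3)[OF i s(2)]] by (simp add: above_def)
      qed
      fix q p assume p: "p \<in> level (Ts ! i) (n0 + q)" "(nd i (t i), p) \<in> Ts ! i"
      obtain p' where p': "p' \<in> level (Ts ! i) (kk q)" "(p, p') \<in> Ts ! i"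
        using infinite_tree.extension[OF infinite_tree_nth[OF i] p(1) kkq] by blast
      have "(nd i (t i), p') \<in> Ts ! i" using tr[OF i p(2) p'(2)] .
      then obtain s where s: "s \<in> seqs B (kk q)" "prefix (t i) s" "nd i s = p'"
        using surj[OF i ti[OF i], of p' "kk q - n0"] p'(1) tk[of q] by auto
      have "(p, pt i q s) \<in> Ts ! i" using tr[OF i p'(2)] pt(3)[OF i s(1)] s(3) by simp
      moreover have "pt i q s \<in> E i" using s by (auto simp: E_def)
      ultimately show "\<exists>s\<in>E i \<inter> level (Ts ! i) (R q). (p, s) \<in> Ts ! i" using pt(2)[OF i s(1)] by blast
    qed
    ultimately show ?thesis by blast
  qed
  consider "\<forall>k. mono_lift B d c (\<lambda>_. []) k True" | n t where "t \<in> tups B d n" "\<forall>k. mono_lift B d c t k False"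
    using Halpern_Lauchli_sequences[OF B, of d c] by blast
  then show thesis
  proof cases
    case 1
    have "(\<lambda>_. []) \<in> tups B d 0" by (simp add: tups_def)
    from main[OF this, of True] 1 obtain Ds' where Ds': "vector_subset Ts Ds'"
      "\<forall>t\<in>level_product Ts Ds'. t \<in> level_product Ts Ds \<and> lev t \<in> range r \<and> \<kappa> t = True"
      "\<forall>i<d. dense_above (Ts ! i) (nd i []) (Ds' ! i)" by blast
    have "dense_in (Ts ! i) (Ds' ! i)" if i: "i < d" for i
    proof -
      interpret infinite_tree "Ts ! i" by (rule infinite_tree_nth[OF i])
      have "Ds' ! i \<subseteq> Field (Ts ! i)" using Ds'(1) i by (simp add: vector_subset_def)
      moreover have "dense_above (Ts ! i) tree_root (Ds' ! i)"
        using Ds'(3)[rule_format, OF i] by (simp add: nd_def node_simps)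
      ultimately show ?thesis by (intro dense_above_root)
    qed
    then have "dense_vector_subset Ts Ds'" using Ds'(1) by (simp add: dense_vector_subset_def)
    with Ds'(1,2) show thesis by (intro that(1)[of Ds']) auto
  next
    case 2
    from main[OF 2(1), of False] 2(2) obtain Ds' where Ds': "vector_subset Ts Ds'"
      "\<forall>t\<in>level_product Ts Ds'. t \<in> level_product Ts Ds \<and> lev t \<in> range r \<and> \<kappa> t = False"
      "\<forall>i<d. dense_above (Ts ! i) (nd i (t i)) (Ds' ! i)" by blast
    define \<tau> where "\<tau> = map (\<lambda>i. nd i (t i)) [0..<d]"
    have lt: "\<tau> ! i \<in> level (Ts ! i) n" if "i < d" for i
      using ndl[OF that, of "t i" n] 2(1) that by (simp add: \<tau>_def tups_def)
    then have "lev \<tau> = n" using d_pos by (auto simp: lev_def level_def)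
    then have "\<tau> \<in> tree_product Ts" using lt by (simp add: tree_product_iff) (simp add: \<tau>_def)
    moreover have "dense_vector_subset_above Ts \<tau> Ds'"
      using Ds'(1,3) by (simp add: dense_vector_subset_above_def \<tau>_def)
    ultimately show thesis using Ds'(1,2) by (intro that(2)[of Ds' \<tau>]) auto
  qed
qed

text \<open>
  By \<open>fusion\<close> there are owners such that membership of a union in \<open>P\<close> depends on the minimum of its index set
  alone; the Halpern-Lauchli theorem is applied to this colouring \<open>\<kappa>\<close> of the retained indices.
\<close>

lemma disjoint_unions_dichotomy:
  assumes P: "P \<in> souslin_measurable_sets (min_sets_topology Ts)"
    and D: "dense_vector_subset Ts Ds" and U: "is_subspace Ts Ds U"
  shows "\<exists>Ds' U'. is_subspace Ts Ds' U' \<and>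
           subspace_span Ts Ds' U' \<subseteq> subspace_span Ts Ds U \<and>
           ((subspace_span Ts Ds' U' \<subseteq> P \<and> dense_vector_subset Ts Ds') \<or>
            (subspace_span Ts Ds' U' \<subseteq> min_sets Ts - P \<and>
             (\<exists>t \<in> tree_product Ts. dense_vector_subset_above Ts t Ds')))"
proof -
  have len: "length Ds = d" using U by (simp add: is_subspace_def vector_subset_def)
  let ?Q = "level_product Ts Ds"
  have Q: "?Q \<subseteq> tree_product Ts" using level_product_iff[OF len] by blast
  interpret levelled_poset ?Q lev "coord_le Ts" by (rule levelled_poset[OF Q])
  define f where "f \<Gamma> = (\<Union>t\<in>\<Gamma>. U t)" for \<Gamma>
  have bp: "baire_wrt cylinders (f -` P)" using baire_preimage[OF P U] by (simp add: f_def[abs_def])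
  obtain F :: "nat \<Rightarrow> 'a list set set" where F: "\<forall>n. nowhere_dense_wrt cylinders (F n)"
    "\<forall>b\<in>cylinders. \<exists>b'\<in>cylinders. b' \<subseteq> b \<and> (b' - (\<Union>n. F n) \<subseteq> f -` P \<or> (b' - (\<Union>n. F n)) \<inter> f -` P = {})"
    using baire_decided[OF countable_cylinders bp] by (elim exE conjE) (rule that; assumption)
  let ?L = "{n. level (Ts ! 0) n \<inter> Ds ! 0 \<noteq> {}}"
  have L: "infinite ?L"
    using infinite_tree.dense_inD(1)[OF infinite_tree_nth[OF d_pos]] D d_pos by (simp add: dense_vector_subset_def)
  obtain r :: "nat \<Rightarrow> nat" and ow where r: "strict_mono r" "range r \<subseteq> ?L"
    and ow1: "\<forall>s\<in>?Q. lev s \<in> range r \<longrightarrow> ow s = Some s"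
    and ow2: "\<forall>s\<in>?Q. \<forall>t. ow s = Some t \<longrightarrow> t \<in> ?Q \<and> lev t \<in> range r \<and> coord_le Ts t s"
    and col: "\<forall>t\<in>?Q. lev t \<in> range r \<longrightarrow> (\<exists>\<epsilon>. \<forall>\<Gamma>. \<Gamma> \<subseteq> {s \<in> ?Q. lev s \<in> range r} \<longrightarrow> t \<in> \<Gamma> \<longrightarrow>
       (\<forall>s\<in>\<Gamma>. coord_le Ts t s) \<longrightarrow> ({s \<in> ?Q. \<exists>u\<in>\<Gamma>. ow s = Some u} \<in> f -` P) = \<epsilon>)"
    using fusion[OF L F(1)[rule_format] F(2)] by (elim exE conjE) (rule that; assumption)
  let ?R = "{s \<in> ?Q. lev s \<in> range r}"
  define G where "G \<Gamma> = {s \<in> ?Q. \<exists>u\<in>\<Gamma>. ow s = Some u}" for \<Gamma>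
  define \<kappa> where "\<kappa> t \<longleftrightarrow> f (G {t}) \<in> P" for t
  have \<kappa>: "f (G \<Gamma>) \<in> P \<longleftrightarrow> \<kappa> t" if "\<Gamma> \<subseteq> ?R" "t \<in> \<Gamma>" "\<forall>s\<in>\<Gamma>. coord_le Ts t s" for \<Gamma> t
  proof -
    have t: "t \<in> ?Q" "lev t \<in> range r" using that by auto
    have "\<exists>\<epsilon>. \<forall>\<Gamma>. \<Gamma> \<subseteq> ?R \<longrightarrow> t \<in> \<Gamma> \<longrightarrow> (\<forall>s\<in>\<Gamma>. coord_le Ts t s) \<longrightarrow> (G \<Gamma> \<in> f -` P) = \<epsilon>"
      unfolding G_def by (rule col[THEN bspec, OF t(1), THEN mp, OF t(2)])
    then obtain \<epsilon> where e: "\<forall>\<Gamma>. \<Gamma> \<subseteq> ?R \<longrightarrow> t \<in> \<Gamma> \<longrightarrow> (\<forall>s\<in>\<Gamma>. coord_le Ts t s) \<longrightarrow> (G \<Gamma> \<in> f -` P) = \<epsilon>" ..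
    have "(G \<Gamma> \<in> f -` P) = \<epsilon>" using e that by simp
    moreover have "(G {t} \<in> f -` P) = \<epsilon>" using e t le_refl[OF t(1)] by simp
    ultimately show ?thesis by (simp add: \<kappa>_def)
  qed
  define U' where "U' t = f (G {t})" for t
  have UG: "(\<Union>t\<in>\<Gamma>. U' t) = f (G \<Gamma>)" for \<Gamma> by (auto simp: U'_def f_def G_def)
  have GQ: "G \<Gamma> \<subseteq> ?Q" for \<Gamma> by (auto simp: G_def)
  \<comment> \<open>Every element has at most one owner, so the new family is disjoint because the old one is.\<close>
  have dis: "disjoint_family_on U ?Q" using U by (simp add: is_subspace_def)
  have sub: "is_subspace Ts Ds' U' \<and> subspace_span Ts Ds' U' \<subseteq> subspace_span Ts Ds U \<and>
      (\<forall>V\<in>subspace_span Ts Ds' U'. V \<in> min_sets Ts \<and> (V \<in> P) = \<epsilon>)"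
    if vs: "vector_subset Ts Ds'" and R: "level_product Ts Ds' \<subseteq> ?R"
      and e: "\<And>t. t \<in> level_product Ts Ds' \<Longrightarrow> \<kappa> t = \<epsilon>" for Ds' \<epsilon>
  proof -
    have "U' t \<in> min_sets Ts \<and> is_minimum Ts (U' t) t" if t: "t \<in> level_product Ts Ds'" for t
    proof -
      have tR: "t \<in> ?Q" "lev t \<in> range r" using t R by auto
      have "t \<in> G {t}" using ow1 tR by (simp add: G_def)
      moreover have "\<forall>s\<in>G {t}. coord_le Ts t s" using ow2 by (auto simp: G_def)
      ultimately show ?thesis using union_has_min[OF U GQ] unfolding U'_def f_def by blast
    qed
    moreover have "U' s \<inter> U' t = {}" if "s \<noteq> t" for s t
    proof -
      have False if "x \<in> U a" "a \<in> G {s}" "x \<in> U b" "b \<in> G {t}" for x a b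
      proof -
        have "a = b" using that dis GQ unfolding disjoint_family_on_def by (metis IntI empty_iff subsetD)
        then show False using that \<open>s \<noteq> t\<close> by (auto simp: G_def)
      qed
      then show ?thesis by (auto simp: U'_def f_def)
    qed
    ultimately have sp: "is_subspace Ts Ds' U'"
      using vs by (auto simp: is_subspace_def disjoint_family_on_def)
    have len': "length Ds' = d" using vs by (simp add: vector_subset_def)
    have "subspace_span Ts Ds' U' \<subseteq> subspace_span Ts Ds U"
    proof
      fix V assume "V \<in> subspace_span Ts Ds' U'"
      then obtain \<Gamma> where "V = (\<Union>t\<in>\<Gamma>. U' t)" "V \<in> min_sets Ts" unfolding subspace_span_def by blast
      then have "V = (\<Union>t\<in>G \<Gamma>. U t)" "V \<in> min_sets Ts" by (simp_all add: UG) (simp add: f_def)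
      then show "V \<in> subspace_span Ts Ds U" unfolding subspace_span_def using GQ[of \<Gamma>] by blast
    qed
    moreover have "V \<in> min_sets Ts \<and> (V \<in> P) = \<epsilon>" if V: "V \<in> subspace_span Ts Ds' U'" for V
    proof -
      obtain \<Gamma> where \<Gamma>: "\<Gamma> \<subseteq> level_product Ts Ds'" "V = (\<Union>t\<in>\<Gamma>. U' t)" "V \<in> min_sets Ts"
        using V unfolding subspace_span_def by blast
      obtain t where t: "t \<in> \<Gamma>" "\<forall>s\<in>\<Gamma>. coord_le Ts t s"
        using union_min_inv[OF sp len' \<Gamma>(1)] \<Gamma>(2,3) by blast
      have "\<Gamma> \<subseteq> ?R" using \<Gamma>(1) R by (rule order_trans)
      then have "(V \<in> P) = \<kappa> t" using \<kappa>[OF _ t] \<Gamma>(2) UG by simp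
      then show ?thesis using e \<Gamma>(1,3) t(1) by blast
    qed
    ultimately show ?thesis using sp by blast
  qed
  show ?thesis
  proof (rule Halpern_Lauchli[OF D r, of \<kappa>])
    fix Ds' assume a: "vector_subset Ts Ds'" "\<And>t. t \<in> level_product Ts Ds' \<Longrightarrow> t \<in> level_product Ts Ds \<and> lev t \<in> range r"
      "\<And>t. t \<in> level_product Ts Ds' \<Longrightarrow> \<kappa> t" "dense_vector_subset Ts Ds'"
    have "level_product Ts Ds' \<subseteq> ?R" using a(2) by blast
    from sub[OF a(1) this, of True] a(3) have s: "is_subspace Ts Ds' U'"
      "subspace_span Ts Ds' U' \<subseteq> subspace_span Ts Ds U" "subspace_span Ts Ds' U' \<subseteq> P" by auto
    show ?thesis using s a(4) by (intro exI[of _ Ds'] exI[of _ U']) simp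
  next
    fix Ds' t assume a: "vector_subset Ts Ds'" "\<And>t. t \<in> level_product Ts Ds' \<Longrightarrow> t \<in> level_product Ts Ds \<and> lev t \<in> range r"
      "\<And>t. t \<in> level_product Ts Ds' \<Longrightarrow> \<not> \<kappa> t" "t \<in> tree_product Ts" "dense_vector_subset_above Ts t Ds'"
    have "level_product Ts Ds' \<subseteq> ?R" using a(2) by blast
    from sub[OF a(1) this, of False] a(3) have s: "is_subspace Ts Ds' U'"
      "subspace_span Ts Ds' U' \<subseteq> subspace_span Ts Ds U" "subspace_span Ts Ds' U' \<subseteq> min_sets Ts - P" by auto
    show ?thesis using s a(4,5) by (intro exI[of _ Ds'] exI[of _ U']) auto
  qed
qed

end

theorem theorem3:
  fixes Ts :: "'a rel list"
    and P :: "'a list set set"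
    and Ds :: "'a set list"
    and U :: "'a list \<Rightarrow> 'a list set"
  assumes "vector_tree Ts"
    and "vheight Ts = \<infinity>"
    and "P \<in> souslin_measurable_sets (min_sets_topology Ts)"
    and "dense_vector_subset Ts Ds"
    and "is_subspace Ts Ds U"
  shows "\<exists>Ds' U'. is_subspace Ts Ds' U' \<and>
           subspace_span Ts Ds' U' \<subseteq> subspace_span Ts Ds U \<and>
           ((subspace_span Ts Ds' U' \<subseteq> P \<and> dense_vector_subset Ts Ds') \<or>
            (subspace_span Ts Ds' U' \<subseteq> min_sets Ts - P \<and>
             (\<exists>t \<in> tree_product Ts. dense_vector_subset_above Ts t Ds')))"
proof -
  interpret infinite_vector_tree Ts by standard (fact assms(1), fact assms(2))
  show ?thesis using disjoint_unions_dichotomy[OF assms(3-5)] .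
qed

end
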